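(* Let $R$ be a trinomial algebra of Type $1$ over an algebraically closed field $\Bbbk$ of characteristic zero. Then $R$ is semirigid if and only if one of the following conditions holds: (a) $R$ is rigid; (b) $d=1$ and the trinomial algebra $R_1$, obtained from $R$ by excluding $S_1$ from the system of generators, is rigid; (c) $d=0$; there exists an $i_0\in\{1,\dots,r\}$ such that $T_{i_0}^{l_{i_0}}=T_{i_01}^{l_{i_01}}$ (i.e. $n_{i_0}=1$) and $l_{i_01}>1$; and for each $i\ne i_0$ there exists a $c_i\in\{1,\dots,n_i\}$ such that $l_{ic_i}=1$ and $l_{ij}>1$ whenever $j\ne c_i$.
   Context: Trinomial algebra of Type $1$: fix integers $r\ge2$, $d\ge0$, $n_i\ge1$ ($i=1,\dots,r$), positive integers $l_{ij}$ ($1\le j\le n_i$), and pairwise distinct $a_1,\dots,a_r\in\Bbbk$. Put $T_i^{l_i}=\prod_{j=1}^{n_i}T_{ij}^{l_{ij}}$. Then $R$ is the quotient of the polynomial algebra $\Bbbk[T_{ij},S_k\mid 1\le i\le r,\,1\le j\le n_i,\,1\le k\le d]$ by the ideal generated by $T_i^{l_i}-T_{i+1}^{l_{i+1}}-(a_{i+1}-a_i)$, $i=1,\dots,r-1$. (It is a normal domain.) A derivation $\delta$ of $R$ is locally nilpotent (an LND) if for each $f\in R$ there is $n>0$ with $\delta^n(f)=0$. An algebra is rigid if it admits no nonzero LND. Two LNDs are equivalent if their kernels coincide; an algebra is semirigid if all its nonzero LNDs are equivalent to each other.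
   Formalization: The case d=0 with n_i=1 and l_{i1}=1 for all i is excluded: there R is a polynomial algebra in one variable, which is semirigid although (a), (b) and (c) all fail. *)

theory Defs
  imports
    "HOL-Algebra.Algebra"
    "HOL-Algebra.Algebraic_Closure_Type"
    "HOL-Library.Poly_Mapping"
begin

section \<open>Locally nilpotent derivations\<close>

definition derivation ::
    "('k, 'm) ring_scheme \<Rightarrow> ('k, 'a, 'n) module_scheme \<Rightarrow> ('a \<Rightarrow> 'a) \<Rightarrow> bool" where
  "derivation K A \<delta> \<longleftrightarrow>
     \<delta> \<in> carrier A \<rightarrow> carrier A \<and>
     (\<forall>f\<in>carrier A. \<forall>g\<in>carrier A. \<delta> (f \<oplus>\<^bsub>A\<^esub> g) = \<delta> f \<oplus>\<^bsub>A\<^esub> \<delta> g) \<and>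
     (\<forall>c\<in>carrier K. \<forall>f\<in>carrier A. \<delta> (c \<odot>\<^bsub>A\<^esub> f) = c \<odot>\<^bsub>A\<^esub> \<delta> f) \<and>
     (\<forall>f\<in>carrier A. \<forall>g\<in>carrier A.
        \<delta> (f \<otimes>\<^bsub>A\<^esub> g) = (\<delta> f \<otimes>\<^bsub>A\<^esub> g) \<oplus>\<^bsub>A\<^esub> (f \<otimes>\<^bsub>A\<^esub> \<delta> g))"

definition lnd ::
    "('k, 'm) ring_scheme \<Rightarrow> ('k, 'a, 'n) module_scheme \<Rightarrow> ('a \<Rightarrow> 'a) \<Rightarrow> bool" where
  "lnd K A \<delta> \<longleftrightarrow>
     derivation K A \<delta> \<and> (\<forall>f\<in>carrier A. \<exists>n>0. (\<delta> ^^ n) f = \<zero>\<^bsub>A\<^esub>)"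

text \<open>A derivation is a HOL function, hence unconstrained outside the carrier; it is nonzero
  if it does not vanish identically on the carrier.\<close>

definition nonzero_lnd ::
    "('k, 'm) ring_scheme \<Rightarrow> ('k, 'a, 'n) module_scheme \<Rightarrow> ('a \<Rightarrow> 'a) \<Rightarrow> bool" where
  "nonzero_lnd K A \<delta> \<longleftrightarrow> lnd K A \<delta> \<and> (\<exists>f\<in>carrier A. \<delta> f \<noteq> \<zero>\<^bsub>A\<^esub>)"

definition lnd_equivalent :: "('k, 'a, 'n) module_scheme \<Rightarrow> ('a \<Rightarrow> 'a) \<Rightarrow> ('a \<Rightarrow> 'a) \<Rightarrow> bool" where
  "lnd_equivalent A \<delta> \<delta>' \<longleftrightarrow> a_kernel A A \<delta> = a_kernel A A \<delta>'"

definition rigid :: "('k, 'm) ring_scheme \<Rightarrow> ('k, 'a, 'n) module_scheme \<Rightarrow> bool" where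
  "rigid K A \<longleftrightarrow> \<not> (\<exists>\<delta>. nonzero_lnd K A \<delta>)"

definition semirigid :: "('k, 'm) ring_scheme \<Rightarrow> ('k, 'a, 'n) module_scheme \<Rightarrow> bool" where
  "semirigid K A \<longleftrightarrow>
     (\<forall>\<delta> \<delta>'. nonzero_lnd K A \<delta> \<longrightarrow> nonzero_lnd K A \<delta>' \<longrightarrow> lnd_equivalent A \<delta> \<delta>')"


section \<open>Polynomial algebras and their quotients\<close>

text \<open>Polynomials in variables from \<open>'x\<close> are finitely supported functions from monomials
  (finitely supported exponent vectors) to coefficients; their multiplication is convolution.
  The number of variables is a value, not a type: \<open>mpoly_ring V\<close> consists of the polynomials
  all of whose monomials involve only variables in \<open>V\<close>.\<close>

type_synonym ('x, 'k) mpol = "('x \<Rightarrow>\<^sub>0 nat) \<Rightarrow>\<^sub>0 'k"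

definition mconst :: "'k::comm_ring_1 \<Rightarrow> ('x, 'k) mpol" where
  "mconst c = Poly_Mapping.single 0 c"

definition mvar :: "'x \<Rightarrow> ('x, 'k::comm_ring_1) mpol" where
  "mvar x = Poly_Mapping.single (Poly_Mapping.single x 1) 1"

definition mpoly_ring :: "'x set \<Rightarrow> ('x, 'k::comm_ring_1) mpol ring" where
  "mpoly_ring V =
     ring_of_type_algebra\<lparr>carrier := {p. \<forall>m\<in>Poly_Mapping.keys p. Poly_Mapping.keys m \<subseteq> V}\<rparr>"

definition quot_algebra ::
    "'x set \<Rightarrow> ('x, 'k::comm_ring_1) mpol set \<Rightarrow> ('k, ('x, 'k) mpol set) module" where
  "quot_algebra V I = ring.extend (mpoly_ring V Quot I)
     (module.fields (\<lambda>c x. (I +>\<^bsub>mpoly_ring V\<^esub> mconst c) \<otimes>\<^bsub>mpoly_ring V Quot I\<^esub> x))"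


section \<open>Trinomial algebras of Type 1\<close>

datatype tvar = T nat nat | S nat

definition tvars :: "nat \<Rightarrow> (nat \<Rightarrow> nat) \<Rightarrow> nat \<Rightarrow> tvar set" where
  "tvars r n d = {T i j |i j. i \<in> {1..r} \<and> j \<in> {1..n i}} \<union> {S k |k. k \<in> {1..d}}"

definition tmonom ::
    "(nat \<Rightarrow> nat) \<Rightarrow> (nat \<Rightarrow> nat \<Rightarrow> nat) \<Rightarrow> nat \<Rightarrow> (tvar, 'k::comm_ring_1) mpol" where
  "tmonom n l i = (\<Prod>j\<in>{1..n i}. mvar (T i j) ^ l i j)"

definition trinomials ::
    "nat \<Rightarrow> (nat \<Rightarrow> nat) \<Rightarrow> (nat \<Rightarrow> nat \<Rightarrow> nat) \<Rightarrow> (nat \<Rightarrow> 'k::comm_ring_1)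
     \<Rightarrow> (tvar, 'k) mpol set" where
  "trinomials r n l a =
     (\<lambda>i. tmonom n l i - tmonom n l (i + 1) - mconst (a (i + 1) - a i)) ` {1..<r}"

definition trinomial_algebra ::
    "nat \<Rightarrow> (nat \<Rightarrow> nat) \<Rightarrow> (nat \<Rightarrow> nat \<Rightarrow> nat) \<Rightarrow> (nat \<Rightarrow> 'k::comm_ring_1) \<Rightarrow> nat
     \<Rightarrow> ('k, (tvar, 'k) mpol set) module" where
  "trinomial_algebra r n l a d =
     quot_algebra (tvars r n d) (Idl\<^bsub>mpoly_ring (tvars r n d)\<^esub> (trinomials r n l a))"


section \<open>Well-definedness\<close>

lemma mpoly_ring_simps [simp]:
  "carrier (mpoly_ring V) = {p. \<forall>m\<in>Poly_Mapping.keys p. Poly_Mapping.keys m \<subseteq> V}"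
  "x \<otimes>\<^bsub>mpoly_ring V\<^esub> y = x * y" "x \<oplus>\<^bsub>mpoly_ring V\<^esub> y = x + y"
  "\<one>\<^bsub>mpoly_ring V\<^esub> = 1" "\<zero>\<^bsub>mpoly_ring V\<^esub> = 0"
  by (simp_all add: mpoly_ring_def ring_of_type_algebra_def)

lemma mult_mem_mpoly_ring:
  assumes "p \<in> carrier (mpoly_ring V)" "q \<in> carrier (mpoly_ring V)"
  shows "p * q \<in> carrier (mpoly_ring V)"
proof -
  have "Poly_Mapping.keys m \<subseteq> V" if m: "m \<in> Poly_Mapping.keys (p * q)" for m
  proof -
    obtain m1 m2 where "m = m1 + m2" "m1 \<in> Poly_Mapping.keys p" "m2 \<in> Poly_Mapping.keys q"
      using m keys_mult[of p q] by blast
    thus ?thesis using assms Poly_Mapping.keys_add[of m1 m2] by fastforce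
  qed
  thus ?thesis by simp
qed

lemma add_mem_mpoly_ring:
  assumes "p \<in> carrier (mpoly_ring V)" "q \<in> carrier (mpoly_ring V)"
  shows "p + q \<in> carrier (mpoly_ring V)"
  using assms Poly_Mapping.keys_add[of p q] by auto

lemma diff_mem_mpoly_ring:
  assumes "p \<in> carrier (mpoly_ring V)" "q \<in> carrier (mpoly_ring V)"
  shows "p - q \<in> carrier (mpoly_ring V)"
  using assms keys_diff[of p q] by auto

lemma zero_mem_mpoly_ring: "0 \<in> carrier (mpoly_ring V)"
  and one_mem_mpoly_ring: "1 \<in> carrier (mpoly_ring V)"
  by simp_all

lemma mconst_mem_mpoly_ring: "mconst c \<in> carrier (mpoly_ring V)"
  by (auto simp: mconst_def)

lemma mvar_mem_mpoly_ring: "x \<in> V \<Longrightarrow> mvar x \<in> carrier (mpoly_ring V)"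
  by (auto simp: mvar_def)

lemma cring_mpoly_ring: "cring (mpoly_ring V :: ('x, 'k::comm_ring_1) mpol ring)"
proof (intro cringI abelian_groupI comm_monoidI)
  fix x :: "('x, 'k) mpol" assume "x \<in> carrier (mpoly_ring V)"
  thus "\<exists>y\<in>carrier (mpoly_ring V). y \<oplus>\<^bsub>mpoly_ring V\<^esub> x = \<zero>\<^bsub>mpoly_ring V\<^esub>"
    by (intro bexI[of _ "- x"]) auto
qed (auto simp: algebra_simps simp del: mpoly_ring_simps(1)
       intro: mult_mem_mpoly_ring add_mem_mpoly_ring zero_mem_mpoly_ring one_mem_mpoly_ring)

lemma tmonom_mem_mpoly_ring:
  assumes "i \<in> {1..r}"
  shows "(tmonom n l i :: (tvar, 'k::comm_ring_1) mpol) \<in> carrier (mpoly_ring (tvars r n d))"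
proof -
  have pow: "p ^ e \<in> carrier (mpoly_ring (tvars r n d))"
    if "p \<in> carrier (mpoly_ring (tvars r n d))" for p :: "(tvar, 'k) mpol" and e
    by (induction e) (simp_all only: power_0 power_Suc one_mem_mpoly_ring mult_mem_mpoly_ring that)
  have "(\<Prod>j\<in>J. (mvar (T i j) :: (tvar, 'k) mpol) ^ l i j) \<in> carrier (mpoly_ring (tvars r n d))"
    if "finite J" "J \<subseteq> {1..n i}" for J
    using that
  proof (induction J rule: finite_induct)
    case (insert j J)
    have "T i j \<in> tvars r n d" using insert.prems assms by (auto simp: tvars_def)
    hence "(mvar (T i j) :: (tvar, 'k) mpol) ^ l i j \<in> carrier (mpoly_ring (tvars r n d))"
      by (intro pow mvar_mem_mpoly_ring)
    moreover have "(\<Prod>j\<in>J. (mvar (T i j) :: (tvar, 'k) mpol) ^ l i j)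
        \<in> carrier (mpoly_ring (tvars r n d))"
      using insert by blast
    ultimately show ?case unfolding prod.insert[OF insert.hyps] by (rule mult_mem_mpoly_ring)
  qed (simp only: prod.empty one_mem_mpoly_ring)
  thus ?thesis by (simp only: tmonom_def finite_atLeastAtMost subset_refl)
qed

lemma trinomials_subset:
  "(trinomials r n l a :: (tvar, 'k::comm_ring_1) mpol set) \<subseteq> carrier (mpoly_ring (tvars r n d))"
  unfolding trinomials_def
  by (intro image_subsetI diff_mem_mpoly_ring tmonom_mem_mpoly_ring mconst_mem_mpoly_ring) auto

lemma quot_algebra_simps [simp]:
  "carrier (quot_algebra V I) = carrier (mpoly_ring V Quot I)"
  "x \<otimes>\<^bsub>quot_algebra V I\<^esub> y = x \<otimes>\<^bsub>mpoly_ring V Quot I\<^esub> y"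
  "x \<oplus>\<^bsub>quot_algebra V I\<^esub> y = x \<oplus>\<^bsub>mpoly_ring V Quot I\<^esub> y"
  "\<one>\<^bsub>quot_algebra V I\<^esub> = \<one>\<^bsub>mpoly_ring V Quot I\<^esub>"
  "\<zero>\<^bsub>quot_algebra V I\<^esub> = \<zero>\<^bsub>mpoly_ring V Quot I\<^esub>"
  "c \<odot>\<^bsub>quot_algebra V I\<^esub> x = (I +>\<^bsub>mpoly_ring V\<^esub> mconst c) \<otimes>\<^bsub>mpoly_ring V Quot I\<^esub> x"
  by (simp_all add: quot_algebra_def ring.defs module.defs)

lemma algebra_quot_algebra:
  fixes I :: "('x, 'k::comm_ring_1) mpol set"
  assumes "ideal I (mpoly_ring V)"
  shows "algebra ring_of_type_algebra (quot_algebra V I)"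
proof -
  let ?P = "mpoly_ring V :: ('x, 'k) mpol ring"
  interpret P: cring ?P by (rule cring_mpoly_ring)
  interpret I: ideal I ?P by fact
  interpret Q: cring "?P Quot I" by (rule I.quotient_is_cring[OF P.is_cring])
  interpret h: ring_hom_ring ?P "?P Quot I" "(+>\<^bsub>?P\<^esub>) I" by (rule I.rcos_ring_hom_ring)
  have c: "I +>\<^bsub>?P\<^esub> mconst c \<in> carrier (?P Quot I)" for c
    by (rule h.hom_closed[OF mconst_mem_mpoly_ring])
  have add: "I +>\<^bsub>?P\<^esub> mconst (b + c)
      = (I +>\<^bsub>?P\<^esub> mconst b) \<oplus>\<^bsub>?P Quot I\<^esub> (I +>\<^bsub>?P\<^esub> mconst c)" for b c
    using h.hom_add[OF mconst_mem_mpoly_ring mconst_mem_mpoly_ring, of b c]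
    by (simp add: mconst_def single_add)
  have mult: "I +>\<^bsub>?P\<^esub> mconst (b * c)
      = (I +>\<^bsub>?P\<^esub> mconst b) \<otimes>\<^bsub>?P Quot I\<^esub> (I +>\<^bsub>?P\<^esub> mconst c)" for b c
    using h.hom_mult[OF mconst_mem_mpoly_ring mconst_mem_mpoly_ring, of b c]
    by (simp add: mconst_def mult_single)
  have one: "I +>\<^bsub>?P\<^esub> mconst 1 = \<one>\<^bsub>?P Quot I\<^esub>"
    using h.hom_one by (simp add: mconst_def)
  have inv: "\<exists>y\<in>carrier (?P Quot I). y \<oplus>\<^bsub>?P Quot I\<^esub> x = \<zero>\<^bsub>?P Quot I\<^esub>"
    if "x \<in> carrier (?P Quot I)" for x
    using that Q.l_neg Q.a_inv_closed by blast
  have Q: "cring (quot_algebra V I)"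
    by (intro cringI abelian_groupI comm_monoidI)
       (auto simp: Q.a_assoc Q.m_assoc Q.l_distr inv intro!: Q.a_comm Q.m_comm)
  show ?thesis
    by (rule algebraI[OF cring_from_type_algebra Q])
       (auto simp: ring_of_type_algebra_def c add mult one
          Q.l_distr Q.r_distr Q.m_assoc Q.m_lcomm)
qed

theorem algebra_trinomial_algebra:
  "algebra ring_of_type_algebra (trinomial_algebra r n l a d :: ('k::comm_ring_1, _) module)"
proof -
  interpret cring "mpoly_ring (tvars r n d) :: (tvar, 'k) mpol ring" by (rule cring_mpoly_ring)
  show ?thesis
    unfolding trinomial_algebra_def
    by (intro algebra_quot_algebra genideal_ideal trinomials_subset)
qed

text \<open>If \<open>d = 0\<close> and every \<open>T\<^sub>i\<^sup>l\<^sup>i\<close> is a single variable \<open>T\<^sub>i\<^sub>1\<close>, then all relations are linear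
  and the trinomial algebra is a polynomial algebra in one variable: semirigid, not rigid, and
  satisfying none of the conditions that characterize semirigidity in all other cases. The
  characterization therefore has to exclude these data.\<close>

end

theory Submission
  imports Defs "HOL-Computational_Algebra.Polynomial_FPS" "HOL-Library.Nat_Bijection"
begin

text \<open>
  Every \<open>T\<^sub>i\<^sup>l\<^sup>i + a\<^sub>i\<close> is the same function \<open>w\<close> on the variety. Taking roots of \<open>w - a\<^sub>i\<close> in a power
  series ring embeds the algebra into a domain of Laurent polynomials, where \<open>\<partial>/\<partial>w\<close> lives.

  Case \<open>d = 0\<close>. If all exponents of \<open>T\<^sub>i\<^sup>l\<^sup>i\<close> and \<open>T\<^sub>k\<^sup>l\<^sup>k\<close> exceed \<open>1\<close>, an LND kills both monomials by a
  Mason--Stothers argument on their constant difference, hence is zero; so for a nonzero LND all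
  indices \<open>i\<close> but at most one, \<open>i\<^sub>0\<close>, have a \<open>c\<^sub>i\<close> with exponent \<open>1\<close>. Conversely such data give an LND, a multiple
  of \<open>\<partial>/\<partial>w\<close>, whose kernel contains \<open>T\<^sub>i\<^sub>j\<close> exactly for \<open>j \<noteq> c\<^sub>i\<close>; semirigidity forces these choices to be
  unique, which is (c). Given (c), a grading argument puts these \<open>T\<^sub>i\<^sub>j\<close> in the kernel of every LND,
  and any two derivations vanishing on them are proportional.

  Case \<open>d = 1\<close>. The top component in \<open>S\<^sub>1\<close> of an LND shows that over a rigid \<open>R\<^sub>1\<close> all LNDs kill \<open>R\<^sub>1\<close>,
  while an LND of \<open>R\<^sub>1\<close> extends by \<open>0\<close> and is not equivalent to \<open>\<partial>/\<partial>S\<^sub>1\<close>. For \<open>d \<ge> 2\<close> compare \<open>\<partial>/\<partial>S\<^sub>1\<close> and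
  \<open>\<partial>/\<partial>S\<^sub>2\<close>.
\<close>

\<comment> \<open>The obstacle is that the algebra is given as a quotient, while additivity of
  degrees needs a domain. Reduction by the relations spans it, over the polynomials in
  \<open>w\<close>, by the monomials that no \<open>tmonom n l i\<close> divides. At the generic
  point such a monomial becomes a Laurent monomial times a product of fractional powers of the
  \<open>w - a\<^sub>i\<close>. If two of them share the Laurent monomial, some fractional exponents
  differ by a non-integer, and residues of logarithmic derivatives exclude a linear relation over
  the polynomials. So evaluation is injective, the algebra is a domain, and every additive weight on
  Laurent exponents grades it. The generic point depends on one index \<open>c\<^sub>i\<close> for
  each \<open>i\<close>: that variable is solved for, while the others are monomials in parameters,
  hence constants of \<open>\<partial>/\<partial>w\<close>. Changing \<open>c\<close> changes the
  killed variables, but also the embedding. Derivations from two choices therefore meet only after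
  transport to the quotient, through their values on the classes of the variables.\<close>
alias lookup = Poly_Mapping.lookup
alias keys = Poly_Mapping.keys
alias single = Poly_Mapping.single

section \<open>Locally nilpotent derivations of a domain\<close>

text \<open>Algebras are subsets of one ambient domain rather than records, so that ring identities
  and cancellation are those of the type. Closure under subtraction follows because
  \<open>\<iota> (- 1)\<close> is \<open>- 1\<close>.\<close>

locale subalgebra =
  fixes A :: "'d::idom set" and \<iota> :: "'k::field_char_0 \<Rightarrow> 'd"
  assumes const_add: "\<iota> (b + c) = \<iota> b + \<iota> c"
    and const_mult: "\<iota> (b * c) = \<iota> b * \<iota> c"
    and const_1: "\<iota> 1 = 1"
    and const_in: "\<iota> c \<in> A"
    and add_in: "f \<in> A \<Longrightarrow> g \<in> A \<Longrightarrow> f + g \<in> A"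
    and mult_in: "f \<in> A \<Longrightarrow> g \<in> A \<Longrightarrow> f * g \<in> A"
begin

lemma const_0: "\<iota> 0 = 0"
  using const_add[of 0 0] by (metis add_0 add_cancel_left_right)

lemma const_minus: "\<iota> (- c) = - \<iota> c"
  using const_add[of c "- c"] const_0 by (simp add: eq_neg_iff_add_eq_0 add.commute)

lemma zero_in: "0 \<in> A" and one_in: "1 \<in> A"
  using const_in[of 0] const_in[of 1] by (simp_all add: const_0 const_1)

lemma uminus_in: "f \<in> A \<Longrightarrow> - f \<in> A"
  using mult_in[OF const_in[of "- 1"], of f] by (simp add: const_minus const_1)

lemma diff_in: "f \<in> A \<Longrightarrow> g \<in> A \<Longrightarrow> f - g \<in> A"
  using add_in[of f "- g"] uminus_in by simp

lemma power_in: "f \<in> A \<Longrightarrow> f ^ n \<in> A"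
  by (induction n) (auto intro: one_in mult_in)

lemma sum_in: "(\<And>j. j \<in> J \<Longrightarrow> f j \<in> A) \<Longrightarrow> sum f J \<in> A"
  by (induction J rule: infinite_finite_induct) (auto intro: zero_in add_in)

lemma prod_in: "(\<And>j. j \<in> J \<Longrightarrow> f j \<in> A) \<Longrightarrow> prod f J \<in> A"
  by (induction J rule: infinite_finite_induct) (auto intro: one_in mult_in)

lemma const_of_nat: "\<iota> (of_nat n) = of_nat n"
  by (induction n) (simp_all add: const_0 const_1 const_add)

lemma of_nat_in: "of_nat n \<in> A"
  using const_in[of "of_nat n"] by (simp add: const_of_nat)

lemma const_eq_0_iff: "\<iota> c = 0 \<longleftrightarrow> c = 0"
  using const_mult[of c "inverse c"] const_0 const_1 by (cases "c = 0") auto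

lemma of_nat_nonzero: "n > 0 \<Longrightarrow> (of_nat n :: 'd) \<noteq> 0"
  using const_eq_0_iff[of "of_nat n"] by (simp add: const_of_nat)

end

locale alg_derivation = subalgebra A \<iota>
  for A :: "'d::idom set" and \<iota> :: "'k::field_char_0 \<Rightarrow> 'd" +
  fixes \<delta> :: "'d \<Rightarrow> 'd"
  assumes der_in: "f \<in> A \<Longrightarrow> \<delta> f \<in> A"
    and der_add: "f \<in> A \<Longrightarrow> g \<in> A \<Longrightarrow> \<delta> (f + g) = \<delta> f + \<delta> g"
    and der_scale: "f \<in> A \<Longrightarrow> \<delta> (\<iota> c * f) = \<iota> c * \<delta> f"
    and der_mult: "f \<in> A \<Longrightarrow> g \<in> A \<Longrightarrow> \<delta> (f * g) = \<delta> f * g + f * \<delta> g"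
begin

lemma der_0: "\<delta> 0 = 0"
  using der_add[OF zero_in zero_in] by (metis add_0 add_cancel_left_right)

lemma der_const: "\<delta> (\<iota> c) = 0"
proof -
  have "\<delta> 1 = 0"
    using der_mult[OF one_in one_in] by (metis mult_1 mult_1_right add_cancel_left_right)
  thus ?thesis using der_scale[OF one_in, of c] by simp
qed

lemma der_sum: "(\<And>j. j \<in> J \<Longrightarrow> f j \<in> A) \<Longrightarrow> \<delta> (sum f J) = (\<Sum>j\<in>J. \<delta> (f j))"
  by (induction J rule: infinite_finite_induct) (auto simp: der_0 der_add sum_in)

lemma der_power: "f \<in> A \<Longrightarrow> \<delta> (f ^ n) = of_nat n * f ^ (n - 1) * \<delta> f"
proof (induction n)
  case 0
  show ?case using der_const[of 1] by (simp add: const_1)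
next
  case (Suc n)
  have "\<delta> (f ^ Suc n) = \<delta> f * f ^ n + f * (of_nat n * f ^ (n - 1) * \<delta> f)"
    using Suc by (simp add: der_mult power_in)
  also have "f * (of_nat n * f ^ (n - 1) * \<delta> f) = of_nat n * f ^ n * \<delta> f"
    by (cases n) simp_all
  finally show ?case by (simp add: algebra_simps)
qed

lemma iter_in: "f \<in> A \<Longrightarrow> (\<delta> ^^ n) f \<in> A"
  by (induction n) (auto intro: der_in)

lemma iter_0: "(\<delta> ^^ n) 0 = 0"
  by (induction n) (auto simp: der_0)

lemma iter_add: "f \<in> A \<Longrightarrow> g \<in> A \<Longrightarrow> (\<delta> ^^ n) (f + g) = (\<delta> ^^ n) f + (\<delta> ^^ n) g"
  by (induction n) (simp_all add: der_add iter_in)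

lemma iter_eq_0_mono: "(\<delta> ^^ m) f = 0 \<Longrightarrow> m \<le> n \<Longrightarrow> (\<delta> ^^ n) f = 0"
  using funpow_add[of "n - m" m \<delta>] iter_0[of "n - m"] by (simp add: comp_def)

text \<open>In the Leibniz expansion every other summand has more than \<open>m\<close> derivatives
  on \<open>f\<close> or more than \<open>n\<close> on \<open>g\<close>. Induction on
  \<open>m + n\<close> avoids writing the expansion; Pascal's rule combines the binomial
  coefficients.\<close>

lemma iter_mult_top:
  assumes "f \<in> A" "g \<in> A" "(\<delta> ^^ Suc m) f = 0" "(\<delta> ^^ Suc n) g = 0"
  shows "(\<delta> ^^ (m + n)) (f * g) = of_nat ((m + n) choose m) * (\<delta> ^^ m) f * (\<delta> ^^ n) g"
  using assms
proof (induction "m + n" arbitrary: m n f g)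
  case 0
  thus ?case by simp
next
  case (Suc s)
  have iter: "(\<delta> ^^ Suc s) (f * g) = (\<delta> ^^ s) (\<delta> f * g) + (\<delta> ^^ s) (f * \<delta> g)"
    using Suc.prems by (simp add: funpow_Suc_right der_mult iter_add mult_in der_in del: funpow.simps)
  have shift: "(\<delta> ^^ p) (\<delta> h) = (\<delta> ^^ Suc p) h" for p h
    by (simp add: funpow_Suc_right del: funpow.simps)
  have left: "(\<delta> ^^ s) (\<delta> f * g) = (if m = 0 then 0 else of_nat (s choose (m - 1)) * (\<delta> ^^ m) f * (\<delta> ^^ n) g)"
  proof (cases m)
    case 0
    thus ?thesis using Suc.prems by (simp add: iter_0)
  next
    case (Suc m')
    have "s = m' + n" using Suc.hyps(2) Suc by simp
    from Suc.hyps(1)[OF this, of "\<delta> f" g] show ?thesis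
      using Suc.prems Suc \<open>s = m' + n\<close> by (simp add: shift der_in del: funpow.simps)
  qed
  have right: "(\<delta> ^^ s) (f * \<delta> g) = (if n = 0 then 0 else of_nat (s choose m) * (\<delta> ^^ m) f * (\<delta> ^^ n) g)"
  proof (cases n)
    case 0
    thus ?thesis using Suc.prems by (simp add: iter_0)
  next
    case (Suc n')
    have "s = m + n'" using Suc.hyps(2) Suc by simp
    from Suc.hyps(1)[OF this, of f "\<delta> g"] show ?thesis
      using Suc.prems Suc \<open>s = m + n'\<close> by (simp add: shift der_in del: funpow.simps)
  qed
  have choose: "of_nat (Suc s choose m) =
      ((if m = 0 then 0 else of_nat (s choose (m - 1))) + (if n = 0 then 0 else of_nat (s choose m)) :: 'd)"
  proof (cases m)
    case 0
    thus ?thesis using Suc.hyps(2) by simp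
  next
    case (Suc m')
    thus ?thesis using Suc.hyps(2) by (cases n) (simp_all add: binomial_eq_0)
  qed
  have "(\<delta> ^^ (m + n)) (f * g) = (\<delta> ^^ Suc s) (f * g)" by (simp only: Suc.hyps(2))
  also have "\<dots> = of_nat (Suc s choose m) * (\<delta> ^^ m) f * (\<delta> ^^ n) g"
    unfolding iter left right choose by (simp add: algebra_simps)
  finally show ?case by (simp only: Suc.hyps(2))
qed

lemma iter_mult_eq_0:
  assumes "f \<in> A" "g \<in> A" "(\<delta> ^^ Suc m) f = 0" "(\<delta> ^^ Suc n) g = 0"
  shows "(\<delta> ^^ Suc (m + n)) (f * g) = 0"
proof -
  have "(\<delta> ^^ Suc (m + n)) (f * g) = \<delta> (\<iota> (of_nat ((m + n) choose m)) * ((\<delta> ^^ m) f * (\<delta> ^^ n) g))"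
    using iter_mult_top[OF assms] unfolding funpow.simps comp_def const_of_nat mult.assoc by (rule arg_cong)
  also have "\<dots> = \<iota> (of_nat ((m + n) choose m)) * \<delta> ((\<delta> ^^ m) f * (\<delta> ^^ n) g)"
    using assms by (intro der_scale mult_in iter_in)
  also have "\<dots> = 0" using assms by (simp add: der_mult iter_in)
  finally show ?thesis .
qed

lemma nilpotent_add:
  assumes "f \<in> A" "g \<in> A" "\<exists>n. (\<delta> ^^ n) f = 0" "\<exists>n. (\<delta> ^^ n) g = 0"
  shows "\<exists>n. (\<delta> ^^ n) (f + g) = 0"
proof -
  obtain m n where "(\<delta> ^^ m) f = 0" "(\<delta> ^^ n) g = 0" using assms by blast
  hence "(\<delta> ^^ max m n) (f + g) = 0"
    using iter_eq_0_mono[of m f "max m n"] iter_eq_0_mono[of n g "max m n"] assms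
    by (simp add: iter_add)
  thus ?thesis ..
qed

lemma nilpotent_mult:
  assumes "f \<in> A" "g \<in> A" "\<exists>n. (\<delta> ^^ n) f = 0" "\<exists>n. (\<delta> ^^ n) g = 0"
  shows "\<exists>n. (\<delta> ^^ n) (f * g) = 0"
proof -
  obtain m n where "(\<delta> ^^ m) f = 0" "(\<delta> ^^ n) g = 0" using assms by blast
  hence "(\<delta> ^^ Suc m) f = 0" "(\<delta> ^^ Suc n) g = 0" by (simp_all add: der_0)
  from iter_mult_eq_0[OF assms(1,2) this] show ?thesis by blast
qed

lemma nilpotent_power:
  assumes "f \<in> A" "\<exists>n. (\<delta> ^^ n) f = 0"
  shows "\<exists>n. (\<delta> ^^ n) (f ^ k) = 0"
proof (induction k)
  case 0
  show ?case using der_const[of 1] by (intro exI[of _ 1]) (simp add: const_1)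
next
  case (Suc k)
  show ?case unfolding power_Suc by (rule nilpotent_mult[OF assms(1) power_in[OF assms(1)] assms(2) Suc])
qed

lemma nilpotent_prod:
  assumes "\<And>j. j \<in> J \<Longrightarrow> f j \<in> A" "\<And>j. j \<in> J \<Longrightarrow> \<exists>n. (\<delta> ^^ n) (f j) = 0"
  shows "\<exists>n. (\<delta> ^^ n) (prod f J) = 0"
proof -
  have one: "\<exists>n. (\<delta> ^^ n) 1 = 0"
    using der_const[of 1] by (intro exI[of _ 1]) (simp add: const_1)
  show ?thesis
    using assms
    by (induction J rule: infinite_finite_induct) (auto simp: one intro!: nilpotent_mult prod_in)
qed

lemma scale_derivation:
  assumes "h \<in> A"
  shows "alg_derivation A \<iota> (\<lambda>f. h * \<delta> f)"
proof
  fix c f assume "f \<in> A"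
  thus "h * \<delta> (\<iota> c * f) = \<iota> c * (h * \<delta> f)" by (simp add: der_scale)
qed (auto simp: der_in der_add der_mult assms mult_in algebra_simps)

end

section \<open>The degree function of a locally nilpotent derivation\<close>

locale alg_lnd = alg_derivation A \<iota> \<delta>
  for A :: "'d::idom set" and \<iota> :: "'k::field_char_0 \<Rightarrow> 'd" and \<delta> +
  assumes nilpotent: "f \<in> A \<Longrightarrow> \<exists>n. (\<delta> ^^ n) f = 0"
begin

text \<open>The degree function of \<open>\<delta>\<close>. The least exponent gives
  \<open>nu 0 = 0\<close> instead of minus infinity, hence the nonvanishing assumptions that
  accompany it.\<close>

definition nu :: "'d \<Rightarrow> nat" where
  "nu f = (LEAST n. (\<delta> ^^ Suc n) f = 0)"

lemma iter_Suc_nu: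
  assumes "f \<in> A"
  shows "(\<delta> ^^ Suc (nu f)) f = 0"
proof -
  obtain n where "(\<delta> ^^ n) f = 0" using nilpotent[OF assms] by blast
  hence "(\<delta> ^^ Suc n) f = 0" by (simp add: der_0)
  thus ?thesis unfolding nu_def by (rule LeastI)
qed

lemma iter_nu:
  assumes "f \<in> A" "f \<noteq> 0"
  shows "(\<delta> ^^ nu f) f \<noteq> 0"
proof (cases "nu f")
  case (Suc n)
  hence "n < nu f" by simp
  hence "(\<delta> ^^ Suc n) f \<noteq> 0" unfolding nu_def by (rule not_less_Least)
  thus ?thesis using Suc by simp
qed (use assms in simp)

lemma nu_eqI:
  assumes "(\<delta> ^^ n) f \<noteq> 0" "(\<delta> ^^ Suc n) f = 0"
  shows "nu f = n"
  unfolding nu_def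
proof (rule Least_equality)
  fix m assume "(\<delta> ^^ Suc m) f = 0"
  thus "n \<le> m" using iter_eq_0_mono[of "Suc m" f n] assms(1) by (meson not_less_eq_eq)
qed fact

lemma nu_eq_0_iff: "f \<in> A \<Longrightarrow> f \<noteq> 0 \<Longrightarrow> nu f = 0 \<longleftrightarrow> \<delta> f = 0"
  using iter_Suc_nu[of f] nu_eqI[of 0 f] by auto

lemma nu_der:
  assumes "f \<in> A" "\<delta> f \<noteq> 0"
  shows "nu f = Suc (nu (\<delta> f))"
proof (rule nu_eqI)
  show "(\<delta> ^^ Suc (nu (\<delta> f))) f \<noteq> 0" "(\<delta> ^^ Suc (Suc (nu (\<delta> f)))) f = 0"
    using iter_nu[OF der_in[OF assms(1)] assms(2)] iter_Suc_nu[OF der_in[OF assms(1)]]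
    by (simp_all add: funpow_Suc_right del: funpow.simps)
qed

text \<open>The top iterate of a product is a binomial coefficient times the product of the top
  iterates, which is nonzero in a domain of characteristic zero.\<close>

lemma nu_mult:
  assumes "f \<in> A" "g \<in> A" "f \<noteq> 0" "g \<noteq> 0"
  shows "nu (f * g) = nu f + nu g"
proof (rule nu_eqI)
  have "(of_nat ((nu f + nu g) choose nu f) :: 'd) \<noteq> 0" by (rule of_nat_nonzero) simp
  thus "(\<delta> ^^ (nu f + nu g)) (f * g) \<noteq> 0"
    using iter_mult_top[OF assms(1,2) iter_Suc_nu iter_Suc_nu] assms iter_nu by simp
  show "(\<delta> ^^ Suc (nu f + nu g)) (f * g) = 0"
    using assms by (intro iter_mult_eq_0 iter_Suc_nu)
qed

lemma nu_power: "f \<in> A \<Longrightarrow> f \<noteq> 0 \<Longrightarrow> nu (f ^ n) = n * nu f"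
  by (induction n) (use nu_eqI[of 0 1] der_const[of 1] in \<open>auto simp: nu_mult power_in const_1\<close>)

text \<open>Degrees add and are nonnegative, so a product of degree zero has factors of degree
  zero.\<close>

lemma factorially_closed:
  assumes "f \<in> A" "g \<in> A" "f * g \<noteq> 0" "\<delta> (f * g) = 0"
  shows "\<delta> f = 0"
  using assms nu_mult[of f g] nu_eq_0_iff[of "f * g"] nu_eq_0_iff[of f] by (simp add: mult_in)

lemma factorially_closed_prod:
  assumes "finite J" "\<And>j. j \<in> J \<Longrightarrow> x j \<in> A" "\<And>j. j \<in> J \<Longrightarrow> x j \<noteq> 0"
    "\<And>j. j \<in> J \<Longrightarrow> e j \<ge> (1::nat)" "\<delta> (\<Prod>j\<in>J. x j ^ e j) = 0" "i \<in> J"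
  shows "\<delta> (x i) = 0"
proof -
  define h where "h = x i ^ (e i - 1) * (\<Prod>j\<in>J - {i}. x j ^ e j)"
  have "x i ^ e i = x i * x i ^ (e i - 1)" using assms(4)[OF assms(6)] by (cases "e i") simp_all
  hence eq: "(\<Prod>j\<in>J. x j ^ e j) = x i * h"
    using prod.remove[OF assms(1,6), of "\<lambda>j. x j ^ e j"] by (simp add: h_def mult.assoc)
  have "h \<in> A" unfolding h_def using assms by (intro mult_in power_in prod_in) auto
  moreover have "x i * h \<noteq> 0" unfolding eq[symmetric] using assms by simp
  ultimately show ?thesis using factorially_closed[of "x i" h] assms eq by simp
qed

text \<open>A nonzero \<open>\<delta> f\<close> has degree one less than \<open>f\<close>, whereas a
  nonzero multiple of \<open>f\<close> has at least the degree of \<open>f\<close>.\<close>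

lemma der_eq_0_if_dvd:
  assumes "f \<in> A" "h \<in> A" "\<delta> f = f * h"
  shows "\<delta> f = 0"
proof (rule ccontr)
  assume "\<delta> f \<noteq> 0"
  hence "f \<noteq> 0" "h \<noteq> 0" using assms by auto
  thus False using nu_mult[of f h] nu_der[OF assms(1) \<open>\<delta> f \<noteq> 0\<close>] assms by simp
qed

text \<open>By the product rule each summand of the derivative has at most one exponent lowered, and
  that by one, so \<open>f0 J\<close> divides both \<open>f J\<close> and its derivative. The degree
  bound comes from \<open>e \<le> 2 * (e - 1)\<close> for \<open>e \<ge> 2\<close>; a factor in the
  kernel has degree zero, so its exponent may be \<open>1\<close>.\<close>

lemma prod_reduced:
  assumes "finite J" "\<And>j. j \<in> J \<Longrightarrow> x j \<in> A" "\<And>j. j \<in> J \<Longrightarrow> x j \<noteq> 0"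
    "\<And>j. j \<in> J \<Longrightarrow> e j \<ge> (1::nat)" "\<And>j. j \<in> J \<Longrightarrow> e j \<ge> 2 \<or> \<delta> (x j) = 0"
  defines "f \<equiv> \<lambda>J. \<Prod>j\<in>J. x j ^ e j" and "f0 \<equiv> \<lambda>J. \<Prod>j\<in>J. x j ^ (e j - 1)"
  shows "(\<exists>h\<in>A. f J = f0 J * h) \<and> (\<exists>h\<in>A. \<delta> (f J) = f0 J * h) \<and> nu (f J) \<le> 2 * nu (f0 J)"
  using assms(1-5)
proof (induction J rule: finite_induct)
  case empty
  have "nu 1 = 0" "\<delta> 1 = 0" using nu_power[OF one_in, of 0] der_const[of 1] by (simp_all add: const_1)
  thus ?case by (auto simp: f_def f0_def intro!: bexI[of _ 1] bexI[of _ 0] one_in zero_in)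
next
  case (insert i J)
  have fin: "f J \<in> A" "f0 J \<in> A" "f J \<noteq> 0" "f0 J \<noteq> 0"
    using insert by (auto simp: f_def f0_def intro!: prod_in power_in)
  have x: "x i \<in> A" "x i \<noteq> 0" "e i \<ge> 1" "e i \<ge> 2 \<or> \<delta> (x i) = 0" using insert by auto
  obtain h h' where h: "h \<in> A" "f J = f0 J * h" and h': "h' \<in> A" "\<delta> (f J) = f0 J * h'"
    and le: "nu (f J) \<le> 2 * nu (f0 J)"
    using insert.IH insert.prems by blast
  have f: "f (insert i J) = x i ^ e i * f J" and f0: "f0 (insert i J) = x i ^ (e i - 1) * f0 J"
    using insert.hyps by (simp_all add: f_def f0_def)
  have pow: "x i ^ e i = x i ^ (e i - 1) * x i" using x(3) by (cases "e i") simp_all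
  have "f (insert i J) = f0 (insert i J) * (x i * h)"
    by (simp add: f f0 h(2) pow)
  moreover have "\<delta> (f (insert i J)) = f0 (insert i J) * (of_nat (e i) * \<delta> (x i) * h + x i * h')"
    unfolding f der_mult[OF power_in[OF x(1)] fin(1)] der_power[OF x(1)] h'(2) f0
    unfolding pow h(2) by (simp add: algebra_simps)
  moreover have "nu (f (insert i J)) \<le> 2 * nu (f0 (insert i J))"
  proof -
    have "e i * nu (x i) \<le> 2 * ((e i - 1) * nu (x i))"
    proof (cases "\<delta> (x i) = 0")
      case True
      thus ?thesis using nu_eq_0_iff[OF x(1,2)] by simp
    next
      case False
      hence "e i \<le> 2 * (e i - 1)" using x(4) by simp
      hence "e i * nu (x i) \<le> 2 * (e i - 1) * nu (x i)" by (rule mult_right_mono) simp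
      thus ?thesis by (simp only: mult.assoc)
    qed
    moreover have "nu (f (insert i J)) = e i * nu (x i) + nu (f J)"
      "nu (f0 (insert i J)) = (e i - 1) * nu (x i) + nu (f0 J)"
      using x fin by (simp_all add: f f0 nu_mult nu_power power_in)
    ultimately show ?thesis using le by linarith
  qed
  moreover have "x i * h \<in> A" "of_nat (e i) * \<delta> (x i) * h + x i * h' \<in> A"
    by (intro add_in mult_in of_nat_in der_in x h h')+
  ultimately show ?case by blast
qed

text \<open>A Mason--Stothers argument: the products \<open>f\<^sub>0\<close>, \<open>g\<^sub>0\<close> of the \<open>x\<^sub>j\<close>, \<open>y\<^sub>j\<close> with exponents lowered by
  one divide \<open>\<delta> f = \<delta> g\<close> as well as \<open>f\<close>, respectively \<open>g\<close>, so that \<open>f\<^sub>0 g\<^sub>0\<close> divides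
  \<open>\<kappa> \<delta> f = f \<delta> g - g \<delta> f\<close>, which is of too small degree.\<close>

lemma mason:
  assumes J: "finite J" "\<And>j. j \<in> J \<Longrightarrow> x j \<in> A" "\<And>j. j \<in> J \<Longrightarrow> x j \<noteq> 0"
    "\<And>j. j \<in> J \<Longrightarrow> e j \<ge> (1::nat)" "\<And>j. j \<in> J \<Longrightarrow> e j \<ge> 2 \<or> \<delta> (x j) = 0"
  assumes J': "finite J'" "\<And>j. j \<in> J' \<Longrightarrow> y j \<in> A" "\<And>j. j \<in> J' \<Longrightarrow> y j \<noteq> 0"
    "\<And>j. j \<in> J' \<Longrightarrow> e' j \<ge> (1::nat)" "\<And>j. j \<in> J' \<Longrightarrow> e' j \<ge> 2 \<or> \<delta> (y j) = 0"
  assumes eq: "(\<Prod>j\<in>J. x j ^ e j) = (\<Prod>j\<in>J'. y j ^ e' j) + \<kappa>"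
    and \<kappa>: "\<kappa> \<in> A" "\<delta> \<kappa> = 0" "\<kappa> \<noteq> 0"
  shows "\<delta> (\<Prod>j\<in>J. x j ^ e j) = 0"
proof (rule ccontr)
  define f f0 where "f = (\<Prod>j\<in>J. x j ^ e j)" and "f0 = (\<Prod>j\<in>J. x j ^ (e j - 1))"
  define g g0 where "g = (\<Prod>j\<in>J'. y j ^ e' j)" and "g0 = (\<Prod>j\<in>J'. y j ^ (e' j - 1))"
  have A: "f \<in> A" "f0 \<in> A" "g \<in> A" "g0 \<in> A" "f \<noteq> 0" "f0 \<noteq> 0" "g \<noteq> 0" "g0 \<noteq> 0"
    using J J' by (auto simp: f_def f0_def g_def g0_def intro!: prod_in power_in)
  assume "\<delta> (\<Prod>j\<in>J. x j ^ e j) \<noteq> 0"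
  hence nz: "\<delta> f \<noteq> 0" by (simp add: f_def)
  have fg: "f = g + \<kappa>" using eq by (simp add: f_def g_def)
  hence df: "\<delta> f = \<delta> g" using A \<kappa> by (simp add: der_add)
  obtain h1 h2 where h: "h1 \<in> A" "f = f0 * h1" "h2 \<in> A" "\<delta> f = f0 * h2" and le: "nu f \<le> 2 * nu f0"
    using prod_reduced[of J x e, OF J] unfolding f_def f0_def by blast
  obtain k1 k2 where k: "k1 \<in> A" "g = g0 * k1" "k2 \<in> A" "\<delta> g = g0 * k2" and le': "nu g \<le> 2 * nu g0"
    using prod_reduced[of J' y e', OF J'] unfolding g_def g0_def by blast
  have "\<kappa> * \<delta> f = f * \<delta> g - g * \<delta> f"
    unfolding df by (simp add: fg algebra_simps)
  also have "\<dots> = f0 * h1 * (g0 * k2) - g0 * k1 * (f0 * h2)"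
    using h(2,4) k(2,4) by simp
  also have "\<dots> = (f0 * g0) * (h1 * k2 - k1 * h2)" by (simp add: algebra_simps)
  finally have key: "\<kappa> * \<delta> f = (f0 * g0) * (h1 * k2 - k1 * h2)" .
  define m where "m = h1 * k2 - k1 * h2"
  have m: "m \<in> A" "m \<noteq> 0"
    using key nz \<kappa> h k by (auto simp: m_def intro!: diff_in mult_in)
  have "nu (\<kappa> * \<delta> f) = nu (\<delta> f)"
    using nu_mult[of \<kappa> "\<delta> f"] nz \<kappa> A nu_eq_0_iff[of \<kappa>] by (simp add: der_in)
  moreover have "nu (\<kappa> * \<delta> f) = nu f0 + nu g0 + nu m"
    using key m A by (simp add: m_def[symmetric] nu_mult mult_in)
  \<comment> \<open>Thus \<open>nu f = nu g\<close>, and adding the two bounds gives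
    \<open>nu f \<le> nu f0 + nu g0 \<le> nu (\<delta> f) = nu f - 1\<close>.\<close>
  moreover have "nu f = Suc (nu (\<delta> f))" "nu g = Suc (nu (\<delta> g))"
    using nu_der[OF A(1)] nu_der[OF A(3)] nz by (simp_all only: df not_False_eq_True)
  ultimately show False using le le' df by simp
qed

end

section \<open>Derivations and algebra generators\<close>

definition generated :: "('k \<Rightarrow> 'd::comm_ring_1) \<Rightarrow> 'd set \<Rightarrow> 'd set" where
  "generated \<iota> G =
     \<Inter> {B. range \<iota> \<subseteq> B \<and> G \<subseteq> B \<and> (\<forall>f\<in>B. \<forall>g\<in>B. f + g \<in> B \<and> f * g \<in> B)}"

lemma gen_const: "\<iota> c \<in> generated \<iota> G"
  and gen_var: "x \<in> G \<Longrightarrow> x \<in> generated \<iota> G"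
  and gen_add: "f \<in> generated \<iota> G \<Longrightarrow> g \<in> generated \<iota> G \<Longrightarrow> f + g \<in> generated \<iota> G"
  and gen_mult: "f \<in> generated \<iota> G \<Longrightarrow> g \<in> generated \<iota> G \<Longrightarrow> f * g \<in> generated \<iota> G"
  unfolding generated_def by blast+

lemma generated_induct [consumes 1, case_names const var add mult]:
  assumes "f \<in> generated \<iota> G"
    and "\<And>c. P (\<iota> c)"
    and "\<And>x. x \<in> G \<Longrightarrow> P x"
    and "\<And>f g. f \<in> generated \<iota> G \<Longrightarrow> g \<in> generated \<iota> G \<Longrightarrow> P f \<Longrightarrow> P g \<Longrightarrow> P (f + g)"
    and "\<And>f g. f \<in> generated \<iota> G \<Longrightarrow> g \<in> generated \<iota> G \<Longrightarrow> P f \<Longrightarrow> P g \<Longrightarrow> P (f * g)"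
  shows "P f"
proof -
  have "generated \<iota> G \<subseteq> {f \<in> generated \<iota> G. P f}"
    using assms(2-5)
    by (subst generated_def, intro Inter_lower) (auto simp: gen_const gen_var gen_add gen_mult)
  thus ?thesis using assms(1) by blast
qed

lemma (in alg_derivation) lnd_if_nilpotent_generators:
  assumes "A = generated \<iota> G" "\<And>x. x \<in> G \<Longrightarrow> \<exists>n. (\<delta> ^^ n) x = 0"
  shows "alg_lnd A \<iota> \<delta>"
proof
  fix f assume "f \<in> A"
  hence "f \<in> generated \<iota> G" using assms(1) by simp
  thus "\<exists>n. (\<delta> ^^ n) f = 0"
  proof (induction rule: generated_induct)
    case (const c)
    show ?case by (rule exI[of _ 1]) (simp add: der_const)
  next
    case (add f g)
    thus ?case using assms(1) by (intro nilpotent_add) auto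
  next
    case (mult f g)
    thus ?case using assms(1) by (intro nilpotent_mult) auto
  qed (use assms in blast)
qed

text \<open>Cross-multiplication compares the quotients of the derivations by \<open>h\<close> and
  \<open>h'\<close> without a field of fractions. The multipliers may lie outside
  \<open>A\<close>.\<close>

lemma proportional_derivations:
  assumes "alg_derivation A \<iota> \<delta>" "alg_derivation A \<iota> \<delta>'" "A = generated \<iota> G"
    and "\<And>x. x \<in> G \<Longrightarrow> h' * \<delta> x = h * \<delta>' x" "f \<in> A"
  shows "h' * \<delta> f = h * \<delta>' f"
proof -
  interpret d: alg_derivation A \<iota> \<delta> by fact
  interpret d': alg_derivation A \<iota> \<delta>' by fact
  from assms have "f \<in> generated \<iota> G" by simp
  thus ?thesis
  proof (induction rule: generated_induct)
    case (const c)
    show ?case by (simp add: d.der_const d'.der_const)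
  next
    case (add f g)
    thus ?case using assms(3) by (simp add: d.der_add d'.der_add distrib_left)
  next
    case (mult f g)
    have "h' * \<delta> (f * g) = (h' * \<delta> f) * g + f * (h' * \<delta> g)"
      using mult.hyps assms(3) by (simp add: d.der_mult algebra_simps)
    also have "\<dots> = h * \<delta>' (f * g)"
      using mult assms(3) by (simp add: d'.der_mult algebra_simps)
    finally show ?case .
  qed (use assms in blast)
qed

lemma proportional_kernels:
  assumes "alg_derivation A \<iota> \<delta>" "alg_derivation A \<iota> \<delta>'" "A = generated \<iota> G"
    and "\<And>x. x \<in> G \<Longrightarrow> h' * \<delta> x = h * \<delta>' x" "h \<noteq> 0" "h' \<noteq> 0" "f \<in> A"
  shows "\<delta> f = 0 \<longleftrightarrow> \<delta>' f = 0"
proof -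
  have eq: "h' * \<delta> f = h * \<delta>' f" by (rule proportional_derivations[OF assms(1-4,7)])
  have "\<delta> f = 0 \<longleftrightarrow> h' * \<delta> f = 0" using assms(6) by simp
  also have "\<dots> \<longleftrightarrow> \<delta>' f = 0" unfolding eq using assms(5) by simp
  finally show ?thesis .
qed

lemma (in alg_derivation) der_eq_0_if_generators:
  assumes "A = generated \<iota> G" "\<And>x. x \<in> G \<Longrightarrow> \<delta> x = 0" "f \<in> A"
  shows "\<delta> f = 0"
proof -
  have "f \<in> generated \<iota> G" using assms by simp
  thus ?thesis
    by (induction rule: generated_induct)
       (simp_all add: der_const assms(2) der_add der_mult assms(1))
qed

text \<open>This brings a derivation of the Laurent polynomials down to the coordinate ring, where
  stability has to be checked on generators only.\<close>

lemma (in alg_derivation) restrict_derivation: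
  assumes "subalgebra B \<iota>" "B = generated \<iota> G" "B \<subseteq> A" "\<And>x. x \<in> G \<Longrightarrow> \<delta> x \<in> B"
  shows "alg_derivation B \<iota> \<delta>"
proof -
  interpret B: subalgebra B \<iota> by fact
  show ?thesis
  proof
    fix f assume "f \<in> B"
    hence "f \<in> generated \<iota> G" using assms(2) by simp
    thus "\<delta> f \<in> B"
    proof (induction rule: generated_induct)
      case (const b)
      show ?case by (simp add: der_const B.zero_in)
    next
      case (var x)
      thus ?case by (rule assms(4))
    next
      case (add f g)
      hence "f \<in> A" "g \<in> A" using assms(2,3) by auto
      thus ?case using add.IH by (simp add: der_add B.add_in)
    next
      case (mult f g)
      hence "f \<in> A" "g \<in> A" "f \<in> B" "g \<in> B" using assms(2,3) by auto
      thus ?case using mult.IH by (simp add: der_mult B.add_in B.mult_in)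
    qed
  qed (use assms(3) in \<open>auto simp: der_add der_scale der_mult subset_iff\<close>)
qed

section \<open>Gradings\<close>

text \<open>The grading is a family of projections of the ambient domain under which
  \<open>A\<close> is stable. A component is then a function of the element, and no chosen
  decomposition has to be carried along.\<close>

locale graded_subalgebra = subalgebra A \<iota>
  for A :: "'d::idom set" and \<iota> :: "'k::field_char_0 \<Rightarrow> 'd" +
  fixes pr :: "int \<Rightarrow> 'd \<Rightarrow> 'd"
  assumes pr_add: "pr k (f + g) = pr k f + pr k g"
    and pr_pr: "pr k (pr j f) = (if k = j then pr j f else 0)"
    and finite_pr: "finite {k. pr k f \<noteq> 0}"
    and sum_pr: "(\<Sum>k | pr k f \<noteq> 0. pr k f) = f"
    and pr_mult: "pr i f = f \<Longrightarrow> pr j g = g \<Longrightarrow> pr (i + j) (f * g) = f * g"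
    and pr_const: "pr 0 (\<iota> c) = \<iota> c"
    and pr_in: "f \<in> A \<Longrightarrow> pr k f \<in> A"
begin

definition homog :: "int \<Rightarrow> 'd set" where
  "homog k = {f \<in> A. pr k f = f}"

lemma homog_in: "f \<in> homog k \<Longrightarrow> f \<in> A"
  by (simp add: homog_def)

lemma pr_homog: "f \<in> A \<Longrightarrow> pr k f \<in> homog k"
  by (simp add: homog_def pr_in pr_pr)

lemma pr_0: "pr k 0 = 0"
  using pr_add[of k 0 0] by (metis add_0 add_cancel_left_right)

lemma zero_homog: "0 \<in> homog k"
  by (simp add: homog_def zero_in pr_0)

lemma mult_homog: "f \<in> homog i \<Longrightarrow> g \<in> homog j \<Longrightarrow> f * g \<in> homog (i + j)"
  by (simp add: homog_def mult_in pr_mult)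

lemma const_homog: "\<iota> c \<in> homog 0"
  by (simp add: homog_def const_in pr_const)

lemma scale_homog: "f \<in> homog k \<Longrightarrow> \<iota> c * f \<in> homog k"
  using mult_homog[OF const_homog, of f k c] by simp

lemma pr_sum: "pr k (sum f J) = (\<Sum>j\<in>J. pr k (f j))"
  by (induction J rule: infinite_finite_induct) (simp_all add: pr_0 pr_add)

lemma pr_of_homog: "f \<in> homog j \<Longrightarrow> pr k f = (if k = j then f else 0)"
  using pr_pr[of k j f] by (auto simp: homog_def)

lemma homog_induct [consumes 1, case_names homog zero add]:
  assumes "f \<in> A" "\<And>k f. f \<in> homog k \<Longrightarrow> P f" "P 0"
    "\<And>f g. f \<in> A \<Longrightarrow> g \<in> A \<Longrightarrow> P f \<Longrightarrow> P g \<Longrightarrow> P (f + g)"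
  shows "P f"
proof -
  have "P (\<Sum>k\<in>K. pr k f)" for K
    by (induction K rule: infinite_finite_induct)
       (use assms in \<open>auto intro!: assms(4) sum_in pr_in intro: assms(2) pr_homog\<close>)
  from this[of "{k. pr k f \<noteq> 0}"] show ?thesis by (simp only: sum_pr)
qed

lemma pr_mult_homog:
  assumes "f \<in> homog i" "g \<in> A"
  shows "pr k (f * g) = f * pr (k - i) g"
  using assms(2)
proof (induction rule: homog_induct)
  case (homog j g)
  thus ?case
    using pr_of_homog[OF homog] pr_of_homog[OF mult_homog[OF assms(1) homog]] by (auto simp: pr_0)
qed (simp_all add: pr_0 pr_add distrib_left)

section \<open>Derivations assembled from homogeneous pieces\<close>

definition homog_ext :: "(int \<Rightarrow> 'd \<Rightarrow> 'd) \<Rightarrow> 'd \<Rightarrow> 'd" where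
  "homog_ext \<Delta> f = (\<Sum>k | pr k f \<noteq> 0. \<Delta> k (pr k f))"

context
  fixes \<Delta> :: "int \<Rightarrow> 'd \<Rightarrow> 'd"
  assumes \<Delta>_add: "\<And>k f g. f \<in> homog k \<Longrightarrow> g \<in> homog k \<Longrightarrow> \<Delta> k (f + g) = \<Delta> k f + \<Delta> k g"
begin

lemma \<Delta>_0: "\<Delta> k 0 = 0"
  using \<Delta>_add[OF zero_homog zero_homog, of k] by (metis add_0 add_cancel_left_right)

lemma homog_ext_homog:
  assumes "f \<in> homog k"
  shows "homog_ext \<Delta> f = \<Delta> k f"
proof (cases "f = 0")
  case False
  hence "{j. pr j f \<noteq> 0} = {k}" using pr_of_homog[OF assms] by auto
  thus ?thesis using assms by (simp add: homog_ext_def homog_def)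
qed (simp add: homog_ext_def pr_0 \<Delta>_0)

lemma homog_ext_superset:
  assumes "finite K" "{k. pr k f \<noteq> 0} \<subseteq> K"
  shows "homog_ext \<Delta> f = (\<Sum>k\<in>K. \<Delta> k (pr k f))"
  unfolding homog_ext_def using assms by (intro sum.mono_neutral_left) (auto simp: \<Delta>_0)

lemma homog_ext_add:
  assumes "f \<in> A" "g \<in> A"
  shows "homog_ext \<Delta> (f + g) = homog_ext \<Delta> f + homog_ext \<Delta> g"
proof -
  let ?K = "{k. pr k f \<noteq> 0} \<union> {k. pr k g \<noteq> 0}"
  have K: "finite ?K" "{k. pr k (f + g) \<noteq> 0} \<subseteq> ?K" "{k. pr k f \<noteq> 0} \<subseteq> ?K" "{k. pr k g \<noteq> 0} \<subseteq> ?K"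
    by (auto simp: finite_pr pr_add)
  show ?thesis
    unfolding homog_ext_superset[OF K(1,2)] homog_ext_superset[OF K(1,3)] homog_ext_superset[OF K(1,4)]
    using assms by (simp add: pr_add \<Delta>_add pr_homog sum.distrib)
qed

lemma homog_ext_derivation:
  assumes \<Delta>_in: "\<And>k f. f \<in> homog k \<Longrightarrow> \<Delta> k f \<in> A"
    and \<Delta>_mult: "\<And>i j f g. f \<in> homog i \<Longrightarrow> g \<in> homog j \<Longrightarrow>
      \<Delta> (i + j) (f * g) = \<Delta> i f * g + f * \<Delta> j g"
    and \<Delta>_scale: "\<And>k f c. f \<in> homog k \<Longrightarrow> \<Delta> k (\<iota> c * f) = \<iota> c * \<Delta> k f"
  shows "alg_derivation A \<iota> (homog_ext \<Delta>)"
proof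
  have ext_0: "homog_ext \<Delta> 0 = 0" using homog_ext_homog[OF zero_homog, of 0] \<Delta>_0 by simp
  show "homog_ext \<Delta> f \<in> A" if "f \<in> A" for f
    using that
    by (induction rule: homog_induct)
       (simp_all add: homog_ext_homog \<Delta>_in homog_ext_add add_in ext_0 zero_in)
  show "homog_ext \<Delta> (f + g) = homog_ext \<Delta> f + homog_ext \<Delta> g" if "f \<in> A" "g \<in> A" for f g
    using that by (rule homog_ext_add)
  show "homog_ext \<Delta> (\<iota> c * f) = \<iota> c * homog_ext \<Delta> f" if "f \<in> A" for c f
    using that
  proof (induction rule: homog_induct)
    case (homog k f)
    thus ?case by (simp add: homog_ext_homog[OF homog] homog_ext_homog[OF scale_homog[OF homog]] \<Delta>_scale)
  qed (simp_all add: ext_0 distrib_left homog_ext_add mult_in const_in)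
  show "homog_ext \<Delta> (f * g) = homog_ext \<Delta> f * g + f * homog_ext \<Delta> g" if "f \<in> A" "g \<in> A" for f g
    using that(1)
  proof (induction rule: homog_induct)
    case (homog i f)
    show ?case using that(2)
    proof (induction rule: homog_induct)
      case h: (homog j g)
      show ?case
        unfolding homog_ext_homog[OF mult_homog[OF homog h]] homog_ext_homog[OF homog]
          homog_ext_homog[OF h] by (rule \<Delta>_mult[OF homog h])
    qed (use homog_in[OF homog] in \<open>simp_all add: ext_0 distrib_left homog_ext_add mult_in\<close>)
  next
    case zero
    thus ?case by (simp add: ext_0)
  next
    case (add f f')
    thus ?case using that(2) by (simp add: homog_ext_add distrib_right mult_in algebra_simps)
  qed
qed

end

lemma lnd_if_nilpotent_homog:
  assumes "alg_derivation A \<iota> \<delta>" "\<And>k f. f \<in> homog k \<Longrightarrow> \<exists>n. (\<delta> ^^ n) f = 0"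
  shows "alg_lnd A \<iota> \<delta>"
proof -
  interpret d: alg_derivation A \<iota> \<delta> by fact
  show ?thesis
  proof
    fix f assume "f \<in> A"
    thus "\<exists>n. (\<delta> ^^ n) f = 0"
      by (induction rule: homog_induct) (auto intro: assms(2) d.nilpotent_add exI[of _ 0])
  qed
qed

section \<open>Lowest homogeneous components of derivations\<close>

definition shifts_by :: "('d \<Rightarrow> 'd) \<Rightarrow> int \<Rightarrow> bool" where
  "shifts_by \<delta> k \<longleftrightarrow> (\<forall>m. \<forall>f\<in>homog m. \<forall>i<m + k. pr i (\<delta> f) = 0)"

lemma shifts_byD:
  "shifts_by \<delta> k \<Longrightarrow> f \<in> homog m \<Longrightarrow> i < m + k \<Longrightarrow> pr i (\<delta> f) = 0"
  by (simp add: shifts_by_def)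

text \<open>The degree shifts of finitely many generators are bounded below, and the Leibniz rule
  passes such a bound on to products.\<close>

lemma shifts_by_exists:
  assumes "alg_derivation A \<iota> \<delta>" "A = generated \<iota> G" "finite G"
    and "\<And>x. x \<in> G \<Longrightarrow> \<exists>m. x \<in> homog m"
  shows "\<exists>k. shifts_by \<delta> k"
proof -
  interpret d: alg_derivation A \<iota> \<delta> by fact
  have bdd: "\<exists>k. \<forall>i<k. pr i f = 0" for f
  proof (cases "f = 0")
    case False
    hence "{k. pr k f \<noteq> 0} \<noteq> {}" using sum_pr[of f] by force
    thus ?thesis
      using Min_le[OF finite_pr, of _ f] by (intro exI[of _ "Min {k. pr k f \<noteq> 0}"]) force
  qed (simp add: pr_0)
  obtain deg where deg: "x \<in> homog (deg x)" if "x \<in> G" for x using assms(4) by metis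
  have "\<forall>x. \<exists>k. \<forall>i<k. pr i (\<delta> x) = 0" using bdd by blast
  then obtain low where low: "\<forall>x. \<forall>i<low x. pr i (\<delta> x) = 0" by (auto dest!: choice)
  \<comment> \<open>The inserted \<open>0\<close> makes the minimum defined when \<open>G\<close> is
    empty.\<close>
  define k where "k = Min (insert 0 ((\<lambda>x. low x - deg x) ` G))"
  have k: "k \<le> low x - deg x" if "x \<in> G" for x
    using that assms(3) by (auto simp: k_def intro: Min_le)
  \<comment> \<open>Sums mix degrees, so the induction needs a statement about every component of an
    arbitrary element.\<close>
  have "\<forall>m. \<forall>i<m + k. pr i (\<delta> (pr m f)) = 0" if "f \<in> A" for f
    using that unfolding assms(2)
  proof (induction rule: generated_induct)
    case (const c)
    show ?case by (simp add: pr_of_homog[OF const_homog] d.der_const d.der_0 pr_0)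
  next
    case (var x)
    show ?case using low k[OF var] by (auto simp: pr_of_homog[OF deg[OF var]] d.der_0 pr_0)
  next
    case (add f g)
    hence "f \<in> A" "g \<in> A" using assms(2) by simp_all
    thus ?case using add.IH by (simp add: pr_add d.der_add pr_in)
  next
    case (mult f g)
    hence fg: "f \<in> A" "g \<in> A" using assms(2) by simp_all
    show ?case
    proof (intro allI impI)
      fix m i assume i: "i < m + k"
      let ?K = "{j. pr j f \<noteq> 0}"
      have "pr m (f * g) = pr m ((\<Sum>j\<in>?K. pr j f) * g)" by (simp only: sum_pr)
      also have "\<dots> = (\<Sum>j\<in>?K. pr j f * pr (m - j) g)"
        by (simp add: sum_distrib_right pr_sum pr_mult_homog[OF pr_homog[OF fg(1)] fg(2)])
      finally have expand: "pr i (\<delta> (pr m (f * g))) = (\<Sum>j\<in>?K. pr i (\<delta> (pr j f * pr (m - j) g)))"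
        using fg by (simp add: d.der_sum pr_in mult_in pr_sum)
      moreover have "pr i (\<delta> (pr j f * pr (m - j) g)) = 0" for j
      proof -
        have "pr i (\<delta> (pr j f * pr (m - j) g)) =
            pr i (pr (m - j) g * \<delta> (pr j f)) + pr i (pr j f * \<delta> (pr (m - j) g))"
          using fg by (simp add: d.der_mult pr_in pr_add mult.commute)
        also have "\<dots> = pr (m - j) g * pr (i - (m - j)) (\<delta> (pr j f)) + pr j f * pr (i - j) (\<delta> (pr (m - j) g))"
          using fg by (simp add: pr_mult_homog[OF pr_homog] d.der_in pr_in)
        finally show ?thesis using mult.IH i by simp
      qed
      ultimately show "pr i (\<delta> (pr m (f * g))) = 0" by simp
    qed
  qed
  hence "shifts_by \<delta> k" unfolding shifts_by_def by (metis (mono_tags, lifting) homog_def mem_Collect_eq)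
  thus ?thesis ..
qed

text \<open>Taking the largest possible shift \<open>k\<close> makes the degree \<open>k\<close>
  part of \<open>\<delta>\<close> nonzero. Its iterates are the components of the iterates of
  \<open>\<delta>\<close> at the lowest degree allowed, so local nilpotency is inherited.\<close>

lemma bottom_component:
  assumes "alg_lnd A \<iota> \<delta>" "f\<^sub>0 \<in> A" "\<delta> f\<^sub>0 \<noteq> 0"
    and "A = generated \<iota> G" "finite G" "\<And>x. x \<in> G \<Longrightarrow> \<exists>m. x \<in> homog m"
  obtains k \<delta>' where "shifts_by \<delta> k" "alg_lnd A \<iota> \<delta>'" "\<exists>f\<in>A. \<delta>' f \<noteq> 0"
    "\<And>m f. f \<in> homog m \<Longrightarrow> \<delta>' f \<in> homog (m + k)"
proof -
  interpret d: alg_lnd A \<iota> \<delta> by fact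
  have "\<exists>m. \<exists>f\<in>homog m. \<delta> f \<noteq> 0"
  proof (rule ccontr)
    assume zero: "\<nexists>m. \<exists>f\<in>homog m. \<delta> f \<noteq> 0"
    have "\<delta> f = 0" if "f \<in> A" for f
      using that zero by (induction rule: homog_induct) (auto simp: d.der_0 d.der_add)
    thus False using assms by blast
  qed
  then obtain m f where f: "f \<in> homog m" "\<delta> f \<noteq> 0" by blast
  obtain i where i: "pr i (\<delta> f) \<noteq> 0" using sum_pr[of "\<delta> f"] f(2) by force
  have bound: "k \<le> i - m" if "shifts_by \<delta> k" for k
  proof (rule ccontr)
    assume "\<not> k \<le> i - m"
    thus False using that f(1) i by (auto simp: shifts_by_def)
  qed
  obtain k\<^sub>0 where k0: "shifts_by \<delta> k\<^sub>0"
    using shifts_by_exists[OF d.alg_derivation_axioms assms(4,5,6)] by blast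
  \<comment> \<open>The maximum over integers bounded by \<open>i - m\<close> is encoded as a least
    natural distance below that bound.\<close>
  define k where "k = i - m - int (LEAST j. shifts_by \<delta> (i - m - int j))"
  have ex: "shifts_by \<delta> (i - m - int (nat (i - m - k\<^sub>0)))" using k0 bound[OF k0] by simp
  have k: "shifts_by \<delta> k" unfolding k_def by (rule LeastI[of "\<lambda>j. shifts_by \<delta> (i - m - int j)", OF ex])
  have max: "\<not> shifts_by \<delta> (k + 1)"
  proof
    assume *: "shifts_by \<delta> (k + 1)"
    hence "(LEAST j. shifts_by \<delta> (i - m - int j)) \<le> nat (i - m - (k + 1))"
      using bound[OF *] by (intro Least_le) simp
    thus False using bound[OF *] by (simp add: k_def)
  qed
  define \<Delta> where "\<Delta> j f = pr (j + k) (\<delta> f)" for j f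
  have \<Delta>_add: "\<Delta> j (f + g) = \<Delta> j f + \<Delta> j g" if "f \<in> homog j" "g \<in> homog j" for j f g
    using that by (simp add: \<Delta>_def d.der_add homog_in pr_add)
  have \<Delta>_homog: "\<Delta> j f \<in> homog (j + k)" if "f \<in> homog j" for j f
    using that by (simp add: \<Delta>_def pr_homog d.der_in homog_in)
  have \<Delta>_scale: "\<Delta> j (\<iota> c * f) = \<iota> c * \<Delta> j f" if "f \<in> homog j" for j f c
    using that pr_mult_homog[OF const_homog d.der_in, of f "j + k" c]
    by (simp add: \<Delta>_def d.der_scale homog_in)
  have \<Delta>_mult: "\<Delta> (i + j) (f * g) = \<Delta> i f * g + f * \<Delta> j g" if f: "f \<in> homog i" and g: "g \<in> homog j" for i j f g
  proof -
    have "\<Delta> (i + j) (f * g) = pr (i + j + k) (g * \<delta> f) + pr (i + j + k) (f * \<delta> g)"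
      using f g by (simp add: \<Delta>_def d.der_mult homog_in pr_add mult.commute)
    also have "\<dots> = g * pr (i + j + k - j) (\<delta> f) + f * pr (i + j + k - i) (\<delta> g)"
      using pr_mult_homog[OF f d.der_in[OF homog_in[OF g]]] pr_mult_homog[OF g d.der_in[OF homog_in[OF f]]]
      by simp
    finally show ?thesis by (simp add: \<Delta>_def algebra_simps)
  qed
  define \<delta>' where "\<delta>' = homog_ext \<Delta>"
  have \<delta>': "\<delta>' f = \<Delta> j f" if "f \<in> homog j" for f j
    unfolding \<delta>'_def by (rule homog_ext_homog[OF \<Delta>_add that])
  have der: "alg_derivation A \<iota> \<delta>'"
    unfolding \<delta>'_def
    by (intro homog_ext_derivation \<Delta>_add \<Delta>_mult \<Delta>_scale homog_in[OF \<Delta>_homog])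
  have iter: "(\<delta>' ^^ n) f = pr (j + int n * k) ((\<delta> ^^ n) f) \<and> (\<forall>i<j + int n * k. pr i ((\<delta> ^^ n) f) = 0)"
    if f: "f \<in> homog j" for n f j
  proof (induction n)
    case 0
    show ?case using pr_of_homog[OF f] by simp
  next
    case (Suc n)
    define h where "h = (\<delta> ^^ n) f"
    have h: "h \<in> A" using f by (simp add: h_def d.iter_in homog_in)
    let ?e = "j + int n * k"
    have low: "pr i h = 0" if "i < ?e" for i using Suc that by (simp add: h_def)
    have step: "pr i (\<delta> h) = (if i = ?e + k then pr i (\<delta> (pr ?e h)) else 0)" if "i \<le> ?e + k" for i
    proof -
      have "pr i (\<delta> h) = pr i (\<delta> (\<Sum>l | pr l h \<noteq> 0. pr l h))" by (simp only: sum_pr)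
      also have "\<dots> = (\<Sum>l | pr l h \<noteq> 0. pr i (\<delta> (pr l h)))"
        using h by (simp add: d.der_sum pr_in pr_sum)
      \<comment> \<open>A summand of degree \<open>l\<close>, which is at least \<open>?e\<close>,
        contributes from degree \<open>l + k\<close> upwards. In degrees up to \<open>?e + k\<close>
        this leaves \<open>l = ?e\<close>.\<close>
      also have "\<dots> = (\<Sum>l | pr l h \<noteq> 0. if l = ?e \<and> i = ?e + k then pr i (\<delta> (pr ?e h)) else 0)"
      proof (rule sum.cong)
        fix l assume l: "l \<in> {l. pr l h \<noteq> 0}"
        hence "l \<ge> ?e" using low[of l] by (cases "l < ?e") auto
        moreover have "pr i (\<delta> (pr l h)) = 0" if "i < l + k"
          using k pr_homog[OF h] that by (auto simp: shifts_by_def)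
        ultimately show "pr i (\<delta> (pr l h)) = (if l = ?e \<and> i = ?e + k then pr i (\<delta> (pr ?e h)) else 0)"
          using \<open>i \<le> ?e + k\<close> by (cases "l = ?e") auto
      qed simp
      also have "\<dots> = (if i = ?e + k then pr i (\<delta> (pr ?e h)) else 0)"
        by (cases "pr ?e h = 0"; cases "i = ?e + k") (auto simp: finite_pr d.der_0 pr_0)
      finally show ?thesis .
    qed
    have "(\<delta>' ^^ Suc n) f = \<delta>' (pr ?e h)" using Suc by (simp add: h_def)
    also have "\<dots> = pr (?e + k) (\<delta> (pr ?e h))" using \<delta>'[OF pr_homog[OF h]] by (simp add: \<Delta>_def)
    also have "\<dots> = pr (?e + k) (\<delta> h)" using step[of "?e + k"] by simp
    finally have "(\<delta>' ^^ Suc n) f = pr (?e + k) (\<delta> h)" .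
    moreover have "?e + k = j + int (Suc n) * k" by (simp add: algebra_simps)
    moreover have "\<forall>i<?e + k. pr i (\<delta> h) = 0" using step by auto
    ultimately show ?case by (simp add: h_def)
  qed
  have lnd: "alg_lnd A \<iota> \<delta>'"
  proof (rule lnd_if_nilpotent_homog[OF der])
    fix j f assume f: "f \<in> homog j"
    obtain n where "(\<delta> ^^ n) f = 0" using d.nilpotent[OF homog_in[OF f]] by blast
    hence "(\<delta>' ^^ n) f = 0" using iter[OF f, of n] by (simp add: pr_0)
    thus "\<exists>n. (\<delta>' ^^ n) f = 0" ..
  qed
  have "\<exists>f\<in>A. \<delta>' f \<noteq> 0"
  proof (rule ccontr)
    assume zero: "\<not> (\<exists>f\<in>A. \<delta>' f \<noteq> 0)"
    have "shifts_by \<delta> (k + 1)"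
      unfolding shifts_by_def
    proof (intro allI ballI impI)
      fix j f i assume f: "f \<in> homog j" and i: "i < j + (k + 1)"
      show "pr i (\<delta> f) = 0"
      proof (cases "i = j + k")
        case True
        thus ?thesis using zero homog_in[OF f] \<delta>'[OF f] by (auto simp: \<Delta>_def)
      next
        case False
        thus ?thesis using k f i by (simp add: shifts_by_def)
      qed
    qed
    thus False using max by blast
  qed
  thus ?thesis using that[OF k lnd] \<delta>' \<Delta>_homog by auto
qed

end

section \<open>Radicals over a rational function field\<close>

text \<open>A root of the constant term, supplied by algebraic closure, lifts to the whole series
  because that term is nonzero.\<close>

lemma nth_root_fps_exists:
  fixes f :: "'k::{alg_closed_field, field_char_0} fps"
  assumes "fps_nth f 0 \<noteq> 0" "m > 0"
  shows "\<exists>g. g ^ m = f"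
proof -
  obtain y where "y ^ m = fps_nth f 0" using nth_root_exists[OF assms(2)] by metis
  moreover obtain m' where "m = Suc m'" using assms(2) by (cases m) auto
  ultimately have "fps_radical (\<lambda>_ _. y) m f ^ m = f"
    using power_radical[OF assms(1), of "\<lambda>_ _. y" m'] by simp
  thus ?thesis ..
qed

text \<open>A rational function whose logarithmic derivative has residue \<open>q\<close> at the simple pole \<open>\<alpha>\<close>
  has order \<open>q\<close> there.\<close>

lemma residue_in_Ints:
  fixes c c' H H\<^sub>0 \<theta> :: "'k::field_char_0 poly"
  assumes nz: "c \<noteq> 0" "c' \<noteq> 0"
    and H: "H = [:-\<alpha>, 1:] * H\<^sub>0" "poly H\<^sub>0 \<alpha> \<noteq> 0"
    and eq: "H * (c' * pderiv c - c * pderiv c') = c * c' * \<theta>"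
    and \<theta>: "poly \<theta> \<alpha> = q * poly H\<^sub>0 \<alpha>"
  shows "q \<in> \<int>"
proof -
  let ?p = "[:-\<alpha>, 1:]"
  obtain m where m: "c = ?p ^ order \<alpha> c * m" "\<not> ?p dvd m" using order_decomp[OF nz(1)] by blast
  obtain m' where m': "c' = ?p ^ order \<alpha> c' * m'" "\<not> ?p dvd m'" using order_decomp[OF nz(2)] by blast
  define i j where "i = order \<alpha> c" and "j = order \<alpha> c'"
  \<comment> \<open>Multiplying by \<open>?p\<close> restores the exponent, so that exponent zero
    obeys the same formula.\<close>
  have pd: "?p * pderiv (?p ^ k) = smult (of_nat k) (?p ^ k)" for k
    by (cases k) (simp_all add: pderiv_power_Suc pderiv_pCons smult_smult del: power_Suc, simp add: algebra_simps)
  have c: "c = ?p ^ i * m" and c': "c' = ?p ^ j * m'" using m m' by (simp_all add: i_def j_def)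
  have dc: "?p * pderiv c = ?p ^ i * (smult (of_nat i) m + ?p * pderiv m)"
    using arg_cong[OF pd[of i], of "\<lambda>u. u * m"] unfolding c pderiv_mult by (simp add: algebra_simps)
  have dc': "?p * pderiv c' = ?p ^ j * (smult (of_nat j) m' + ?p * pderiv m')"
    using arg_cong[OF pd[of j], of "\<lambda>u. u * m'"] unfolding c' pderiv_mult by (simp add: algebra_simps)
  have "?p ^ (i + j) * (m * m' * \<theta>) = c * c' * \<theta>"
    unfolding c c' by (simp add: power_add algebra_simps)
  also have "\<dots> = H\<^sub>0 * (c' * (?p * pderiv c) - c * (?p * pderiv c'))"
    unfolding eq[symmetric] H by (simp only: algebra_simps)
  also have "\<dots> = ?p ^ (i + j) * (H\<^sub>0 * (m' * (smult (of_nat i) m + ?p * pderiv m) -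
      m * (smult (of_nat j) m' + ?p * pderiv m')))"
    unfolding dc dc' by (subst (1) c', subst (1) c) (simp only: power_add algebra_simps)
  finally have "m * m' * \<theta> = H\<^sub>0 * (m' * (smult (of_nat i) m + ?p * pderiv m) -
      m * (smult (of_nat j) m' + ?p * pderiv m'))"
    by (subst (asm) mult_cancel_left) auto
  hence "poly (m * m' * \<theta>) \<alpha> = poly (H\<^sub>0 * (m' * (smult (of_nat i) m + ?p * pderiv m) -
      m * (smult (of_nat j) m' + ?p * pderiv m'))) \<alpha>"
    by (rule arg_cong)
  \<comment> \<open>At \<open>\<alpha>\<close> the summands that still contain \<open>?p\<close>
    vanish, and only the two orders are left.\<close>
  hence "poly m \<alpha> * poly m' \<alpha> * poly H\<^sub>0 \<alpha> * q = poly m \<alpha> * poly m' \<alpha> * poly H\<^sub>0 \<alpha> * (of_nat i - of_nat j)"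
    by (simp add: \<theta> algebra_simps)
  moreover have "poly m \<alpha> \<noteq> 0" "poly m' \<alpha> \<noteq> 0"
    using m(2) m'(2) by (simp_all add: poly_eq_0_iff_dvd)
  ultimately have "q = of_nat i - of_nat j" using H(2) by simp
  thus ?thesis by simp
qed

text \<open>Differentiating a linear relation with the fewest terms and eliminating one of them gives a
  shorter relation. It is trivial, so the quotients of the terms are constant, which the residues
  of their logarithmic derivatives forbid.\<close>

lemma radicals_linearly_independent:
  fixes G :: "'j \<Rightarrow> 'k::field_char_0 fps" and \<alpha> :: "'i \<Rightarrow> 'k" and q :: "'j \<Rightarrow> 'i \<Rightarrow> 'k"
  assumes fin: "finite I" and inj: "inj_on \<alpha> I"
    and G: "\<And>\<mu>. \<mu> \<in> M \<Longrightarrow> G \<mu> \<noteq> 0"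
    and dG: "\<And>\<mu>. \<mu> \<in> M \<Longrightarrow> fps_of_poly (\<Prod>i\<in>I. [:-\<alpha> i, 1:]) * fps_deriv (G \<mu>) =
      fps_of_poly (\<Sum>i\<in>I. smult (q \<mu> i) (\<Prod>j\<in>I - {i}. [:-\<alpha> j, 1:])) * G \<mu>"
    and q: "\<And>\<mu> \<mu>'. \<mu> \<in> M \<Longrightarrow> \<mu>' \<in> M \<Longrightarrow> \<mu> \<noteq> \<mu>' \<Longrightarrow> \<exists>i\<in>I. q \<mu> i - q \<mu>' i \<notin> \<int>"
    and M: "finite M" and rel: "(\<Sum>\<mu>\<in>M. fps_of_poly (c \<mu>) * G \<mu>) = 0"
  shows "\<forall>\<mu>\<in>M. c \<mu> = 0"
  using M G dG q rel
proof (induction M arbitrary: c rule: finite_induct)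
  case (insert \<nu> M)
  define H where "H = (\<Prod>i\<in>I. [:-\<alpha> i, 1:])"
  define \<theta> where "\<theta> \<mu> = (\<Sum>i\<in>I. smult (q \<mu> i) (\<Prod>j\<in>I - {i}. [:-\<alpha> j, 1:]))" for \<mu>
  have IH: "\<forall>\<mu>\<in>M. b \<mu> = 0" if "(\<Sum>\<mu>\<in>M. fps_of_poly (b \<mu>) * G \<mu>) = 0" for b
    using insert.IH[OF _ _ _ that] insert.prems(1-3) by blast
  have dG: "fps_of_poly H * fps_deriv (G \<mu>) = fps_of_poly (\<theta> \<mu>) * G \<mu>" if "\<mu> \<in> insert \<nu> M" for \<mu>
    using insert.prems(2)[OF that] by (simp add: H_def \<theta>_def)
  \<comment> \<open>These are the coefficients of the differentiated relation, multiplied by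
    \<open>H\<close> so that they stay polynomial.\<close>
  define b where "b \<mu> = H * pderiv (c \<mu>) + c \<mu> * \<theta> \<mu>" for \<mu>
  have db: "fps_of_poly H * fps_deriv (fps_of_poly (c \<mu>) * G \<mu>) = fps_of_poly (b \<mu>) * G \<mu>"
    if "\<mu> \<in> insert \<nu> M" for \<mu>
    using arg_cong[OF dG[OF that], of "\<lambda>u. fps_of_poly (c \<mu>) * u"]
    by (simp add: b_def fps_of_poly_add fps_of_poly_mult fps_of_poly_pderiv algebra_simps)
  have rel: "fps_of_poly (c \<nu>) * G \<nu> + (\<Sum>\<mu>\<in>M. fps_of_poly (c \<mu>) * G \<mu>) = 0"
    using insert.prems(4) insert.hyps by simp
  have "fps_of_poly H * fps_deriv (\<Sum>\<mu>\<in>insert \<nu> M. fps_of_poly (c \<mu>) * G \<mu>) =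
      (\<Sum>\<mu>\<in>insert \<nu> M. fps_of_poly (b \<mu>) * G \<mu>)"
    by (simp only: fps_deriv_sum sum_distrib_left db cong: sum.cong)
  hence rel': "fps_of_poly (b \<nu>) * G \<nu> + (\<Sum>\<mu>\<in>M. fps_of_poly (b \<mu>) * G \<mu>) = 0"
    using insert.prems(4) insert.hyps by simp
  \<comment> \<open>This combination of the relation with its derivative cancels the term of
    \<open>\<nu>\<close>.\<close>
  have "(\<Sum>\<mu>\<in>M. fps_of_poly (c \<nu> * b \<mu> - b \<nu> * c \<mu>) * G \<mu>) =
      fps_of_poly (c \<nu>) * (\<Sum>\<mu>\<in>M. fps_of_poly (b \<mu>) * G \<mu>) -
      fps_of_poly (b \<nu>) * (\<Sum>\<mu>\<in>M. fps_of_poly (c \<mu>) * G \<mu>)"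
    by (simp add: fps_of_poly_diff fps_of_poly_mult sum_subtractf sum_distrib_left algebra_simps)
  also have "\<dots> = fps_of_poly (c \<nu>) * (- (fps_of_poly (b \<nu>) * G \<nu>)) -
      fps_of_poly (b \<nu>) * (- (fps_of_poly (c \<nu>) * G \<nu>))"
    using rel rel' by (simp only: add_eq_0_iff)
  also have "\<dots> = 0" by (simp add: algebra_simps)
  finally have elim: "\<forall>\<mu>\<in>M. c \<nu> * b \<mu> - b \<nu> * c \<mu> = 0" by (rule IH)
  have "c \<nu> = 0"
  proof (rule ccontr)
    assume nz: "c \<nu> \<noteq> 0"
    have "c \<mu> = 0" if \<mu>: "\<mu> \<in> M" for \<mu>
    proof (rule ccontr)
      assume nz': "c \<mu> \<noteq> 0"
      have "\<mu> \<noteq> \<nu>" using insert.hyps \<mu> by blast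
      then obtain i where i: "i \<in> I" "q \<nu> i - q \<mu> i \<notin> \<int>" using insert.prems(3)[of \<nu> \<mu>] \<mu> by auto
      define H\<^sub>0 where "H\<^sub>0 = (\<Prod>j\<in>I - {i}. [:-\<alpha> j, 1:])"
      have H: "H = [:-\<alpha> i, 1:] * H\<^sub>0" unfolding H_def H\<^sub>0_def by (rule prod.remove[OF fin i(1)])
      have H0: "poly H\<^sub>0 (\<alpha> i) \<noteq> 0"
        using fin inj i by (auto simp: H\<^sub>0_def poly_prod inj_on_def)
      have ev: "poly (\<theta> \<rho>) (\<alpha> i) = q \<rho> i * poly H\<^sub>0 (\<alpha> i)" for \<rho>
      proof -
        have "poly (\<theta> \<rho>) (\<alpha> i) = (\<Sum>j\<in>I. if j = i then q \<rho> i * poly H\<^sub>0 (\<alpha> i) else 0)"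
          unfolding \<theta>_def poly_sum
        proof (rule sum.cong)
          fix j assume "j \<in> I"
          thus "poly (smult (q \<rho> j) (\<Prod>j\<in>I - {j}. [:-\<alpha> j, 1:])) (\<alpha> i) =
              (if j = i then q \<rho> i * poly H\<^sub>0 (\<alpha> i) else 0)"
            using fin i by (auto simp: H\<^sub>0_def poly_prod)
        qed simp
        thus ?thesis using fin i by simp
      qed
      \<comment> \<open>The vanishing coefficient says that \<open>c \<mu>\<close> times
        \<open>G \<mu>\<close> and \<open>c \<nu>\<close> times \<open>G \<nu>\<close> have equal
        logarithmic derivatives.\<close>
      have "H * (c \<nu> * pderiv (c \<mu>) - c \<mu> * pderiv (c \<nu>)) = c \<mu> * c \<nu> * (\<theta> \<nu> - \<theta> \<mu>)"
        using elim \<mu> by (simp add: b_def algebra_simps)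
      from residue_in_Ints[OF nz' nz H H0 this, of "q \<nu> i - q \<mu> i"] i(2)
      show False by (simp add: ev algebra_simps)
    qed
    hence "fps_of_poly (c \<nu>) * G \<nu> = 0" using rel by simp
    thus False using nz insert.prems(1)[of \<nu>] by simp
  qed
  moreover from this have "\<forall>\<mu>\<in>M. c \<mu> = 0" using rel by (intro IH) simp
  ultimately show ?case by simp
qed simp

section \<open>Generic points of the trinomial variety\<close>

lemma poly_mapping_sum_single: "(\<Sum>m\<in>keys p. single m (lookup p m)) = p"
  by (rule poly_mapping_eqI) (auto simp: lookup_sum lookup_single when_def in_keys_iff)

lemma prod_single: "(\<Prod>j\<in>J. single (m j) (1 :: 'a::comm_semiring_1)) = single (\<Sum>j\<in>J. m j) 1"
  by (induction J rule: infinite_finite_induct) (simp_all add: mult_single)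

lemma mvar_power: "mvar x ^ k = (single (single x k) 1 :: ('x, 'k::comm_ring_1) mpol)"
  by (induction k) (simp_all add: mvar_def mult_single flip: single_add)

lemma mpoly_ring_induct [consumes 1, case_names const var add mult]:
  fixes p :: "('x, 'b::comm_ring_1) mpol"
  assumes "p \<in> carrier (mpoly_ring V)" "\<And>b. P (mconst b)" "\<And>x. x \<in> V \<Longrightarrow> P (mvar x)"
    "\<And>p q. P p \<Longrightarrow> P q \<Longrightarrow> P (p + q)" "\<And>p q. P p \<Longrightarrow> P q \<Longrightarrow> P (p * q)"
  shows "P p"
proof -
  have mvar_pow: "P (mvar x ^ k)" if "x \<in> V" for x k
    by (induction k) (use assms(2)[of 1] assms(3)[OF that] assms(5) in \<open>auto simp: mconst_def\<close>)
  have pt_monom: "P (single m 1)" if "keys m \<subseteq> V" for m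
  proof -
    have "P (\<Prod>x\<in>J. mvar x ^ lookup m x)" if "J \<subseteq> V" for J
      using that by (induction J rule: infinite_finite_induct)
        (use assms(2)[of 1] mvar_pow assms(5) in \<open>auto simp: mconst_def\<close>)
    from this[OF that] show ?thesis
      by (simp add: mvar_power prod_single poly_mapping_sum_single)
  qed
  have "P (single m (lookup p m))" if "m \<in> keys p" for m
    using assms(5)[OF assms(2) pt_monom, of m "lookup p m"] assms(1) that
    by (auto simp: mconst_def mult_single)
  hence "P (\<Sum>m\<in>J. single m (lookup p m))" if "J \<subseteq> keys p" for J
    using that by (induction J rule: infinite_finite_induct)
      (use assms(2)[of 0] assms(4) in \<open>auto simp: mconst_def\<close>)
  from this[of "keys p"] show ?thesis by (simp add: poly_mapping_sum_single)
qed

text \<open>The images of all exponents are prescribed, not those of the variables alone. At the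
  generic point this makes the image of each monomial a single Laurent term.\<close>

locale polynomial_evaluation =
  fixes \<iota> :: "'k::comm_ring_1 \<Rightarrow> 'd::comm_ring_1" and \<psi> :: "'m::comm_monoid_add \<Rightarrow> 'd"
  assumes const_add: "\<iota> (b + c) = \<iota> b + \<iota> c"
    and const_mult: "\<iota> (b * c) = \<iota> b * \<iota> c"
    and const_1: "\<iota> 1 = 1"
    and monom_0: "\<psi> 0 = 1"
    and monom_add: "\<psi> (m + m') = \<psi> m * \<psi> m'"
begin

definition evaluate :: "('m \<Rightarrow>\<^sub>0 'k) \<Rightarrow> 'd" where
  "evaluate p = (\<Sum>m\<in>keys p. \<iota> (lookup p m) * \<psi> m)"

lemma const_0: "\<iota> 0 = 0"
  using const_add[of 0 0] by (metis add_0 add_cancel_left_right)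

lemma eval_add: "evaluate (p + q) = evaluate p + evaluate q"
  unfolding evaluate_def
  by (rule setsum_keys_plus_distrib) (simp_all add: const_0 const_add algebra_simps)

lemma eval_0: "evaluate 0 = 0"
  by (simp add: evaluate_def)

lemma eval_minus: "evaluate (- p) = - evaluate p"
  using eval_add[of p "- p"] eval_0 by (simp add: eq_neg_iff_add_eq_0 add.commute)

lemma eval_diff: "evaluate (p - q) = evaluate p - evaluate q"
  using eval_add[of p "- q"] by (simp add: eval_minus)

lemma eval_sum: "evaluate (sum f J) = (\<Sum>j\<in>J. evaluate (f j))"
  by (induction J rule: infinite_finite_induct) (simp_all add: eval_0 eval_add)

lemma eval_single: "evaluate (single m b) = \<iota> b * \<psi> m"
  by (simp add: evaluate_def const_0)

lemma eval_mult: "evaluate (p * q) = evaluate p * evaluate q"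
proof -
  have "p * q = (\<Sum>m\<in>keys p. single m (lookup p m)) * (\<Sum>m\<in>keys q. single m (lookup q m))"
    by (simp only: poly_mapping_sum_single)
  also have "\<dots> = (\<Sum>m\<in>keys p. \<Sum>m'\<in>keys q. single (m + m') (lookup p m * lookup q m'))"
    by (simp add: sum_product mult_single)
  also have "evaluate \<dots> = (\<Sum>m\<in>keys p. \<Sum>m'\<in>keys q. \<iota> (lookup p m) * \<psi> m * (\<iota> (lookup q m') * \<psi> m'))"
    by (simp add: eval_sum eval_single const_mult monom_add algebra_simps)
  also have "\<dots> = evaluate p * evaluate q"
    by (simp add: evaluate_def sum_product)
  finally show ?thesis .
qed

lemma eval_1: "evaluate 1 = 1"
  using eval_single[of 0 1] by (simp add: const_1 monom_0)

lemma eval_power: "evaluate (p ^ k) = evaluate p ^ k"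
  by (induction k) (simp_all add: eval_1 eval_mult)

lemma eval_prod: "evaluate (prod f J) = (\<Prod>j\<in>J. evaluate (f j))"
  by (induction J rule: infinite_finite_induct) (simp_all add: eval_1 eval_mult)

end

fun tvar_code :: "tvar \<Rightarrow> nat" where
  "tvar_code (T i j) = 2 * prod_encode (i, j)"
| "tvar_code (S k) = Suc (2 * k)"

lemma tvar_code_eq_iff: "tvar_code x = tvar_code y \<longleftrightarrow> x = y"
proof (cases x; cases y)
  fix i j k assume "x = T i j" "y = S k"
  thus ?thesis using parity_cases by (simp, presburger)
next
  fix i j k assume "x = S k" "y = T i j"
  thus ?thesis by (simp, presburger)
qed (simp_all add: prod_encode_eq)

text \<open>The order is arbitrary; it only serves to make polynomials in the \<open>tvar\<close>s an instance of \<^class>\<open>idom\<close>.\<close>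

instantiation tvar :: linorder
begin

definition less_eq_tvar :: "tvar \<Rightarrow> tvar \<Rightarrow> bool" where "x \<le> y \<longleftrightarrow> tvar_code x \<le> tvar_code y"
definition less_tvar :: "tvar \<Rightarrow> tvar \<Rightarrow> bool" where "x < y \<longleftrightarrow> tvar_code x < tvar_code y"

instance
  by standard (auto simp: less_eq_tvar_def less_tvar_def tvar_code_eq_iff)

end

text \<open>The integer exponents belong to the independent parameters; the coefficients are power
  series in \<open>w - z\<close>.\<close>

type_synonym 'k laurent = "(tvar \<Rightarrow>\<^sub>0 int) \<Rightarrow>\<^sub>0 'k fps"

definition lconst :: "'k::field_char_0 \<Rightarrow> 'k laurent" where
  "lconst b = single 0 (fps_const b)"

locale trinomial_data =
  fixes r :: nat and n :: "nat \<Rightarrow> nat" and l :: "nat \<Rightarrow> nat \<Rightarrow> nat"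
    and a :: "nat \<Rightarrow> 'k::{alg_closed_field, field_char_0}"
  assumes r_ge: "r \<ge> 2"
    and n_ge: "i \<in> {1..r} \<Longrightarrow> n i \<ge> 1"
    and l_ge: "i \<in> {1..r} \<Longrightarrow> j \<in> {1..n i} \<Longrightarrow> l i j \<ge> 1"
    and a_inj: "inj_on a {1..r}"

text \<open>The generic point of the trinomial variety, on the chart around \<open>w = z\<close> where \<open>T\<^sub>i\<^sup>l\<^sup>i = w - a\<^sub>i\<close>:
  with \<open>w = z + s\<close>, all variables but \<open>T\<^bsub>i c\<^sub>i\<^esub>\<close> are powers of independent parameters, and
  \<open>T\<^bsub>i c\<^sub>i\<^esub>\<close> is \<open>\<beta>\<^sub>i\<close>, a root of \<open>w - a\<^sub>i\<close> in the power series in \<open>s\<close>, divided by the monomial that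
  makes \<open>T\<^sub>i\<^sup>l\<^sup>i\<close> equal to \<open>w - a\<^sub>i\<close>.\<close>

locale trinomial_point = trinomial_data r n l a
  for r n l and a :: "nat \<Rightarrow> 'k::{alg_closed_field, field_char_0}" +
  fixes c :: "nat \<Rightarrow> nat" and z :: 'k and \<beta> :: "nat \<Rightarrow> 'k fps"
  assumes c_in: "i \<in> {1..r} \<Longrightarrow> c i \<in> {1..n i}"
    and \<beta>_power: "i \<in> {1..r} \<Longrightarrow> \<beta> i ^ l i (c i) = fps_of_poly [:- (a i - z), 1:]"
begin

text \<open>The parameter attached to \<open>T i j\<close> occurs to the power
  \<open>l i (c i)\<close>, so that solving for \<open>T i (c i)\<close>, which takes an
  \<open>l i (c i)\<close>-th root, leaves integral exponents.\<close>

definition expo :: "(tvar \<Rightarrow>\<^sub>0 nat) \<Rightarrow> (tvar \<Rightarrow>\<^sub>0 int)" where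
  "expo m = Abs_poly_mapping (\<lambda>x. case x of
     T i j \<Rightarrow> if i \<in> {1..r} \<and> j \<in> {1..n i} \<and> j \<noteq> c i
       then int (l i (c i) * lookup m (T i j)) - int (l i j * lookup m (T i (c i))) else 0
   | S k \<Rightarrow> int (lookup m (S k)))"

lemma lookup_expo: "lookup (expo m) x = (case x of
     T i j \<Rightarrow> if i \<in> {1..r} \<and> j \<in> {1..n i} \<and> j \<noteq> c i
       then int (l i (c i) * lookup m (T i j)) - int (l i j * lookup m (T i (c i))) else 0
   | S k \<Rightarrow> int (lookup m (S k)))" (is "_ = ?f x")
proof -
  have "{x. ?f x \<noteq> 0} \<subseteq> keys m \<union> (\<Union>i\<in>{1..r}. T i ` {1..n i})"
  proof
    fix x assume "x \<in> {x. ?f x \<noteq> 0}"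
    thus "x \<in> keys m \<union> (\<Union>i\<in>{1..r}. T i ` {1..n i})"
      by (cases x) (force simp: in_keys_iff split: if_splits)+
  qed
  hence "finite {x. ?f x \<noteq> 0}" by (rule finite_subset) simp
  thus ?thesis unfolding expo_def by (subst lookup_Abs_poly_mapping) simp_all
qed

lemma expo_0: "expo 0 = 0"
  by (rule poly_mapping_eqI) (simp add: lookup_expo split: tvar.splits)

lemma expo_add: "expo (m + m') = expo m + expo m'"
  by (rule poly_mapping_eqI) (simp add: lookup_expo lookup_add algebra_simps split: tvar.splits)

definition root_part :: "(tvar \<Rightarrow>\<^sub>0 nat) \<Rightarrow> 'k fps" where
  "root_part m = (\<Prod>i\<in>{1..r}. \<beta> i ^ lookup m (T i (c i)))"

lemma root_part_0: "root_part 0 = 1"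
  by (simp add: root_part_def)

lemma root_part_add: "root_part (m + m') = root_part m * root_part m'"
  by (simp add: root_part_def lookup_add power_add prod.distrib)

lemma \<beta>_nonzero: "i \<in> {1..r} \<Longrightarrow> \<beta> i \<noteq> 0"
  using \<beta>_power[of i] l_ge[OF _ c_in, of i] fps_of_poly_eq_iff[of "[:- (a i - z), 1:]" 0]
  by (auto simp: power_0_left)

lemma root_part_nonzero: "root_part m \<noteq> 0"
  using \<beta>_nonzero by (auto simp: root_part_def)

definition pt_monom :: "(tvar \<Rightarrow>\<^sub>0 nat) \<Rightarrow> 'k laurent" where
  "pt_monom m = single (expo m) (root_part m)"

sublocale polynomial_evaluation lconst pt_monom
  by unfold_locales
     (simp_all add: lconst_def pt_monom_def mult_single expo_0 expo_add root_part_0 root_part_add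
       flip: single_add)

definition gen :: "tvar \<Rightarrow> 'k laurent" where
  "gen x = evaluate (mvar x)"

lemma gen_eq: "gen x = pt_monom (single x 1)"
  by (simp add: gen_def mvar_def eval_single const_1)

lemma gen_nonzero: "gen x \<noteq> 0"
  using root_part_nonzero[of "single x 1"]
  by (metis gen_eq pt_monom_def lookup_single_eq lookup_zero)

lemma eval_mconst: "evaluate (mconst b) = lconst b"
  by (simp add: mconst_def eval_single monom_0)

definition tmonom_expo :: "nat \<Rightarrow> (tvar \<Rightarrow>\<^sub>0 nat)" where
  "tmonom_expo i = (\<Sum>j\<in>{1..n i}. single (T i j) (l i j))"

lemma tmonom_eq: "tmonom n l i = single (tmonom_expo i) (1 :: 'k)"
  by (simp add: tmonom_def mvar_power prod_single tmonom_expo_def)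

lemma lookup_tmonom_expo:
  "lookup (tmonom_expo i) x =
    (case x of T i' j \<Rightarrow> if i' = i \<and> j \<in> {1..n i} then l i j else 0 | S k \<Rightarrow> 0)"
  by (cases x) (auto simp: tmonom_expo_def lookup_sum lookup_single when_def)

text \<open>The parameter exponents \<open>l i (c i) * l i j\<close> and
  \<open>- l i j * l i (c i)\<close> cancel, leaving the power of \<open>\<beta> i\<close>.\<close>

lemma eval_tmonom:
  assumes i: "i \<in> {1..r}"
  shows "evaluate (tmonom n l i) = single 0 (fps_of_poly [:- (a i - z), 1:])"
proof -
  have "expo (tmonom_expo i) = 0"
    by (rule poly_mapping_eqI) (use c_in[OF i] in \<open>auto simp: lookup_expo lookup_tmonom_expo split: tvar.splits\<close>)
  moreover have "root_part (tmonom_expo i) = (\<Prod>i'\<in>{1..r}. if i' = i then \<beta> i ^ l i (c i) else 1)"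
    unfolding root_part_def by (rule prod.cong) (use c_in[OF i] in \<open>auto simp: lookup_tmonom_expo\<close>)
  moreover have "\<dots> = \<beta> i ^ l i (c i)" using i by simp
  ultimately show ?thesis
    by (simp add: tmonom_eq eval_single const_1 pt_monom_def \<beta>_power[OF i])
qed

lemma prod_gen:
  assumes i: "i \<in> {1..r}"
  shows "(\<Prod>j\<in>{1..n i}. gen (T i j) ^ l i j) = single 0 (fps_of_poly [:- (a i - z), 1:])"
  using eval_tmonom[OF i] by (simp add: tmonom_def eval_prod eval_power gen_def)

lemma prod_gen_diff:
  assumes "i \<in> {1..r}" "i' \<in> {1..r}"
  shows "(\<Prod>j\<in>{1..n i}. gen (T i j) ^ l i j) =
    (\<Prod>j\<in>{1..n i'}. gen (T i' j) ^ l i' j) + lconst (a i' - a i)"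
  unfolding prod_gen[OF assms(1)] prod_gen[OF assms(2)] lconst_def single_add[symmetric]
  by (simp add: fps_of_poly_pCons algebra_simps)

definition coord_ring :: "nat \<Rightarrow> 'k laurent set" where
  "coord_ring d = evaluate ` carrier (mpoly_ring (tvars r n d))"

lemma coord_ring_eq: "coord_ring d = generated lconst (gen ` tvars r n d)"
proof (intro equalityI subsetI)
  fix f assume "f \<in> coord_ring d"
  then obtain p where p: "p \<in> carrier (mpoly_ring (tvars r n d))" "f = evaluate p"
    unfolding coord_ring_def by blast
  show "f \<in> generated lconst (gen ` tvars r n d)"
    unfolding p(2) using p(1)
  proof (induction rule: mpoly_ring_induct)
    case (var x)
    thus ?case by (auto simp: gen_def[symmetric] intro: gen_var)
  qed (simp_all add: eval_add eval_mult eval_mconst gen_const gen_add gen_mult)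
next
  fix f assume "f \<in> generated lconst (gen ` tvars r n d)"
  thus "f \<in> coord_ring d"
  proof (induction rule: generated_induct)
    case (const b)
    thus ?case unfolding coord_ring_def
      by (intro image_eqI[OF _ mconst_mem_mpoly_ring]) (rule eval_mconst[symmetric])
  next
    case (var x)
    then obtain y where "y \<in> tvars r n d" "x = gen y" by blast
    thus ?case unfolding coord_ring_def gen_def by (intro image_eqI[OF _ mvar_mem_mpoly_ring])
  next
    case (add f g)
    then obtain p q where "p \<in> carrier (mpoly_ring (tvars r n d))" "f = evaluate p"
      "q \<in> carrier (mpoly_ring (tvars r n d))" "g = evaluate q" unfolding coord_ring_def by blast
    thus ?case unfolding coord_ring_def
      by (intro image_eqI[OF _ add_mem_mpoly_ring[of p _ q]]) (simp_all only: eval_add)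
  next
    case (mult f g)
    then obtain p q where "p \<in> carrier (mpoly_ring (tvars r n d))" "f = evaluate p"
      "q \<in> carrier (mpoly_ring (tvars r n d))" "g = evaluate q" unfolding coord_ring_def by blast
    thus ?case unfolding coord_ring_def
      by (intro image_eqI[OF _ mult_mem_mpoly_ring[of p _ q]]) (simp_all only: eval_mult)
  qed
qed

sublocale alg: subalgebra "coord_ring d" "lconst :: 'k \<Rightarrow> 'k laurent" for d
  by unfold_locales
     (simp_all add: const_add const_mult const_1 coord_ring_eq gen_const gen_add gen_mult)

abbreviation coord_lnd :: "nat \<Rightarrow> ('k laurent \<Rightarrow> 'k laurent) \<Rightarrow> bool" where
  "coord_lnd d \<equiv> alg_lnd (coord_ring d) lconst"

lemma gen_in: "x \<in> tvars r n d \<Longrightarrow> gen x \<in> coord_ring d"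
  by (simp add: coord_ring_eq gen_var)

end

section \<open>The ideal of the trinomials\<close>

context trinomial_point
begin

abbreviation polys :: "nat \<Rightarrow> (tvar, 'k) mpol set" where
  "polys d \<equiv> carrier (mpoly_ring (tvars r n d))"

abbreviation rel_ideal :: "nat \<Rightarrow> (tvar, 'k) mpol set" where
  "rel_ideal d \<equiv> Idl\<^bsub>mpoly_ring (tvars r n d)\<^esub> (trinomials r n l a)"

lemma ideal_rel_ideal: "ideal (rel_ideal d) (mpoly_ring (tvars r n d))"
proof -
  interpret P: cring "mpoly_ring (tvars r n d) :: (tvar, 'k) mpol ring" by (rule cring_mpoly_ring)
  show ?thesis by (intro P.genideal_ideal trinomials_subset)
qed

lemma rel_ideal_add: "p \<in> rel_ideal d \<Longrightarrow> q \<in> rel_ideal d \<Longrightarrow> p + q \<in> rel_ideal d"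
  using additive_subgroup.a_closed[OF ideal.axioms(1)[OF ideal_rel_ideal]] by simp

lemma rel_ideal_mult:
  "p \<in> rel_ideal d \<Longrightarrow> q \<in> polys d \<Longrightarrow> q * p \<in> rel_ideal d"
  using ideal.I_l_closed[OF ideal_rel_ideal, of p d q] by simp

lemma rel_ideal_0: "0 \<in> rel_ideal d"
  using additive_subgroup.zero_closed[OF ideal.axioms(1)[OF ideal_rel_ideal]] by simp

lemma rel_ideal_minus: "p \<in> rel_ideal d \<Longrightarrow> - p \<in> rel_ideal d"
  using rel_ideal_mult[OF _ mconst_mem_mpoly_ring, of p d "- 1"]
  by (simp add: mconst_def single_uminus)

lemma rel_ideal_diff: "p \<in> rel_ideal d \<Longrightarrow> q \<in> rel_ideal d \<Longrightarrow> p - q \<in> rel_ideal d"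
  using rel_ideal_add[of p d "- q"] rel_ideal_minus by simp

lemma trinomial_in_ideal:
  assumes "i \<in> {1..<r}"
  shows "tmonom n l i - tmonom n l (i + 1) - mconst (a (i + 1) - a i) \<in> rel_ideal d"
proof -
  interpret P: cring "mpoly_ring (tvars r n d) :: (tvar, 'k) mpol ring" by (rule cring_mpoly_ring)
  have "tmonom n l i - tmonom n l (i + 1) - mconst (a (i + 1) - a i) \<in> trinomials r n l a"
    unfolding trinomials_def using assms by (rule imageI)
  thus ?thesis by (rule subsetD[OF P.genideal_self[OF trinomials_subset]])
qed

lemma eval_rel_ideal:
  assumes "p \<in> rel_ideal d"
  shows "evaluate p = 0"
proof -
  let ?P = "mpoly_ring (tvars r n d) :: (tvar, 'k) mpol ring"
  interpret P: cring ?P by (rule cring_mpoly_ring)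
  let ?J = "{p \<in> carrier ?P. evaluate p = 0}"
  have "ideal ?J ?P"
  proof (rule idealI[OF P.ring_axioms])
    show "subgroup ?J (add_monoid ?P)"
    proof (rule P.add.subgroupI)
      fix p assume "p \<in> ?J"
      hence p: "p \<in> carrier ?P" "evaluate p = 0" by auto
      have "\<ominus>\<^bsub>?P\<^esub> p = - p"
        using p P.minus_equality[of "- p" p] diff_mem_mpoly_ring[OF zero_mem_mpoly_ring p(1)] by simp
      thus "\<ominus>\<^bsub>?P\<^esub> p \<in> ?J" using p diff_mem_mpoly_ring[OF zero_mem_mpoly_ring p(1)]
        by (simp only: mem_Collect_eq eval_minus diff_0 minus_zero)
    next
      fix p q assume "p \<in> ?J" "q \<in> ?J"
      thus "p \<oplus>\<^bsub>?P\<^esub> q \<in> ?J" 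
        using add_mem_mpoly_ring[of p _ q]
        by (simp only: mem_Collect_eq mpoly_ring_simps(3) eval_add add_0_right)
    next
      show "?J \<subseteq> carrier ?P" by blast
    next
      show "?J \<noteq> {}" using zero_mem_mpoly_ring eval_0 by blast
    qed
  next
    fix p q assume "p \<in> ?J" "q \<in> carrier ?P"
    thus "q \<otimes>\<^bsub>?P\<^esub> p \<in> ?J" "p \<otimes>\<^bsub>?P\<^esub> q \<in> ?J"

      using mult_mem_mpoly_ring[of p _ q] mult_mem_mpoly_ring[of q _ p]
      by (simp_all only: mem_Collect_eq mpoly_ring_simps(2) eval_mult mult_zero_left mult_zero_right)
  qed
  moreover have "trinomials r n l a \<subseteq> ?J"
  proof
    fix p :: "(tvar, 'k) mpol" assume p: "p \<in> trinomials r n l a"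
    then obtain i where i: "i \<in> {1..<r}" "p = tmonom n l i - tmonom n l (i + 1) - mconst (a (i + 1) - a i)"
      unfolding trinomials_def by blast
    have "evaluate p = 0"
      using i(1) unfolding i(2)
      by (simp add: eval_diff eval_tmonom eval_mconst)
         (simp add: lconst_def fps_of_poly_pCons flip: single_diff fps_const_sub fps_const_neg)
    thus "p \<in> ?J" using p trinomials_subset by blast
  qed
  ultimately have "rel_ideal d \<subseteq> ?J" by (rule P.genideal_minimal)
  thus ?thesis using assms by blast
qed

section \<open>Reduction to normal forms over the polynomials in \<open>w\<close>\<close>

text \<open>The regular function \<open>w - z\<close>.\<close>

definition base_poly :: "(tvar, 'k) mpol" where
  "base_poly = tmonom n l 1 + mconst (a 1 - z)"

lemma base_poly_mem: "base_poly \<in> polys d"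
  unfolding base_poly_def
  using r_ge by (intro add_mem_mpoly_ring tmonom_mem_mpoly_ring mconst_mem_mpoly_ring) auto

text \<open>Subtracting the defining relations one after another telescopes to \<open>i = 1\<close>,
  where the congruence is an equality.\<close>

lemma tmonom_cong_base_poly:
  assumes "i \<in> {1..r}"
  shows "tmonom n l i - (base_poly - mconst (a i - z)) \<in> rel_ideal d"
  using assms
proof (induction i)
  case (Suc i)
  show ?case
  proof (cases "i = 0")
    case True
    thus ?thesis by (simp add: base_poly_def rel_ideal_0)
  next
    case False
    hence i: "i \<in> {1..<r}" "i \<in> {1..r}" using Suc.prems by auto
    from rel_ideal_diff[OF Suc.IH[OF i(2)] trinomial_in_ideal[OF i(1)]]
    have "tmonom n l i - (base_poly - mconst (a i - z)) -
        (tmonom n l i - tmonom n l (i + 1) - mconst (a (i + 1) - a i)) \<in> rel_ideal d" .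
    moreover have "mconst (a (i + 1) - z) = (mconst (a i - z) + mconst (a (i + 1) - a i) :: (tvar, 'k) mpol)"
      by (simp add: mconst_def flip: single_add)
    ultimately show ?thesis by (simp add: algebra_simps)
  qed
qed simp

definition base_eval :: "'k poly \<Rightarrow> (tvar, 'k) mpol" where
  "base_eval p = poly (map_poly mconst p) base_poly"

lemma base_eval_0: "base_eval 0 = 0"
  by (simp add: base_eval_def)

lemma base_eval_pCons: "base_eval (pCons b p) = mconst b + base_poly * base_eval p"
  by (simp add: base_eval_def map_poly_pCons mconst_def)

lemma base_eval_add: "base_eval (p + q) = base_eval p + base_eval q"
proof -
  have "map_poly mconst (p + q) = (map_poly mconst p + map_poly mconst q :: (tvar, 'k) mpol poly)"
    by (rule poly_eqI) (simp add: coeff_map_poly mconst_def single_add)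
  thus ?thesis by (simp add: base_eval_def)
qed

lemma base_eval_smult: "base_eval (smult b p) = mconst b * base_eval p"
proof -
  have "map_poly mconst (smult b p) = (smult (mconst b) (map_poly mconst p) :: (tvar, 'k) mpol poly)"
    by (rule poly_eqI) (simp add: coeff_map_poly mconst_def mult_single)
  thus ?thesis by (simp add: base_eval_def)
qed

lemma base_eval_linear: "base_eval ([:- b, 1:] * p) = (base_poly - mconst b) * base_eval p"
proof -
  have "[:- b, 1:] * p = smult (- b) p + pCons 0 p" by simp
  thus ?thesis
    by (simp only: base_eval_add base_eval_smult base_eval_pCons)
       (simp add: algebra_simps mconst_def single_uminus)
qed

lemma base_eval_mem: "base_eval p \<in> polys d"
proof (induction p)
  case (pCons b p)
  show ?case unfolding base_eval_pCons
    by (intro add_mem_mpoly_ring mult_mem_mpoly_ring mconst_mem_mpoly_ring base_poly_mem pCons.IH)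
qed (simp add: base_eval_0)

lemma eval_base_poly: "evaluate base_poly = single 0 fps_X"
  using r_ge
  by (simp add: base_poly_def eval_add eval_tmonom eval_mconst)
     (simp add: lconst_def fps_of_poly_pCons flip: single_add fps_const_sub fps_const_neg)

lemma eval_base_eval: "evaluate (base_eval p) = single 0 (fps_of_poly p)"
proof (induction p)
  case (pCons b p)
  thus ?case
    by (simp add: base_eval_pCons eval_add eval_mult eval_mconst eval_base_poly)
       (simp add: lconst_def mult_single fps_of_poly_pCons single_add mult.commute)
qed (simp add: base_eval_0 eval_0)

text \<open>The monomials divisible by no \<open>tmonom n l i\<close>. They give a basis of the
  quotient as a module over the polynomials in \<open>w\<close>: they span by reduction and are
  independent by evaluation at the generic point.\<close>

definition normal :: "nat \<Rightarrow> (tvar \<Rightarrow>\<^sub>0 nat) set" where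
  "normal d = {m. keys m \<subseteq> tvars r n d \<and> (\<forall>i\<in>{1..r}. \<exists>j\<in>{1..n i}. lookup m (T i j) < l i j)}"

definition normal_form :: "(tvar \<Rightarrow>\<^sub>0 nat) set \<Rightarrow> ((tvar \<Rightarrow>\<^sub>0 nat) \<Rightarrow> 'k poly) \<Rightarrow> (tvar, 'k) mpol" where
  "normal_form M f = (\<Sum>m\<in>M. base_eval (f m) * single m 1)"

lemma normal_form_mem:
  assumes "M \<subseteq> normal d"
  shows "normal_form M f \<in> polys d"
proof -
  have "(\<Sum>m\<in>M'. base_eval (f m) * single m 1) \<in> polys d" if "M' \<subseteq> M" for M'
    using that
  proof (induction M' rule: infinite_finite_induct)
    case (insert m M')
    have "single m (1 :: 'k) \<in> polys d"
      using insert.prems assms by (auto simp: normal_def)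
    thus ?case unfolding sum.insert[OF insert.hyps] using insert
      by (intro add_mem_mpoly_ring mult_mem_mpoly_ring base_eval_mem) auto
  qed simp_all
  from this[OF subset_refl] show ?thesis by (simp only: normal_form_def)
qed

definition has_normal_form :: "nat \<Rightarrow> (tvar, 'k) mpol \<Rightarrow> bool" where
  "has_normal_form d p \<longleftrightarrow> (\<exists>M f. finite M \<and> M \<subseteq> normal d \<and> p - normal_form M f \<in> rel_ideal d)"

lemma has_normal_form_add:
  assumes "has_normal_form d p" "has_normal_form d q"
  shows "has_normal_form d (p + q)"
proof -
  obtain M f where M: "finite M" "M \<subseteq> normal d" "p - normal_form M f \<in> rel_ideal d"
    using assms(1) unfolding has_normal_form_def by blast
  obtain N g where N: "finite N" "N \<subseteq> normal d" "q - normal_form N g \<in> rel_ideal d"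
    using assms(2) unfolding has_normal_form_def by blast
  \<comment> \<open>Outside \<open>M\<close> and \<open>N\<close> the coefficient functions have
    arbitrary values, so both are first replaced by zero there.\<close>
  let ?f = "\<lambda>m. if m \<in> M then f m else 0" and ?g = "\<lambda>m. if m \<in> N then g m else 0"
  have "normal_form M f = normal_form (M \<union> N) ?f"
    unfolding normal_form_def using M(1) N(1)
    by (intro sum.mono_neutral_cong_left) (auto simp: base_eval_0)
  moreover have "normal_form N g = normal_form (M \<union> N) ?g"
    unfolding normal_form_def using M(1) N(1)
    by (intro sum.mono_neutral_cong_left) (auto simp: base_eval_0)
  moreover have "normal_form (M \<union> N) (\<lambda>m. ?f m + ?g m) = normal_form (M \<union> N) ?f + normal_form (M \<union> N) ?g"
    by (simp only: normal_form_def base_eval_add distrib_right sum.distrib)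
  ultimately have "p + q - normal_form (M \<union> N) (\<lambda>m. ?f m + ?g m) =
      (p - normal_form M f) + (q - normal_form N g)"
    by (simp only: algebra_simps)
  hence "p + q - normal_form (M \<union> N) (\<lambda>m. ?f m + ?g m) \<in> rel_ideal d"
    using rel_ideal_add[OF M(3) N(3)] by (simp only:)
  thus ?thesis unfolding has_normal_form_def
    using M(1,2) N(1,2) by (intro exI[of _ "M \<union> N"] exI[of _ "\<lambda>m. ?f m + ?g m"]) (simp only: finite_Un Un_subset_iff)
qed

lemma has_normal_form_mconst_mult:
  assumes "has_normal_form d p"
  shows "has_normal_form d (mconst b * p)"
proof -
  obtain M f where M: "finite M" "M \<subseteq> normal d" "p - normal_form M f \<in> rel_ideal d"
    using assms(1) unfolding has_normal_form_def by blast
  have "mconst b * p - normal_form M (\<lambda>m. smult b (f m)) = mconst b * (p - normal_form M f)"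
    by (simp add: normal_form_def base_eval_smult right_diff_distrib sum_distrib_left mult.assoc)
  hence "mconst b * p - normal_form M (\<lambda>m. smult b (f m)) \<in> rel_ideal d"
    using rel_ideal_mult[OF M(3) mconst_mem_mpoly_ring] by (simp only:)
  thus ?thesis unfolding has_normal_form_def
    using M(1,2) by (intro exI[of _ M] exI[of _ "\<lambda>m. smult b (f m)"] conjI)
qed

text \<open>Modulo the relations, \<open>tmonom n l i\<close> acts on the coefficients as
  \<open>w - a i\<close>, which is \<open>[:- (a i - z), 1:]\<close> in the variable
  \<open>w - z\<close>.\<close>

lemma has_normal_form_tmonom_mult:
  assumes "has_normal_form d p" and i: "i \<in> {1..r}"
  shows "has_normal_form d (tmonom n l i * p)"
proof -
  obtain M f where M: "finite M" "M \<subseteq> normal d" "p - normal_form M f \<in> rel_ideal d"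
    using assms(1) unfolding has_normal_form_def by blast
  have "normal_form M (\<lambda>m. [:- (a i - z), 1:] * f m) = (base_poly - mconst (a i - z)) * normal_form M f"
    by (simp only: normal_form_def base_eval_linear sum_distrib_left mult.assoc)
  hence "tmonom n l i * p - normal_form M (\<lambda>m. [:- (a i - z), 1:] * f m) =
      tmonom n l i * (p - normal_form M f) +
      normal_form M f * (tmonom n l i - (base_poly - mconst (a i - z)))"
    by (simp only: algebra_simps)
  moreover have "tmonom n l i * (p - normal_form M f) \<in> rel_ideal d"
    by (rule rel_ideal_mult[OF M(3) tmonom_mem_mpoly_ring[OF i]])
  moreover have "normal_form M f * (tmonom n l i - (base_poly - mconst (a i - z))) \<in> rel_ideal d"
    by (rule rel_ideal_mult[OF tmonom_cong_base_poly[OF i] normal_form_mem[OF M(2)]])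
  ultimately have "tmonom n l i * p - normal_form M (\<lambda>m. [:- (a i - z), 1:] * f m) \<in> rel_ideal d"
    using rel_ideal_add by (simp only:)
  thus ?thesis unfolding has_normal_form_def
    using M(1,2) by (intro exI[of _ M] exI[of _ "\<lambda>m. [:- (a i - z), 1:] * f m"] conjI)
qed

lemma finite_tvars: "finite (tvars r n d)"
proof -
  have "tvars r n d = (\<Union>i\<in>{1..r}. T i ` {1..n i}) \<union> S ` {1..d}"
    unfolding tvars_def by blast
  thus ?thesis by simp
qed

text \<open>A monomial that is not normal has a factor \<open>tmonom n l i\<close>, which is of
  positive degree; induction on the total degree applies to the cofactor.\<close>

lemma has_normal_form_monom:
  assumes "keys m \<subseteq> tvars r n d"
  shows "has_normal_form d (single m 1)"
  using assms
proof (induction "\<Sum>x\<in>tvars r n d. lookup m x" arbitrary: m rule: less_induct)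
  case less
  show ?case
  proof (cases "m \<in> normal d")
    case True
    have "single m 1 - normal_form {m} (\<lambda>_. 1) = 0"
      by (simp add: normal_form_def one_pCons base_eval_pCons base_eval_0 mconst_def)
    thus ?thesis unfolding has_normal_form_def using True rel_ideal_0
      by (intro exI[of _ "{m}"] exI[of _ "\<lambda>_. 1"]) simp
  next
    case False
    then obtain i where i: "i \<in> {1..r}" and ge: "\<forall>j\<in>{1..n i}. l i j \<le> lookup m (T i j)"
      using less.prems unfolding normal_def by (auto simp: not_less)
    define m' where "m' = m - tmonom_expo i"
    have m: "m = tmonom_expo i + m'"
      by (rule poly_mapping_eqI) (use ge in \<open>auto simp: m'_def lookup_add lookup_minus lookup_tmonom_expo split: tvar.splits\<close>)
    have keys: "keys m' \<subseteq> tvars r n d"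
      using less.prems by (auto simp: m in_keys_iff lookup_add subset_iff)
    have c: "T i (c i) \<in> tvars r n d" using i c_in[OF i] by (auto simp: tvars_def)
    have "(\<Sum>x\<in>tvars r n d. lookup m' x) < (\<Sum>x\<in>tvars r n d. lookup m x)"
    proof (rule sum_strict_mono_ex1[OF finite_tvars])
      show "\<exists>x\<in>tvars r n d. lookup m' x < lookup m x"
        using c c_in[OF i] l_ge[OF i c_in[OF i]]
        by (intro bexI[of _ "T i (c i)"]) (auto simp: m lookup_add lookup_tmonom_expo)
    qed (simp add: m lookup_add)
    from has_normal_form_tmonom_mult[OF less.hyps[OF this keys] i]
    show ?thesis by (simp add: tmonom_eq mult_single m)
  qed
qed

lemma has_normal_form:
  assumes "p \<in> polys d"
  shows "has_normal_form d p"
proof -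
  have "has_normal_form d (\<Sum>m\<in>J. single m (lookup p m))" if "J \<subseteq> keys p" for J
    using that
  proof (induction J rule: infinite_finite_induct)
    case (insert m J)
    have "keys m \<subseteq> tvars r n d" using insert.prems assms by auto
    from has_normal_form_mconst_mult[OF has_normal_form_monom[OF this], of "lookup p m"]
    have "has_normal_form d (single m (lookup p m))" by (simp add: mconst_def mult_single)
    thus ?case using insert by (simp add: has_normal_form_add)
  qed (auto simp: has_normal_form_def normal_form_def rel_ideal_0 intro!: exI[of _ "{}"])
  from this[of "keys p"] show ?thesis by (simp add: poly_mapping_sum_single)
qed

section \<open>Independence of the normal monomials\<close>

lemma deriv_\<beta>:
  assumes i: "i \<in> {1..r}"
  shows "fps_of_poly [:- (a i - z), 1:] * fps_deriv (\<beta> i) = fps_const (1 / of_nat (l i (c i))) * \<beta> i"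
proof -
  let ?L = "l i (c i)"
  have L: "?L > 0" using l_ge[OF i c_in[OF i]] by simp
  have "fps_const (of_nat ?L) * fps_deriv (\<beta> i) * \<beta> i ^ (?L - 1) = 1"
    using arg_cong[OF \<beta>_power[OF i], of fps_deriv]
    by (simp add: fps_deriv_power' fps_of_poly_pCons fps_of_nat)
  moreover have "\<beta> i ^ ?L = \<beta> i ^ (?L - 1) * \<beta> i" using L by (cases ?L) simp_all
  ultimately have "fps_const (of_nat ?L) * (fps_of_poly [:- (a i - z), 1:] * fps_deriv (\<beta> i)) = \<beta> i"
    unfolding \<beta>_power[OF i, symmetric] by (metis (no_types, lifting) mult.assoc mult.commute mult_1)
  hence "fps_const (1 / of_nat ?L) * (fps_const (of_nat ?L) * (fps_of_poly [:- (a i - z), 1:] * fps_deriv (\<beta> i))) =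
      fps_const (1 / of_nat ?L) * \<beta> i" by simp
  thus ?thesis using L by (simp add: mult.assoc[symmetric])
qed

text \<open>The logarithmic derivative of \<open>root_part m\<close> has at most simple poles at the
  points \<open>a i - z\<close>, with residues \<open>lookup m (T i (c i)) / l i (c i)\<close>. The
  product over all \<open>i\<close> clears denominators, in the shape required by
  \<open>radicals_linearly_independent\<close>.\<close>

lemma deriv_root_part:
  "fps_of_poly (\<Prod>i\<in>{1..r}. [:- (a i - z), 1:]) * fps_deriv (root_part m) =
    fps_of_poly (\<Sum>i\<in>{1..r}. smult (of_nat (lookup m (T i (c i))) / of_nat (l i (c i)))
      (\<Prod>j\<in>{1..r} - {i}. [:- (a j - z), 1:])) * root_part m"
proof -
  let ?u = "\<lambda>i. [:- (a i - z), 1:]"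
  have pow: "fps_of_poly (?u i) * fps_deriv (\<beta> i ^ e) = fps_const (of_nat e / of_nat (l i (c i))) * \<beta> i ^ e"
    if i: "i \<in> {1..r}" for i e
  proof (cases e)
    case (Suc e')
    have "fps_deriv (\<beta> i ^ e) = fps_const (of_nat e) * fps_deriv (\<beta> i) * \<beta> i ^ e'"
      using fps_deriv_power[of "\<beta> i" e] unfolding Suc diff_Suc_1 .
    hence "fps_of_poly (?u i) * fps_deriv (\<beta> i ^ e) =
        fps_const (of_nat e) * \<beta> i ^ e' * (fps_of_poly (?u i) * fps_deriv (\<beta> i))"
      by (simp only: ac_simps)
    also have "\<dots> = (fps_const (of_nat e) * fps_const (1 / of_nat (l i (c i)))) * (\<beta> i ^ e' * \<beta> i)"
      unfolding deriv_\<beta>[OF i] by (simp only: algebra_simps)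
    finally show ?thesis by (simp add: Suc mult.commute)
  qed simp
  have "fps_of_poly (\<Prod>i\<in>J. ?u i) * fps_deriv (\<Prod>i\<in>J. \<beta> i ^ lookup m (T i (c i))) =
    fps_of_poly (\<Sum>i\<in>J. smult (of_nat (lookup m (T i (c i))) / of_nat (l i (c i)))
      (\<Prod>j\<in>J - {i}. ?u j)) * (\<Prod>i\<in>J. \<beta> i ^ lookup m (T i (c i)))" if "finite J" "J \<subseteq> {1..r}" for J
    using that
  proof (induction J rule: finite_induct)
    case (insert i J)
    let ?e = "\<lambda>i. lookup m (T i (c i))"
    let ?q = "\<lambda>i. of_nat (?e i) / of_nat (l i (c i)) :: 'k"
    have "(\<Sum>k\<in>J. smult (?q k) (\<Prod>j\<in>insert i J - {k}. ?u j)) = (\<Sum>k\<in>J. ?u i * smult (?q k) (\<Prod>j\<in>J - {k}. ?u j))"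
    proof (rule sum.cong)
      fix k assume k: "k \<in> J"
      hence "insert i J - {k} = insert i (J - {k})" "i \<notin> J - {k}" using insert.hyps by auto
      thus "smult (?q k) (\<Prod>j\<in>insert i J - {k}. ?u j) = ?u i * smult (?q k) (\<Prod>j\<in>J - {k}. ?u j)"
        using insert.hyps prod.insert[of "J - {k}" i ?u] by (simp only: finite_Diff mult_smult_right simp_thms)
    qed simp
    moreover have "insert i J - {i} = J" using insert.hyps by auto
    ultimately have q: "(\<Sum>k\<in>insert i J. smult (?q k) (\<Prod>j\<in>insert i J - {k}. ?u j)) =
        smult (?q i) (\<Prod>j\<in>J. ?u j) + ?u i * (\<Sum>k\<in>J. smult (?q k) (\<Prod>j\<in>J - {k}. ?u j))"
      by (simp only: sum.insert[OF insert.hyps] sum_distrib_left)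
    have "fps_of_poly (\<Prod>j\<in>insert i J. ?u j) * fps_deriv (\<Prod>j\<in>insert i J. \<beta> j ^ ?e j) =
        fps_of_poly (\<Prod>j\<in>J. ?u j) * (fps_of_poly (?u i) * fps_deriv (\<beta> i ^ ?e i)) * (\<Prod>j\<in>J. \<beta> j ^ ?e j) +
        fps_of_poly (?u i) * \<beta> i ^ ?e i * (fps_of_poly (\<Prod>j\<in>J. ?u j) * fps_deriv (\<Prod>j\<in>J. \<beta> j ^ ?e j))"
      by (simp only: prod.insert[OF insert.hyps] fps_of_poly_mult fps_deriv_mult algebra_simps)
    also have "\<dots> = fps_of_poly (\<Sum>k\<in>insert i J. smult (?q k) (\<Prod>j\<in>insert i J - {k}. ?u j)) *
        (\<Prod>j\<in>insert i J. \<beta> j ^ ?e j)"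
      unfolding q insert.IH[OF insert.prems[THEN subset_trans[OF subset_insertI]]] pow[of i, OF insert.prems[THEN subsetD, OF insertI1]]
      by (simp only: prod.insert[OF insert.hyps] fps_of_poly_mult fps_of_poly_add fps_of_poly_smult algebra_simps)
    finally show ?case .
  qed simp
  thus ?thesis by (simp add: root_part_def)
qed

text \<open>Equal parameter exponents and integral differences of the residues make the exponents of
  \<open>T i j\<close> in \<open>m\<close> and \<open>m'\<close> differ by \<open>u * l i j\<close>,
  with one integer \<open>u\<close> for each \<open>i\<close>. A nonzero \<open>u\<close> would make
  one of the two monomials divisible by \<open>tmonom n l i\<close>.\<close>

lemma normal_eqI:
  assumes m: "m \<in> normal d" "m' \<in> normal d" and expo: "expo m = expo m'"
    and int: "\<And>i. i \<in> {1..r} \<Longrightarrow> of_nat (lookup m (T i (c i))) / of_nat (l i (c i)) -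
      of_nat (lookup m' (T i (c i))) / of_nat (l i (c i)) \<in> (\<int> :: 'k set)"
  shows "m = m'"
proof (rule poly_mapping_eqI)
  fix x
  show "lookup m x = lookup m' x"
  proof (cases "x \<in> tvars r n d")
    case False
    hence "x \<notin> keys m" "x \<notin> keys m'" using m unfolding normal_def by blast+
    thus ?thesis by (simp add: in_keys_iff)
  next
    case True
    then consider k where "x = S k" | i j where "x = T i j" "i \<in> {1..r}" "j \<in> {1..n i}"
      unfolding tvars_def by blast
    thus ?thesis
    proof cases
      case 1
      thus ?thesis using arg_cong[OF expo, of "\<lambda>e. lookup e x"] by (simp add: lookup_expo)
    next
      case (2 i j)
      let ?L = "l i (c i)"
      have L: "?L > 0" using l_ge[OF 2(2) c_in[OF 2(2)]] by simp
      obtain u where "of_nat (lookup m (T i (c i))) / of_nat ?L - of_nat (lookup m' (T i (c i))) / of_nat ?L =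
          (of_int u :: 'k)" using int[OF 2(2)] by (auto elim: Ints_cases)
      hence "(of_nat (lookup m (T i (c i))) - of_nat (lookup m' (T i (c i))) :: 'k) = of_int u * of_nat ?L"
        using L by (simp add: field_simps)
      hence "(of_int (int (lookup m (T i (c i))) - int (lookup m' (T i (c i)))) :: 'k) = of_int (u * int ?L)"
        by simp
      hence u: "int (lookup m (T i (c i))) - int (lookup m' (T i (c i))) = u * int ?L"
        by (simp only: of_int_eq_iff)
      have diff: "int (lookup m (T i j')) - int (lookup m' (T i j')) = u * int (l i j')" if j': "j' \<in> {1..n i}" for j'
      proof (cases "j' = c i")
        case False
        have "int ?L * int (lookup m (T i j')) - int (l i j') * int (lookup m (T i (c i))) =
            int ?L * int (lookup m' (T i j')) - int (l i j') * int (lookup m' (T i (c i)))"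
          using arg_cong[OF expo, of "\<lambda>e. lookup e (T i j')"] False j' 2(2) by (simp add: lookup_expo)
        hence "int ?L * (int (lookup m (T i j')) - int (lookup m' (T i j'))) =
            int (l i j') * (int (lookup m (T i (c i))) - int (lookup m' (T i (c i))))"
          by (simp only: right_diff_distrib)
        thus ?thesis using L unfolding u by simp
      qed (use u in simp)
      obtain j1 where j1: "j1 \<in> {1..n i}" "lookup m (T i j1) < l i j1"
        using m(1) 2(2) unfolding normal_def by blast
      obtain j2 where j2: "j2 \<in> {1..n i}" "lookup m' (T i j2) < l i j2"
        using m(2) 2(2) unfolding normal_def by blast
      have "u * int (l i j1) < 1 * int (l i j1)" using diff[OF j1(1)] j1(2) by linarith
      hence "u < 1" by (rule mult_right_less_imp_less) simp
      moreover have "(- 1) * int (l i j2) < u * int (l i j2)" using diff[OF j2(1)] j2(2) by linarith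
      hence "- 1 < u" by (rule mult_right_less_imp_less) simp
      ultimately have "u = 0" by simp
      thus ?thesis using diff[OF 2(3)] 2(1) by simp
    qed
  qed
qed

text \<open>Normal monomials with different parameter exponents land in different Laurent terms.
  Those with the same exponents have a non-integral difference of residues, so their root parts are
  linearly independent over the polynomials.\<close>

lemma normal_form_eq_0:
  assumes M: "finite M" "M \<subseteq> normal d" and zero: "evaluate (normal_form M f) = 0" and m: "m \<in> M"
  shows "f m = 0"
proof -
  define N where "N = {m' \<in> M. expo m' = expo m}"
  define e where "e = expo m"
  have "evaluate (normal_form M f) = (\<Sum>m\<in>M. single (expo m) (fps_of_poly (f m) * root_part m))"
    by (simp add: normal_form_def eval_sum eval_mult eval_base_eval eval_single const_1 pt_monom_def mult_single)
  hence "(\<Sum>m\<in>M. single (expo m) (fps_of_poly (f m) * root_part m)) = 0" using zero by simp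
  hence "lookup (\<Sum>m\<in>M. single (expo m) (fps_of_poly (f m) * root_part m)) e = 0"
    by (simp only: lookup_zero)
  hence "(\<Sum>m'\<in>M. fps_of_poly (f m') * root_part m' when expo m' = e) = 0"
    by (simp only: lookup_sum lookup_single)
  moreover have "(\<Sum>m'\<in>M. fps_of_poly (f m') * root_part m' when expo m' = e) =
      (\<Sum>m'\<in>N. fps_of_poly (f m') * root_part m')"
    unfolding N_def when_def e_def[symmetric] using M(1) by (rule sum.inter_filter[symmetric])
  ultimately have rel: "(\<Sum>m'\<in>N. fps_of_poly (f m') * root_part m') = 0" by (simp only:)
  define q :: "(tvar \<Rightarrow>\<^sub>0 nat) \<Rightarrow> nat \<Rightarrow> 'k"
    where "q m i = of_nat (lookup m (T i (c i))) / of_nat (l i (c i))" for m i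
  have q: "\<exists>i\<in>{1..r}. q m1 i - q m2 i \<notin> \<int>" if "m1 \<in> N" "m2 \<in> N" "m1 \<noteq> m2" for m1 m2
  proof (rule ccontr)
    assume *: "\<not> (\<exists>i\<in>{1..r}. q m1 i - q m2 i \<notin> \<int>)"
    have "m1 \<in> normal d" "m2 \<in> normal d" "expo m1 = expo m2"
      using that M(2) by (auto simp: N_def)
    moreover have "\<And>i. i \<in> {1..r} \<Longrightarrow> q m1 i - q m2 i \<in> \<int>" using * by blast
    ultimately have "m1 = m2" unfolding q_def by (rule normal_eqI)
    thus False using that(3) by simp
  qed
  have inj: "inj_on (\<lambda>i. a i - z) {1..r}"
  proof (rule inj_onI)
    fix i j assume "i \<in> {1..r}" "j \<in> {1..r}" "a i - z = a j - z"
    thus "i = j" using inj_onD[OF a_inj, of i j] by simp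
  qed
  have "finite N" unfolding N_def using M(1) by (rule rev_finite_subset) blast
  have "\<forall>m'\<in>N. f m' = 0"
  proof (rule radicals_linearly_independent[where I = "{1..r}" and \<alpha> = "\<lambda>i. a i - z" and q = q
        and G = root_part and M = N and c = f])
    show "finite {1..r}" by (rule finite_atLeastAtMost)
    show "root_part m' \<noteq> 0" for m' by (rule root_part_nonzero)
    show "fps_of_poly (\<Prod>i\<in>{1..r}. [:- (a i - z), 1:]) * fps_deriv (root_part m') =
        fps_of_poly (\<Sum>i\<in>{1..r}. smult (q m' i) (\<Prod>j\<in>{1..r} - {i}. [:- (a j - z), 1:])) * root_part m'" for m'
      unfolding q_def by (rule deriv_root_part)
  qed (fact inj q \<open>finite N\<close> rel)+
  thus ?thesis using m by (simp add: N_def)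
qed

text \<open>A polynomial is congruent to a normal form, and a normal form that evaluates to zero has
  zero coefficients. Hence the quotient embeds into a domain.\<close>

lemma eval_eq_0_iff:
  assumes p: "p \<in> polys d"
  shows "evaluate p = 0 \<longleftrightarrow> p \<in> rel_ideal d"
proof
  assume zero: "evaluate p = 0"
  obtain M f where M: "finite M" "M \<subseteq> normal d" "p - normal_form M f \<in> rel_ideal d"
    using has_normal_form[OF p] unfolding has_normal_form_def by blast
  hence "evaluate (normal_form M f) = 0" using eval_rel_ideal[OF M(3)] zero by (simp add: eval_diff)
  hence "normal_form M f = 0"
    using normal_form_eq_0[OF M(1,2) _ _, of f]
    by (subst normal_form_def, intro sum.neutral ballI) (simp only: base_eval_0 mult_zero_left)
  thus "p \<in> rel_ideal d" using M(3) by simp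
qed (rule eval_rel_ideal)

end

section \<open>Transport along isomorphisms\<close>

text \<open>Closure of \<open>A\<close> under its operations is recorded here because the records
  carry no axioms; with it the inverse is again such an isomorphism.\<close>

definition algebra_iso ::
    "('k, 'm) ring_scheme \<Rightarrow> ('k, 'a, 'p) module_scheme \<Rightarrow> ('k, 'b, 'q) module_scheme \<Rightarrow> ('a \<Rightarrow> 'b) \<Rightarrow> bool"
  where "algebra_iso K A B h \<longleftrightarrow>
    bij_betw h (carrier A) (carrier B) \<and> \<zero>\<^bsub>A\<^esub> \<in> carrier A \<and> h \<zero>\<^bsub>A\<^esub> = \<zero>\<^bsub>B\<^esub> \<and>
    (\<forall>f\<in>carrier A. \<forall>g\<in>carrier A. f \<oplus>\<^bsub>A\<^esub> g \<in> carrier A \<and> h (f \<oplus>\<^bsub>A\<^esub> g) = h f \<oplus>\<^bsub>B\<^esub> h g) \<and>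
    (\<forall>f\<in>carrier A. \<forall>g\<in>carrier A. f \<otimes>\<^bsub>A\<^esub> g \<in> carrier A \<and> h (f \<otimes>\<^bsub>A\<^esub> g) = h f \<otimes>\<^bsub>B\<^esub> h g) \<and>
    (\<forall>c\<in>carrier K. \<forall>f\<in>carrier A. c \<odot>\<^bsub>A\<^esub> f \<in> carrier A \<and> h (c \<odot>\<^bsub>A\<^esub> f) = c \<odot>\<^bsub>B\<^esub> h f)"

lemma algebra_iso_inverse:
  assumes "algebra_iso K A B h"
  shows "algebra_iso K B A (inv_into (carrier A) h)"
proof -
  let ?g = "inv_into (carrier A) h"
  have bij: "bij_betw h (carrier A) (carrier B)" using assms by (simp add: algebra_iso_def)
  have g_in: "?g x \<in> carrier A" and hg: "h (?g x) = x" if "x \<in> carrier B" for x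
    using that bij by (auto simp: bij_betw_def inv_into_into f_inv_into_f)
  have gh: "?g (h x) = x" if "x \<in> carrier A" for x
    using that bij by (simp add: bij_betw_def)
  have h_in: "h x \<in> carrier B" if "x \<in> carrier A" for x using that bij by (auto simp: bij_betw_def)
  have zero: "\<zero>\<^bsub>A\<^esub> \<in> carrier A" "h \<zero>\<^bsub>A\<^esub> = \<zero>\<^bsub>B\<^esub>" using assms by (simp_all add: algebra_iso_def)
  have add: "x \<oplus>\<^bsub>B\<^esub> y \<in> carrier B \<and> ?g (x \<oplus>\<^bsub>B\<^esub> y) = ?g x \<oplus>\<^bsub>A\<^esub> ?g y"
    if "x \<in> carrier B" "y \<in> carrier B" for x y
  proof -
    have "?g x \<oplus>\<^bsub>A\<^esub> ?g y \<in> carrier A" "h (?g x \<oplus>\<^bsub>A\<^esub> ?g y) = x \<oplus>\<^bsub>B\<^esub> y"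
      using assms g_in[OF that(1)] g_in[OF that(2)] hg[OF that(1)] hg[OF that(2)]
      by (simp_all add: algebra_iso_def)
    thus ?thesis using h_in gh by metis
  qed
  have mult: "x \<otimes>\<^bsub>B\<^esub> y \<in> carrier B \<and> ?g (x \<otimes>\<^bsub>B\<^esub> y) = ?g x \<otimes>\<^bsub>A\<^esub> ?g y"
    if "x \<in> carrier B" "y \<in> carrier B" for x y
  proof -
    have "?g x \<otimes>\<^bsub>A\<^esub> ?g y \<in> carrier A" "h (?g x \<otimes>\<^bsub>A\<^esub> ?g y) = x \<otimes>\<^bsub>B\<^esub> y"
      using assms g_in[OF that(1)] g_in[OF that(2)] hg[OF that(1)] hg[OF that(2)]
      by (simp_all add: algebra_iso_def)
    thus ?thesis using h_in gh by metis
  qed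
  have scale: "c \<odot>\<^bsub>B\<^esub> x \<in> carrier B \<and> ?g (c \<odot>\<^bsub>B\<^esub> x) = c \<odot>\<^bsub>A\<^esub> ?g x"
    if "c \<in> carrier K" "x \<in> carrier B" for c x
  proof -
    have "c \<odot>\<^bsub>A\<^esub> ?g x \<in> carrier A" "h (c \<odot>\<^bsub>A\<^esub> ?g x) = c \<odot>\<^bsub>B\<^esub> x"
      using assms that(1) g_in[OF that(2)] hg[OF that(2)] by (simp_all add: algebra_iso_def)
    thus ?thesis using h_in gh by metis
  qed
  show ?thesis
    unfolding algebra_iso_def
    using bij_betw_inv_into[OF bij] h_in[OF zero(1)] gh[OF zero(1)] zero add mult scale by simp
qed

definition pull_back :: "('k, 'a, 'p) module_scheme \<Rightarrow> ('a \<Rightarrow> 'b) \<Rightarrow> ('b \<Rightarrow> 'b) \<Rightarrow> 'a \<Rightarrow> 'a" where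
  "pull_back A h \<delta> x = inv_into (carrier A) h (\<delta> (h x))"

lemma pull_back_eq_0_iff:
  assumes h: "algebra_iso K A B h" and \<delta>: "derivation K B \<delta>" and x: "x \<in> carrier A"
  shows "pull_back A h \<delta> x = \<zero>\<^bsub>A\<^esub> \<longleftrightarrow> \<delta> (h x) = \<zero>\<^bsub>B\<^esub>"
proof -
  have bij: "bij_betw h (carrier A) (carrier B)" using h by (simp add: algebra_iso_def)
  hence "h x \<in> carrier B" using x by (auto simp: bij_betw_def)
  hence "h (pull_back A h \<delta> x) = \<delta> (h x)"
    using \<delta> funcset_mem[of \<delta> "carrier B" "carrier B"] bij_betw_inv_into_right[OF bij]
    by (simp add: derivation_def pull_back_def)
  moreover have "h \<zero>\<^bsub>A\<^esub> = \<zero>\<^bsub>B\<^esub>" "\<zero>\<^bsub>A\<^esub> \<in> carrier A" using h by (simp_all add: algebra_iso_def)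
  moreover from this have "inv_into (carrier A) h \<zero>\<^bsub>B\<^esub> = \<zero>\<^bsub>A\<^esub>"
    using bij_betw_inv_into_left[OF bij] by metis
  ultimately show ?thesis by (auto simp: pull_back_def)
qed

lemma nonzero_lnd_pull_back:
  assumes h: "algebra_iso K A B h" and \<delta>: "nonzero_lnd K B \<delta>"
  shows "nonzero_lnd K A (pull_back A h \<delta>)"
proof -
  let ?g = "inv_into (carrier A) h" and ?d = "pull_back A h \<delta>"
  have der: "derivation K B \<delta>" using \<delta> by (simp add: nonzero_lnd_def lnd_def)
  have bij: "bij_betw h (carrier A) (carrier B)" using h by (simp add: algebra_iso_def)
  have h_in: "h x \<in> carrier B" if "x \<in> carrier A" for x using that bij by (auto simp: bij_betw_def)
  have \<delta>_in: "\<delta> x \<in> carrier B" if "x \<in> carrier B" for x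
    using that der by (auto simp: derivation_def)
  have g: "algebra_iso K B A ?g" by (rule algebra_iso_inverse[OF h])
  have g_in: "?g x \<in> carrier A" and hg: "h (?g x) = x" if "x \<in> carrier B" for x
    using that bij by (auto simp: bij_betw_def inv_into_into f_inv_into_f)
  have gh: "?g (h x) = x" if "x \<in> carrier A" for x
    using that bij by (simp add: bij_betw_def)
  have hom: "h (x \<oplus>\<^bsub>A\<^esub> y) = h x \<oplus>\<^bsub>B\<^esub> h y" "h (x \<otimes>\<^bsub>A\<^esub> y) = h x \<otimes>\<^bsub>B\<^esub> h y"
    if "x \<in> carrier A" "y \<in> carrier A" for x y
    using h that unfolding algebra_iso_def by blast+
  have hom_g: "?g (x \<oplus>\<^bsub>B\<^esub> y) = ?g x \<oplus>\<^bsub>A\<^esub> ?g y" "?g (x \<otimes>\<^bsub>B\<^esub> y) = ?g x \<otimes>\<^bsub>A\<^esub> ?g y"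
      "x \<otimes>\<^bsub>B\<^esub> y \<in> carrier B"
    if "x \<in> carrier B" "y \<in> carrier B" for x y
    using g that unfolding algebra_iso_def by blast+
  have hom_scale: "h (b \<odot>\<^bsub>A\<^esub> x) = b \<odot>\<^bsub>B\<^esub> h x" if "b \<in> carrier K" "x \<in> carrier A" for b x
    using h that unfolding algebra_iso_def by blast
  have hom_g_scale: "?g (b \<odot>\<^bsub>B\<^esub> x) = b \<odot>\<^bsub>A\<^esub> ?g x" if "b \<in> carrier K" "x \<in> carrier B" for b x
    using g that unfolding algebra_iso_def by blast
  have der_B: "\<delta> (x \<oplus>\<^bsub>B\<^esub> y) = \<delta> x \<oplus>\<^bsub>B\<^esub> \<delta> y" "\<delta> (x \<otimes>\<^bsub>B\<^esub> y) = (\<delta> x \<otimes>\<^bsub>B\<^esub> y) \<oplus>\<^bsub>B\<^esub> (x \<otimes>\<^bsub>B\<^esub> \<delta> y)"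
    if "x \<in> carrier B" "y \<in> carrier B" for x y
    using der that unfolding derivation_def by blast+
  have der_scale: "\<delta> (b \<odot>\<^bsub>B\<^esub> x) = b \<odot>\<^bsub>B\<^esub> \<delta> x" if "b \<in> carrier K" "x \<in> carrier B" for b x
    using der that unfolding derivation_def by blast
  have "derivation K A ?d"
    unfolding derivation_def
  proof (intro conjI ballI)
    show "?d \<in> carrier A \<rightarrow> carrier A" by (simp add: pull_back_def g_in \<delta>_in h_in)
  next
    fix x y assume "x \<in> carrier A" "y \<in> carrier A"
    thus "?d (x \<oplus>\<^bsub>A\<^esub> y) = ?d x \<oplus>\<^bsub>A\<^esub> ?d y" "?d (x \<otimes>\<^bsub>A\<^esub> y) = (?d x \<otimes>\<^bsub>A\<^esub> y) \<oplus>\<^bsub>A\<^esub> (x \<otimes>\<^bsub>A\<^esub> ?d y)"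
      by (simp_all add: pull_back_def hom der_B hom_g gh h_in \<delta>_in)
  next
    fix c x assume "c \<in> carrier K" "x \<in> carrier A"
    thus "?d (c \<odot>\<^bsub>A\<^esub> x) = c \<odot>\<^bsub>A\<^esub> ?d x"
      by (simp add: pull_back_def hom_scale der_scale hom_g_scale h_in \<delta>_in)
  qed
  moreover have "\<exists>n>0. (?d ^^ n) x = \<zero>\<^bsub>A\<^esub>" if x: "x \<in> carrier A" for x
  proof -
    have iter: "(?d ^^ n) x = ?g ((\<delta> ^^ n) (h x)) \<and> (\<delta> ^^ n) (h x) \<in> carrier B" for n
      by (induction n) (simp_all add: gh[OF x] h_in[OF x] pull_back_def hg \<delta>_in)
    obtain n where "n > 0" "(\<delta> ^^ n) (h x) = \<zero>\<^bsub>B\<^esub>"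
      using \<delta> h_in[OF x] by (auto simp: nonzero_lnd_def lnd_def)
    thus ?thesis using iter[of n] g by (auto simp: algebra_iso_def)
  qed
  moreover have "\<exists>x\<in>carrier A. ?d x \<noteq> \<zero>\<^bsub>A\<^esub>"
  proof -
    obtain y where y: "y \<in> carrier B" "\<delta> y \<noteq> \<zero>\<^bsub>B\<^esub>" using \<delta> by (auto simp: nonzero_lnd_def)
    thus ?thesis using pull_back_eq_0_iff[OF h der g_in[OF y(1)]] g_in[OF y(1)] hg[OF y(1)] by auto
  qed
  ultimately show ?thesis by (simp add: nonzero_lnd_def lnd_def)
qed

lemma rigid_iso:
  assumes "algebra_iso K A B h"
  shows "rigid K A \<longleftrightarrow> rigid K B"
  unfolding rigid_def
  using nonzero_lnd_pull_back[OF assms] nonzero_lnd_pull_back[OF algebra_iso_inverse[OF assms]]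
  by (metis (no_types))

lemma semirigid_kernel_iff:
  assumes "semirigid K B" "nonzero_lnd K B \<delta>" "nonzero_lnd K B \<delta>'" "x \<in> carrier B"
  shows "\<delta> x = \<zero>\<^bsub>B\<^esub> \<longleftrightarrow> \<delta>' x = \<zero>\<^bsub>B\<^esub>"
proof -
  have "a_kernel B B \<delta> = a_kernel B B \<delta>'"
    using assms(1-3) unfolding semirigid_def lnd_equivalent_def by blast
  hence "x \<in> a_kernel B B \<delta> \<longleftrightarrow> x \<in> a_kernel B B \<delta>'" by (simp only:)
  thus ?thesis using assms(4) by (simp only: a_kernel_def' mem_Collect_eq simp_thms)
qed

lemma semirigid_pull_back:
  assumes h: "algebra_iso K A B h" and A: "semirigid K A"
    and \<delta>: "nonzero_lnd K B \<delta>" "nonzero_lnd K B \<delta>'" and y: "y \<in> carrier B" "\<delta> y = \<zero>\<^bsub>B\<^esub>"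
  shows "\<delta>' y = \<zero>\<^bsub>B\<^esub>"
proof -
  have bij: "bij_betw h (carrier A) (carrier B)" using h by (simp add: algebra_iso_def)
  obtain x where x: "x \<in> carrier A" "h x = y"
    using bij_betw_imp_surj_on[OF bij] y(1) by (metis imageE)
  have "a_kernel A A (pull_back A h \<delta>) = a_kernel A A (pull_back A h \<delta>')"
    using A nonzero_lnd_pull_back[OF h \<delta>(1)] nonzero_lnd_pull_back[OF h \<delta>(2)]
    unfolding semirigid_def lnd_equivalent_def by blast
  hence "x \<in> a_kernel A A (pull_back A h \<delta>) \<longleftrightarrow> x \<in> a_kernel A A (pull_back A h \<delta>')" by (simp only:)
  hence "pull_back A h \<delta> x = \<zero>\<^bsub>A\<^esub> \<longleftrightarrow> pull_back A h \<delta>' x = \<zero>\<^bsub>A\<^esub>"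
    using x(1) by (simp only: a_kernel_def' mem_Collect_eq simp_thms)
  moreover have "derivation K B \<delta>" "derivation K B \<delta>'" using \<delta> by (simp_all add: nonzero_lnd_def lnd_def)
  ultimately show ?thesis
    using pull_back_eq_0_iff[OF h _ x(1)] y(2) unfolding x(2) by metis
qed

lemma semirigid_iso:
  assumes "algebra_iso K A B h" "semirigid K A"
  shows "semirigid K B"
  unfolding semirigid_def lnd_equivalent_def
proof (intro allI impI)
  fix \<delta> \<delta>' assume \<delta>: "nonzero_lnd K B \<delta>" and \<delta>': "nonzero_lnd K B \<delta>'"
  show "a_kernel B B \<delta> = a_kernel B B \<delta>'"
    unfolding a_kernel_def'
    using semirigid_pull_back[OF assms \<delta> \<delta>'] semirigid_pull_back[OF assms \<delta>' \<delta>]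
    by (intro Collect_cong conj_cong refl iffI)
qed

section \<open>Subalgebras of a domain as algebra records\<close>

definition subalgebra_module :: "'d::comm_ring_1 set \<Rightarrow> ('k \<Rightarrow> 'd) \<Rightarrow> ('k, 'd) module" where
  "subalgebra_module A \<iota> =
     \<lparr>carrier = A, monoid.mult = (*), one = 1, ring.zero = 0, add = (+), module.smult = \<lambda>c f. \<iota> c * f\<rparr>"

lemma (in subalgebra) nonzero_lnd_iff:
  "nonzero_lnd (ring_of_type_algebra :: 'k ring) (subalgebra_module A \<iota>) \<delta> \<longleftrightarrow>
    alg_lnd A \<iota> \<delta> \<and> (\<exists>f\<in>A. \<delta> f \<noteq> 0)"
proof -
  let ?K = "ring_of_type_algebra :: 'k ring" and ?B = "subalgebra_module A \<iota>"
  have der: "derivation ?K ?B \<delta> \<longleftrightarrow> alg_derivation A \<iota> \<delta>"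
    unfolding derivation_def alg_derivation_def alg_derivation_axioms_def
    using subalgebra_axioms
    by (auto simp: subalgebra_module_def ring_of_type_algebra_def Pi_def)
  have "(\<forall>f\<in>A. \<exists>n>0. (\<delta> ^^ n) f = 0) \<longleftrightarrow> (\<forall>f\<in>A. \<exists>n. (\<delta> ^^ n) f = 0)"
    if "alg_derivation A \<iota> \<delta>"
  proof -
    interpret alg_derivation A \<iota> \<delta> by fact
    \<comment> \<open>A vanishing zeroth iterate says \<open>f = 0\<close>; one more application
      meets the requirement \<open>n > 0\<close>.\<close>
    have "\<exists>n>0. (\<delta> ^^ n) f = 0" if "(\<delta> ^^ n) f = 0" for f n
      using iter_eq_0_mono[OF that, of "Suc n"] by (intro exI[of _ "Suc n"]) simp
    thus ?thesis by blast
  qed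
  hence "lnd ?K ?B \<delta> \<longleftrightarrow> alg_lnd A \<iota> \<delta>"
    unfolding lnd_def der alg_lnd_def alg_lnd_axioms_def
    by (auto simp: subalgebra_module_def)
  thus ?thesis by (simp add: nonzero_lnd_def subalgebra_module_def)
qed

lemma (in subalgebra) rigid_subalgebra_module_iff:
  "rigid (ring_of_type_algebra :: 'k ring) (subalgebra_module A \<iota>) \<longleftrightarrow>
    (\<forall>\<delta>. alg_lnd A \<iota> \<delta> \<longrightarrow> (\<forall>f\<in>A. \<delta> f = 0))"
  unfolding rigid_def nonzero_lnd_iff by (intro iffI allI impI notI ballI; (elim exE)?; blast)

lemma (in subalgebra) semirigid_subalgebra_module_iff:
  "semirigid (ring_of_type_algebra :: 'k ring) (subalgebra_module A \<iota>) \<longleftrightarrow>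
    (\<forall>\<delta> \<delta>'. alg_lnd A \<iota> \<delta> \<longrightarrow> (\<exists>f\<in>A. \<delta> f \<noteq> 0) \<longrightarrow> alg_lnd A \<iota> \<delta>' \<longrightarrow>
      (\<exists>f\<in>A. \<delta>' f \<noteq> 0) \<longrightarrow> (\<forall>f\<in>A. \<delta> f = 0 \<longleftrightarrow> \<delta>' f = 0))"
proof -
  have "lnd_equivalent (subalgebra_module A \<iota>) \<delta> \<delta>' \<longleftrightarrow> (\<forall>f\<in>A. \<delta> f = 0 \<longleftrightarrow> \<delta>' f = 0)" for \<delta> \<delta>'
    unfolding lnd_equivalent_def a_kernel_def' by (auto simp: subalgebra_module_def)
  thus ?thesis unfolding semirigid_def nonzero_lnd_iff by (simp only: imp_conjL)
qed

context trinomial_point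
begin

text \<open>Injectivity is \<open>eval_eq_0_iff\<close>. The images of the classes of the variables
  are part of the conclusion because kernels will be compared on them.\<close>

lemma trinomial_algebra_iso:
  obtains h where
    "algebra_iso (ring_of_type_algebra :: 'k ring) (trinomial_algebra r n l a d)
      (subalgebra_module (coord_ring d) lconst) h"
    "\<And>x. x \<in> tvars r n d \<Longrightarrow>
      h (rel_ideal d +>\<^bsub>mpoly_ring (tvars r n d)\<^esub> mvar x) = gen x"
proof -
  let ?P = "mpoly_ring (tvars r n d) :: (tvar, 'k) mpol ring"
  let ?I = "rel_ideal d" and ?R = "trinomial_algebra r n l a d"
  let ?B = "subalgebra_module (coord_ring d) lconst :: ('k, 'k laurent) module"
  interpret P: cring ?P by (rule cring_mpoly_ring)
  interpret I: ideal ?I ?P by (rule ideal_rel_ideal)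
  interpret Q: cring "?P Quot ?I" by (rule I.quotient_is_cring[OF P.is_cring])
  interpret q: ring_hom_ring ?P "?P Quot ?I" "(+>\<^bsub>?P\<^esub>) ?I" by (rule I.rcos_ring_hom_ring)
  \<comment> \<open>Evaluation is constant on a coset of the relation ideal, so the image of a coset
    is a singleton.\<close>
  define h where "h Y = the_elem (evaluate ` Y)" for Y
  have carrier_R: "carrier ?R = (\<lambda>p. ?I +>\<^bsub>?P\<^esub> p) ` carrier ?P"
    by (auto simp: trinomial_algebra_def FactRing_def A_RCOSETS_def')
  have h: "h (?I +>\<^bsub>?P\<^esub> p) = evaluate p" if "p \<in> carrier ?P" for p
  proof -
    have "evaluate ` (?I +>\<^bsub>?P\<^esub> p) = {evaluate p}"
    proof -
      have "?I +>\<^bsub>?P\<^esub> p = (\<lambda>i. i + p) ` ?I"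
        unfolding a_r_coset_def' by auto
      thus ?thesis using rel_ideal_0[of d] by (force simp: eval_add eval_rel_ideal image_iff)
    qed
    thus ?thesis by (simp add: h_def)
  qed
  have add: "(?I +>\<^bsub>?P\<^esub> p) \<oplus>\<^bsub>?R\<^esub> (?I +>\<^bsub>?P\<^esub> p') = ?I +>\<^bsub>?P\<^esub> (p + p')"
    and mult: "(?I +>\<^bsub>?P\<^esub> p) \<otimes>\<^bsub>?R\<^esub> (?I +>\<^bsub>?P\<^esub> p') = ?I +>\<^bsub>?P\<^esub> (p * p')"
    and scale: "b \<odot>\<^bsub>?R\<^esub> (?I +>\<^bsub>?P\<^esub> p) = ?I +>\<^bsub>?P\<^esub> (mconst b * p)"
    if "p \<in> carrier ?P" "p' \<in> carrier ?P" for p p' b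
    using that q.hom_add[of p p'] q.hom_mult[of p p'] q.hom_mult[OF mconst_mem_mpoly_ring[of b], of p]
    by (simp_all only: trinomial_algebra_def quot_algebra_simps mpoly_ring_simps(2,3))
  have zero: "\<zero>\<^bsub>?R\<^esub> = ?I +>\<^bsub>?P\<^esub> 0"
    using q.hom_zero by (simp only: trinomial_algebra_def quot_algebra_simps mpoly_ring_simps)
  have inj: "inj_on h (carrier ?R)"
  proof (rule inj_onI)
    fix Y Y' assume "Y \<in> carrier ?R" "Y' \<in> carrier ?R" "h Y = h Y'"
    then obtain p p' where p: "p \<in> carrier ?P" "p' \<in> carrier ?P" "Y = ?I +>\<^bsub>?P\<^esub> p" "Y' = ?I +>\<^bsub>?P\<^esub> p'"
      "evaluate p = evaluate p'"
      unfolding carrier_R using h by auto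
    have "evaluate (p - p') = 0" using p(5) by (simp only: eval_diff diff_self)
    hence "p - p' \<in> ?I" using eval_eq_0_iff[OF diff_mem_mpoly_ring[OF p(1,2)]] by blast
    moreover have "p \<ominus>\<^bsub>?P\<^esub> p' = p - p'"
    proof -
      have "- p' \<in> carrier ?P" using diff_mem_mpoly_ring[OF zero_mem_mpoly_ring p(2)] by (simp only: diff_0)
      hence "\<ominus>\<^bsub>?P\<^esub> p' = - p'" using P.minus_equality[of "- p'" p'] p by simp
      thus ?thesis by (simp add: a_minus_def)
    qed
    ultimately show "Y = Y'"
      unfolding p(3,4) using P.quotient_eq_iff_same_a_r_cos[OF ideal_rel_ideal p(1,2)] by simp
  qed
  have "algebra_iso (ring_of_type_algebra :: 'k ring) ?R ?B h"
    unfolding algebra_iso_def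
  proof (intro conjI ballI)
    show "bij_betw h (carrier ?R) (carrier ?B)"
      using inj unfolding bij_betw_def carrier_R subalgebra_module_def coord_ring_def
      by (simp only: image_image h partial_object.select_convs cong: image_cong)
  next
    show "\<zero>\<^bsub>?R\<^esub> \<in> carrier ?R" unfolding zero carrier_R by (rule imageI) (rule zero_mem_mpoly_ring)
    show "h \<zero>\<^bsub>?R\<^esub> = \<zero>\<^bsub>?B\<^esub>"
      unfolding zero h[OF zero_mem_mpoly_ring] by (simp add: eval_0 subalgebra_module_def)
  next
    fix Y Y' assume "Y \<in> carrier ?R" "Y' \<in> carrier ?R"
    then obtain p p' where p: "p \<in> carrier ?P" "p' \<in> carrier ?P" and Y: "Y = ?I +>\<^bsub>?P\<^esub> p" "Y' = ?I +>\<^bsub>?P\<^esub> p'"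
      unfolding carrier_R by blast
    show "Y \<oplus>\<^bsub>?R\<^esub> Y' \<in> carrier ?R" "Y \<otimes>\<^bsub>?R\<^esub> Y' \<in> carrier ?R"
      unfolding Y add[OF p] mult[OF p] unfolding carrier_R
      by (intro imageI add_mem_mpoly_ring mult_mem_mpoly_ring p)+
    show "h (Y \<oplus>\<^bsub>?R\<^esub> Y') = h Y \<oplus>\<^bsub>?B\<^esub> h Y'" "h (Y \<otimes>\<^bsub>?R\<^esub> Y') = h Y \<otimes>\<^bsub>?B\<^esub> h Y'"
      unfolding Y add[OF p] mult[OF p] h[OF p(1)] h[OF p(2)]
        h[OF add_mem_mpoly_ring[OF p]] h[OF mult_mem_mpoly_ring[OF p]]
      by (simp_all add: subalgebra_module_def eval_add eval_mult)
  next
    fix b :: 'k and Y assume "Y \<in> carrier ?R"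
    then obtain p where p: "p \<in> carrier ?P" and Y: "Y = ?I +>\<^bsub>?P\<^esub> p" unfolding carrier_R by blast
    note bp = mult_mem_mpoly_ring[OF mconst_mem_mpoly_ring[of b] p]
    show "b \<odot>\<^bsub>?R\<^esub> Y \<in> carrier ?R" unfolding Y scale[OF p p] unfolding carrier_R by (rule imageI[OF bp])
    show "h (b \<odot>\<^bsub>?R\<^esub> Y) = b \<odot>\<^bsub>?B\<^esub> h Y"
      unfolding Y scale[OF p p] h[OF p] h[OF bp] by (simp add: subalgebra_module_def eval_mult eval_mconst)
  qed
  moreover have "h (?I +>\<^bsub>?P\<^esub> mvar x) = gen x" if "x \<in> tvars r n d" for x
    using h[OF mvar_mem_mpoly_ring[OF that]] by (simp add: gen_def)
  ultimately show ?thesis by (rule that)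
qed

end

section \<open>Derivations of the coordinate algebra\<close>

definition wt_part :: "((tvar \<Rightarrow>\<^sub>0 int) \<Rightarrow> int) \<Rightarrow> int \<Rightarrow> 'k::field_char_0 laurent \<Rightarrow> 'k laurent" where
  "wt_part \<omega> k = Poly_Mapping.mapp (\<lambda>e b. if \<omega> e = k then b else 0)"

lemma lookup_wt_part: "lookup (wt_part \<omega> k f) e = (if \<omega> e = k then lookup f e else 0)"
  by (auto simp: wt_part_def lookup_mapp when_def in_keys_iff)

lemma wt_part_eq_iff: "wt_part \<omega> k f = f \<longleftrightarrow> (\<forall>e\<in>keys f. \<omega> e = k)"
  by (auto simp: poly_mapping_eq_iff fun_eq_iff lookup_wt_part in_keys_iff)

lemma wt_part_single:
  "wt_part \<omega> k (single e b) = (if \<omega> e = k then single e b else 0)"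
  by (rule poly_mapping_eqI) (simp add: lookup_wt_part lookup_single when_def)

lemma wt_part_add: "wt_part \<omega> k (f + g) = wt_part \<omega> k f + wt_part \<omega> k g"
  by (rule poly_mapping_eqI) (simp add: lookup_wt_part lookup_add)

lemma wt_part_sum: "wt_part \<omega> k (sum f J) = (\<Sum>j\<in>J. wt_part \<omega> k (f j))"
  by (rule poly_mapping_eqI) (simp add: lookup_wt_part lookup_sum)

text \<open>This is \<open>\<partial>/\<partial>w\<close>: the parameters are constants, and the
  coefficients are series in \<open>w - z\<close>.\<close>

definition coeff_deriv :: "'k::field_char_0 laurent \<Rightarrow> 'k laurent" where
  "coeff_deriv = Poly_Mapping.map fps_deriv"

lemma lookup_coeff_deriv: "lookup (coeff_deriv f) e = fps_deriv (lookup f e)"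
  by (simp add: coeff_deriv_def Poly_Mapping.map.rep_eq when_def)

lemma coeff_deriv_add: "coeff_deriv (f + g) = coeff_deriv f + coeff_deriv g"
  by (rule poly_mapping_eqI) (simp add: lookup_coeff_deriv lookup_add)

lemma coeff_deriv_sum: "coeff_deriv (sum f J) = (\<Sum>j\<in>J. coeff_deriv (f j))"
  by (rule poly_mapping_eqI) (simp add: lookup_coeff_deriv lookup_sum fps_deriv_sum)

lemma coeff_deriv_single: "coeff_deriv (single e b) = single e (fps_deriv b)"
  by (rule poly_mapping_eqI) (simp add: lookup_coeff_deriv lookup_single when_def)

lemma coeff_deriv_mult: "coeff_deriv (f * g) = coeff_deriv f * g + f * coeff_deriv g"
proof -
  let ?F = "\<lambda>e. single e (lookup f e)" and ?G = "\<lambda>e. single e (lookup g e)"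
  have single: "coeff_deriv (?F e * ?G e') = coeff_deriv (?F e) * ?G e' + ?F e * coeff_deriv (?G e')" for e e'
    by (simp add: mult_single coeff_deriv_single single_add add.commute)
  have "coeff_deriv ((\<Sum>e\<in>keys f. ?F e) * (\<Sum>e\<in>keys g. ?G e)) =
      coeff_deriv (\<Sum>e\<in>keys f. ?F e) * (\<Sum>e\<in>keys g. ?G e) + (\<Sum>e\<in>keys f. ?F e) * coeff_deriv (\<Sum>e\<in>keys g. ?G e)"
    unfolding sum_product coeff_deriv_sum single sum.distrib ..
  thus ?thesis by (simp only: poly_mapping_sum_single)
qed

lemma subalgebra_UNIV: "subalgebra (UNIV :: 'k::field_char_0 laurent set) lconst"
  by unfold_locales (simp_all add: lconst_def mult_single flip: single_add)

lemma derivation_coeff_deriv: "alg_derivation (UNIV :: 'k::field_char_0 laurent set) lconst coeff_deriv"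
proof -
  interpret subalgebra "UNIV :: 'k laurent set" lconst by (rule subalgebra_UNIV)
  have "coeff_deriv (lconst b) = 0" for b :: 'k by (simp add: lconst_def coeff_deriv_single)
  thus ?thesis by unfold_locales (simp_all add: coeff_deriv_add coeff_deriv_mult)
qed

context trinomial_point
begin

lemma root_part_single: "root_part (single x 1) = (\<Prod>i\<in>{1..r}. if x = T i (c i) then \<beta> i else 1)"
  unfolding root_part_def by (rule prod.cong) (auto simp: lookup_single when_def)

lemma root_part_single_other: "(\<And>i. i \<in> {1..r} \<Longrightarrow> x \<noteq> T i (c i)) \<Longrightarrow> root_part (single x 1) = 1"
  unfolding root_part_single by (rule prod.neutral) auto

lemma gen_power: "gen x ^ k = pt_monom (single x k)"
proof (induction k)
  case 0
  show ?case by (simp add: monom_0)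
next
  case (Suc k)
  have "gen x ^ Suc k = gen x * pt_monom (single x k)" using Suc by simp
  also have "\<dots> = pt_monom (single x 1 + single x k)" by (simp only: gen_eq monom_add)
  also have "single x 1 + single x k = single x (Suc k)" by (simp flip: single_add)
  finally show ?case .
qed

lemma evaluate_eq: "evaluate p = (\<Sum>m\<in>keys p. lconst (lookup p m) * pt_monom m)"
  by (simp add: evaluate_def)

lemma monom_in:
  assumes "keys m \<subseteq> tvars r n d"
  shows "lconst b * pt_monom m \<in> coord_ring d"
  unfolding coord_ring_def
  by (rule image_eqI[of _ _ "single m b"]) (use assms in \<open>auto simp: eval_single\<close>)

lemma wt_part_monom:
  "wt_part \<omega> k (lconst b * pt_monom m) = (if \<omega> (expo m) = k then lconst b * pt_monom m else 0)"
  by (simp add: pt_monom_def lconst_def mult_single wt_part_single)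

context
  fixes \<omega> :: "(tvar \<Rightarrow>\<^sub>0 int) \<Rightarrow> int"
  assumes \<omega>_add: "\<And>e e'. \<omega> (e + e') = \<omega> e + \<omega> e'"
begin

text \<open>Each monomial evaluates to a single Laurent term and so is homogeneous for any additive
  weight. Hence the components of an element of the coordinate ring stay in it.\<close>

lemma graded_coord_ring: "graded_subalgebra (coord_ring d) lconst (wt_part \<omega>)"
proof
  show "wt_part \<omega> k (f + g) = wt_part \<omega> k f + wt_part \<omega> k g" for k and f g :: "'k laurent"
    by (rule wt_part_add)
  show "wt_part \<omega> k (wt_part \<omega> j f) = (if k = j then wt_part \<omega> j f else 0)" for k j and f :: "'k laurent"
    by (auto intro!: poly_mapping_eqI simp: lookup_wt_part)
  show fin: "finite {k. wt_part \<omega> k f \<noteq> 0}" for f :: "'k laurent"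
  proof (rule finite_subset)
    show "{k. wt_part \<omega> k f \<noteq> 0} \<subseteq> \<omega> ` keys f"
    proof
      fix k assume "k \<in> {k. wt_part \<omega> k f \<noteq> 0}"
      then obtain e where "lookup (wt_part \<omega> k f) e \<noteq> 0"
        unfolding mem_Collect_eq poly_mapping_eq_iff fun_eq_iff lookup_zero by blast
      thus "k \<in> \<omega> ` keys f" by (auto simp: lookup_wt_part in_keys_iff split: if_splits)
    qed
  qed simp
  show "(\<Sum>k | wt_part \<omega> k f \<noteq> 0. wt_part \<omega> k f) = f" for f :: "'k laurent"
  proof (rule poly_mapping_eqI)
    fix e
    have "lookup f e = 0" if "wt_part \<omega> (\<omega> e) f = 0"
      using lookup_wt_part[of \<omega> "\<omega> e" f e] that by simp
    moreover have "lookup (\<Sum>k | wt_part \<omega> k f \<noteq> 0. wt_part \<omega> k f) e =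
        (if wt_part \<omega> (\<omega> e) f \<noteq> 0 then lookup f e else 0)"
      unfolding lookup_sum lookup_wt_part sum.delta'[OF fin] by (simp only: mem_Collect_eq)
    ultimately show "lookup (\<Sum>k | wt_part \<omega> k f \<noteq> 0. wt_part \<omega> k f) e = lookup f e"
      by (simp split: if_splits)
  qed
  show "wt_part \<omega> (i + j) (f * g) = f * g"
    if "wt_part \<omega> i f = f" "wt_part \<omega> j g = g" for i j and f g :: "'k laurent"
    unfolding wt_part_eq_iff
  proof
    fix e assume "e \<in> keys (f * g)"
    then obtain e1 e2 where "e = e1 + e2" "e1 \<in> keys f" "e2 \<in> keys g" using keys_mult[of f g] by blast
    thus "\<omega> e = i + j" using that by (simp add: wt_part_eq_iff \<omega>_add)
  qed
  have "\<omega> 0 = 0" using \<omega>_add[of 0 0] by simp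
  thus "wt_part \<omega> 0 (lconst b) = lconst b" for b :: 'k
    by (simp add: lconst_def wt_part_single)
  show "wt_part \<omega> k f \<in> coord_ring d" if f: "f \<in> coord_ring d" for k f
  proof -
    obtain p where p: "p \<in> carrier (mpoly_ring (tvars r n d))" "f = evaluate p"
      using f unfolding coord_ring_def by blast
    show ?thesis
      unfolding p(2) evaluate_eq wt_part_sum wt_part_monom
      using p(1) by (intro alg.sum_in) (auto intro: monom_in alg.zero_in)
  qed
qed

lemma divisible_if_weights:
  assumes f: "f \<in> coord_ring d"
    and ge: "\<And>m. keys m \<subseteq> tvars r n d \<Longrightarrow> wt_part \<omega> (\<omega> (expo m)) f \<noteq> 0 \<Longrightarrow> k \<le> lookup m x"
  shows "\<exists>h\<in>coord_ring d. f = gen x ^ k * h"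
proof -
  interpret G: graded_subalgebra "coord_ring d" lconst "wt_part \<omega>" by (rule graded_coord_ring)
  obtain p where p: "p \<in> carrier (mpoly_ring (tvars r n d))" "f = evaluate p"
    using f unfolding coord_ring_def by blast
  define M where "M = {m \<in> keys p. wt_part \<omega> (\<omega> (expo m)) f \<noteq> 0}"
  define K where "K = {k. wt_part \<omega> k f \<noteq> 0}"
  have "f = (\<Sum>k\<in>K. wt_part \<omega> k f)" unfolding K_def by (rule G.sum_pr[symmetric])
  also have "\<dots> = (\<Sum>k\<in>K. \<Sum>m\<in>keys p. if \<omega> (expo m) = k then lconst (lookup p m) * pt_monom m else 0)"
    unfolding p(2) evaluate_eq wt_part_sum wt_part_monom ..
  also have "\<dots> = (\<Sum>m\<in>keys p. \<Sum>k\<in>K. if \<omega> (expo m) = k then lconst (lookup p m) * pt_monom m else 0)"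
    by (rule sum.swap)
  also have "\<dots> = (\<Sum>m\<in>keys p. if m \<in> M then lconst (lookup p m) * pt_monom m else 0)"
  proof (rule sum.cong)
    fix m assume "m \<in> keys p"
    moreover have "finite K" unfolding K_def by (rule G.finite_pr)
    ultimately show "(\<Sum>k\<in>K. if \<omega> (expo m) = k then lconst (lookup p m) * pt_monom m else 0) =
        (if m \<in> M then lconst (lookup p m) * pt_monom m else 0)"
      by (simp add: M_def K_def)
  qed simp
  also have "\<dots> = (\<Sum>m\<in>keys p. gen x ^ k * (if m \<in> M then lconst (lookup p m) * pt_monom (m - single x k) else 0))"
  proof (rule sum.cong)
    fix m assume m: "m \<in> keys p"
    show "(if m \<in> M then lconst (lookup p m) * pt_monom m else 0) =
        gen x ^ k * (if m \<in> M then lconst (lookup p m) * pt_monom (m - single x k) else 0)"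
    proof (cases "m \<in> M")
      case True
      have "keys m \<subseteq> tvars r n d" using m p(1) by auto
      hence "k \<le> lookup m x" using True ge by (simp add: M_def)
      hence "m = single x k + (m - single x k)"
        by (intro poly_mapping_eqI) (auto simp: lookup_add lookup_minus lookup_single when_def)
      hence "pt_monom m = pt_monom (single x k + (m - single x k))" by (rule arg_cong)
      also have "\<dots> = gen x ^ k * pt_monom (m - single x k)" by (simp only: gen_power monom_add)
      finally have "pt_monom m = gen x ^ k * pt_monom (m - single x k)" .
      thus ?thesis using True by (simp add: mult.left_commute)
    qed simp
  qed simp
  finally have "f = gen x ^ k * (\<Sum>m\<in>keys p. if m \<in> M then lconst (lookup p m) * pt_monom (m - single x k) else 0)"
    by (simp only: sum_distrib_left)
  moreover have "keys (m - single x k) \<subseteq> tvars r n d" if "m \<in> keys p" for m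
  proof -
    have "keys (m - single x k) \<subseteq> keys m" by (auto simp: in_keys_iff lookup_minus)
    thus ?thesis using that p(1) by auto
  qed
  hence "(\<Sum>m\<in>keys p. if m \<in> M then lconst (lookup p m) * pt_monom (m - single x k) else 0) \<in> coord_ring d"
    by (intro alg.sum_in) (simp add: monom_in alg.zero_in)
  ultimately show ?thesis by blast
qed

lemma gen_homog:
  assumes "x \<in> tvars r n d"
  shows "gen x \<in> graded_subalgebra.homog (coord_ring d) (wt_part \<omega>) (\<omega> (expo (single x 1)))"
proof -
  interpret G: graded_subalgebra "coord_ring d" lconst "wt_part \<omega>" by (rule graded_coord_ring)
  show ?thesis
    using gen_in[OF assms] by (simp add: G.homog_def gen_eq pt_monom_def wt_part_single)
qed

end

text \<open>The formal partial derivative of \<open>tmonom n l i\<close> with respect to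
  \<open>T i (c i)\<close>.\<close>

definition partial :: "nat \<Rightarrow> 'k laurent" where
  "partial i = of_nat (l i (c i)) * gen (T i (c i)) ^ (l i (c i) - 1) *
     (\<Prod>j\<in>{1..n i} - {c i}. gen (T i j) ^ l i j)"

lemma T_in: "i \<in> {1..r} \<Longrightarrow> j \<in> {1..n i} \<Longrightarrow> gen (T i j) \<in> coord_ring d"
  by (rule gen_in) (auto simp: tvars_def)

lemma partial_in: "i \<in> {1..r} \<Longrightarrow> partial i \<in> coord_ring d"
  unfolding partial_def
  by (intro alg.mult_in alg.power_in alg.prod_in alg.of_nat_in T_in c_in) auto

lemma partial_nonzero: "i \<in> {1..r} \<Longrightarrow> partial i \<noteq> 0"
  using l_ge[OF _ c_in, of i] alg.of_nat_nonzero[of "l i (c i)"] gen_nonzero by (simp add: partial_def)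

lemma derivation_tmonom:
  assumes \<delta>: "alg_derivation B lconst \<delta>" and B: "\<And>j. j \<in> {1..n i} \<Longrightarrow> gen (T i j) \<in> B"
    and i: "i \<in> {1..r}" and ker: "\<And>j. j \<in> {1..n i} \<Longrightarrow> j \<noteq> c i \<Longrightarrow> \<delta> (gen (T i j)) = 0"
  shows "\<delta> (\<Prod>j\<in>{1..n i}. gen (T i j) ^ l i j) = partial i * \<delta> (gen (T i (c i)))"
proof -
  interpret d: alg_derivation B lconst \<delta> by fact
  have "\<delta> (\<Prod>j\<in>J. gen (T i j) ^ l i j) = 0" if "J \<subseteq> {1..n i} - {c i}" for J
    using that
  proof (induction J rule: infinite_finite_induct)
    case (insert j J)
    hence "gen (T i j) \<in> B" "(\<Prod>j\<in>J. gen (T i j) ^ l i j) \<in> B" using B by (auto intro!: d.prod_in d.power_in)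
    thus ?case using insert ker by (simp add: d.der_mult d.power_in d.der_power)
  qed (use d.der_const[of 1] in \<open>simp_all add: d.const_1\<close>)
  hence "\<delta> (\<Prod>j\<in>{1..n i} - {c i}. gen (T i j) ^ l i j) = 0" by blast
  moreover have "(\<Prod>j\<in>{1..n i} - {c i}. gen (T i j) ^ l i j) \<in> B"
    using B by (intro d.prod_in d.power_in) auto
  moreover have "gen (T i (c i)) \<in> B" using B c_in[OF i] by blast
  ultimately show ?thesis
    by (subst prod.remove[OF _ c_in[OF i]])
       (simp_all add: d.der_mult d.power_in d.der_power partial_def mult_ac)
qed

text \<open>\<open>\<partial>/\<partial>w\<close> sends \<open>T i (c i)\<close> to the inverse of
  \<open>partial i\<close>; multiplying by all \<open>partial i\<close> clears these denominators.
  For \<open>i \<noteq> i0\<close> the exponent \<open>1\<close> removes \<open>T i (c i)\<close>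
  from \<open>partial i\<close>, which is thus nilpotent. This makes \<open>T i0 (c i0)\<close>
  nilpotent, then \<open>partial i0\<close>, and finally the remaining variables.\<close>

lemma lnd_exists:
  assumes i0: "i0 \<in> {1..r}" and l1: "\<And>i. i \<in> {1..r} \<Longrightarrow> i \<noteq> i0 \<Longrightarrow> l i (c i) = 1"
  shows "\<exists>\<delta>. coord_lnd d \<delta> \<and>
    (\<forall>i\<in>{1..r}. \<forall>j\<in>{1..n i}. \<delta> (gen (T i j)) = 0 \<longleftrightarrow> j \<noteq> c i)"
proof -
  interpret D: alg_derivation UNIV lconst "coeff_deriv :: 'k laurent \<Rightarrow> _" by (rule derivation_coeff_deriv)
  define u where "u = (\<Prod>i\<in>{1..r}. partial i)"
  define \<delta> where "\<delta> f = u * coeff_deriv f" for f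
  have D_T: "coeff_deriv (gen (T i j)) = 0" if "j \<noteq> c i" for i j
  proof -
    have "root_part (single (T i j) 1) = 1" by (rule root_part_single_other) (use that in auto)
    thus ?thesis by (simp add: gen_eq pt_monom_def coeff_deriv_single del: One_nat_def)
  qed
  have D_S: "coeff_deriv (gen (S k)) = 0" for k
    by (simp add: gen_eq pt_monom_def root_part_single_other coeff_deriv_single del: One_nat_def)
  have D_c: "partial i * coeff_deriv (gen (T i (c i))) = 1" if i: "i \<in> {1..r}" for i
    using derivation_tmonom[OF derivation_coeff_deriv UNIV_I i D_T]
    unfolding prod_gen[OF i] coeff_deriv_single by (simp add: fps_of_poly_pCons)
  have \<delta>_c: "\<delta> (gen (T i (c i))) = (\<Prod>i'\<in>{1..r} - {i}. partial i')" if i: "i \<in> {1..r}" for i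
  proof -
    have "\<delta> (gen (T i (c i))) = (partial i * coeff_deriv (gen (T i (c i)))) * (\<Prod>i'\<in>{1..r} - {i}. partial i')"
      unfolding \<delta>_def u_def by (subst prod.remove[OF _ i]) (simp_all add: mult_ac)
    thus ?thesis by (simp add: D_c[OF i])
  qed
  have ker: "\<delta> (gen (T i j)) = 0 \<longleftrightarrow> j \<noteq> c i" if "i \<in> {1..r}" for i j
    using that \<delta>_c[OF that] partial_nonzero by (cases "j = c i") (simp_all add: D_T \<delta>_def)
  have gens: "\<delta> x \<in> coord_ring d" if "x \<in> gen ` tvars r n d" for x
  proof -
    from that consider k where "x = gen (S k)" | i j where "x = gen (T i j)" "i \<in> {1..r}" "j \<noteq> c i"
      | i where "x = gen (T i (c i))" "i \<in> {1..r}"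
      unfolding tvars_def by blast
    thus ?thesis
    proof cases
      case (3 i)
      show ?thesis unfolding 3(1) \<delta>_c[OF 3(2)] by (intro alg.prod_in partial_in) blast
    qed (simp_all add: \<delta>_def D_S D_T alg.zero_in)
  qed
  interpret U: alg_derivation UNIV lconst \<delta>
    unfolding \<delta>_def by (rule D.scale_derivation) simp
  interpret d: alg_derivation "coord_ring d" lconst \<delta>
    by (rule U.restrict_derivation[OF alg.subalgebra_axioms coord_ring_eq _ gens]) auto
  have nil_T: "\<exists>k. (\<delta> ^^ k) (gen (T i j)) = 0" if "i \<in> {1..r}" "j \<noteq> c i" for i j
    by (rule exI[of _ 1]) (use ker[OF that(1), of j] that(2) in simp)
  \<comment> \<open>The image of \<open>T i (c i)\<close> omits \<open>partial i\<close>, so for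
    \<open>i0\<close> the argument is not circular.\<close>
  have nil_gens: "\<exists>k. (\<delta> ^^ k) (gen (T i (c i))) = 0"
    if i: "i \<in> {1..r}" and "\<And>i'. i' \<in> {1..r} - {i} \<Longrightarrow> \<exists>k. (\<delta> ^^ k) (partial i') = 0" for i
  proof -
    have "\<exists>k. (\<delta> ^^ k) (\<delta> (gen (T i (c i)))) = 0"
      unfolding \<delta>_c[OF i] using that(2) by (intro d.nilpotent_prod partial_in) auto
    then obtain k where "(\<delta> ^^ Suc k) (gen (T i (c i))) = 0"
      by (auto simp: funpow_Suc_right simp del: funpow.simps)
    thus ?thesis by blast
  qed
  have nil_rest: "\<exists>k. (\<delta> ^^ k) (\<Prod>j\<in>{1..n i} - {c i}. gen (T i j) ^ l i j) = 0" if "i \<in> {1..r}" for i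
    using that by (intro d.nilpotent_prod d.nilpotent_power alg.power_in T_in nil_T) auto
  have rest_in: "(\<Prod>j\<in>{1..n i} - {c i}. gen (T i j) ^ l i j) \<in> coord_ring d" if "i \<in> {1..r}" for i
    using that by (intro alg.prod_in alg.power_in T_in) auto
  have nil_partial: "\<exists>k. (\<delta> ^^ k) (partial i) = 0" if "i \<in> {1..r}" "i \<noteq> i0" for i
    using nil_rest[OF that(1)] l1[OF that] by (simp add: partial_def)
  have nil_c0: "\<exists>k. (\<delta> ^^ k) (gen (T i0 (c i0))) = 0"
    using nil_partial by (intro nil_gens[OF i0]) auto
  have "\<exists>k. (\<delta> ^^ k) (of_nat (l i0 (c i0))) = 0"
    using d.der_const[of "of_nat (l i0 (c i0))"]
    by (intro exI[of _ 1]) (simp add: alg.const_of_nat)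
  hence nil_partial0: "\<exists>k. (\<delta> ^^ k) (partial i0) = 0"
    unfolding partial_def
    by (intro d.nilpotent_mult d.nilpotent_power alg.mult_in alg.power_in alg.of_nat_in T_in c_in nil_rest rest_in i0 nil_c0)
  have "coord_lnd d \<delta>"
  proof (rule d.lnd_if_nilpotent_generators[OF coord_ring_eq])
    fix x assume "x \<in> gen ` tvars r n d"
    then consider k where "x = gen (S k)" | i j where "x = gen (T i j)" "i \<in> {1..r}" "j \<noteq> c i"
      | i where "x = gen (T i (c i))" "i \<in> {1..r}"
      unfolding tvars_def by blast
    thus "\<exists>k. (\<delta> ^^ k) x = 0"
    proof cases
      case (1 k)
      thus ?thesis by (intro exI[of _ 1]) (simp add: \<delta>_def D_S)
    next
      case (2 i j)
      thus ?thesis using nil_T by simp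
    next
      case (3 i)
      have "\<exists>k. (\<delta> ^^ k) (partial i') = 0" if "i' \<in> {1..r} - {i}" for i'
        using that nil_partial[of i'] nil_partial0 by (cases "i' = i0") simp_all
      thus ?thesis unfolding 3(1) by (rule nil_gens[OF 3(2)])
    qed
  qed
  thus ?thesis using ker by (intro exI[of _ \<delta>] conjI ballI)
qed

text \<open>\<open>mason\<close> kills the monomial of \<open>i\<close>. The monomials of all
  \<open>k\<close> differ from it by constants, so they are killed too, and factorial closedness
  passes this on to their variables.\<close>

lemma lnd_T_eq_0:
  assumes \<delta>: "coord_lnd d \<delta>"
    and i: "i \<in> {1..r}" "i' \<in> {1..r}" "i \<noteq> i'"
    and ge: "\<And>j. j \<in> {1..n i} \<Longrightarrow> l i j \<ge> 2 \<or> \<delta> (gen (T i j)) = 0"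
      "\<And>j. j \<in> {1..n i'} \<Longrightarrow> l i' j \<ge> 2 \<or> \<delta> (gen (T i' j)) = 0"
    and k: "k \<in> {1..r}" "j \<in> {1..n k}"
  shows "\<delta> (gen (T k j)) = 0"
proof -
  interpret d: alg_lnd "coord_ring d" lconst \<delta> by fact
  have "a i' - a i \<noteq> 0" using inj_onD[OF a_inj, of i' i] i by auto
  hence \<kappa>: "lconst (a i' - a i) \<noteq> 0" by (simp add: alg.const_eq_0_iff)
  have "\<delta> (\<Prod>j\<in>{1..n i}. gen (T i j) ^ l i j) = 0"
    by (rule d.mason[OF _ T_in[OF i(1)] gen_nonzero l_ge[OF i(1)] ge(1) _ T_in[OF i(2)] gen_nonzero
          l_ge[OF i(2)] ge(2) prod_gen_diff[OF i(1,2)] alg.const_in d.der_const \<kappa>]) simp_all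
  moreover have "(\<Prod>j\<in>{1..n i}. gen (T i j) ^ l i j) \<in> coord_ring d"
    using i by (intro alg.prod_in alg.power_in T_in)
  ultimately have "\<delta> (\<Prod>j\<in>{1..n k}. gen (T k j) ^ l k j) = 0"
    unfolding prod_gen_diff[OF k(1) i(1)] by (simp add: d.der_add alg.const_in d.der_const)
  thus ?thesis
    using d.factorially_closed_prod[of "{1..n k}" "\<lambda>j. gen (T k j)" "l k" j] T_in[OF k(1)] gen_nonzero l_ge[OF k(1)] k(2)
    by simp
qed

end

section \<open>Semirigid coordinate algebras\<close>

text \<open>The centre \<open>z\<close> avoids all \<open>a i\<close>, so each
  \<open>w - a i\<close> is a series in \<open>w - z\<close> with nonzero constant term and has the
  required root.\<close>

lemma (in trinomial_data) point_exists:
  assumes "\<And>i. i \<in> {1..r} \<Longrightarrow> c i \<in> {1..n i}"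
  obtains z \<beta> where "trinomial_point r n l a c z \<beta>"
proof -
  have "\<exists>z. z \<notin> a ` {1..r}" by (rule ex_new_if_finite[OF infinite_UNIV_char_0]) simp
  then obtain z where z: "z \<notin> a ` {1..r}" by blast
  have "\<exists>g. g ^ l i (c i) = fps_of_poly [:- (a i - z), 1:]" if i: "i \<in> {1..r}" for i
  proof (rule nth_root_fps_exists)
    have "z \<noteq> a i" using z i by blast
    thus "fps_nth (fps_of_poly [:- (a i - z), 1:]) 0 \<noteq> 0" by simp
    show "l i (c i) > 0" using l_ge[OF i assms[OF i]] by simp
  qed
  hence "\<forall>i\<in>{1..r}. \<exists>g. g ^ l i (c i) = fps_of_poly [:- (a i - z), 1:]" by blast
  then obtain \<beta> where \<beta>: "\<forall>i\<in>{1..r}. \<beta> i ^ l i (c i) = fps_of_poly [:- (a i - z), 1:]"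
    using bchoice[of "{1..r}"] by metis
  have "trinomial_point r n l a c z \<beta>"
  proof unfold_locales
    show "\<beta> i ^ l i (c i) = fps_of_poly [:- (a i - z), 1:]" if "i \<in> {1..r}" for i using \<beta> that by blast
  qed (fact assms)
  thus ?thesis by (rule that)
qed

section \<open>The algebra without variables \<open>S\<^sub>k\<close>\<close>

context trinomial_point
begin

lemma tvars_0: "tvars r n 0 = {T i j |i j. i \<in> {1..r} \<and> j \<in> {1..n i}}"
  by (auto simp: tvars_def)

lemma tvars_1: "tvars r n 1 = insert (S 1) (tvars r n 0)"
  by (auto simp: tvars_def)

lemma gen_0_cases:
  assumes "x \<in> gen ` tvars r n 0"
  obtains i j where "x = gen (T i j)" "i \<in> {1..r}" "j \<in> {1..n i}"
  using assms unfolding tvars_0 by blast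

text \<open>For the grading with weight \<open>1\<close> on \<open>T\<^bsub>ij\<^esub>\<close> and \<open>- l\<^bsub>ij\<^esub>\<close> on \<open>T\<^bsub>i c\<^sub>i\<^esub>\<close>, a lowest component of
  negative degree would send \<open>T\<^bsub>i c\<^sub>i\<^esub>\<close> into a multiple of its square, hence to \<open>0\<close>, and then vanish
  by the Mason--Stothers argument. So \<open>\<delta>\<close> does not lower degrees, and \<open>T\<^bsub>ij\<^esub>\<close> divides
  \<open>\<delta> T\<^bsub>ij\<^esub>\<close>.\<close>

lemma lnd_kernel:
  assumes \<delta>: "coord_lnd 0 \<delta>"
    and i0: "i0 \<in> {1..r}" "\<And>j. j \<in> {1..n i0} \<Longrightarrow> l i0 j \<ge> 2"
    and i: "i \<in> {1..r}" "i \<noteq> i0" "l i (c i) = 1" "\<And>j. j \<in> {1..n i} \<Longrightarrow> j \<noteq> c i \<Longrightarrow> l i j \<ge> 2"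
    and j: "j \<in> {1..n i}" "j \<noteq> c i"
  shows "\<delta> (gen (T i j)) = 0"
proof (cases "\<exists>f\<in>coord_ring 0. \<delta> f \<noteq> 0")
  case False
  thus ?thesis using T_in[OF i(1) j(1), of 0] by blast
next
  case True
  then obtain f\<^sub>0 where f0: "f\<^sub>0 \<in> coord_ring 0" "\<delta> f\<^sub>0 \<noteq> 0" by blast
  \<comment> \<open>The grading described above is the exponent of the parameter of
    \<open>T i j\<close>, because \<open>l i (c i) = 1\<close>.\<close>
  define \<omega> :: "(tvar \<Rightarrow>\<^sub>0 int) \<Rightarrow> int" where "\<omega> e = lookup e (T i j)" for e
  have \<omega>_add: "\<omega> (e + e') = \<omega> e + \<omega> e'" for e e' by (simp add: \<omega>_def lookup_add)
  have \<omega>: "\<omega> (expo m) = int (lookup m (T i j)) - int (l i j) * int (lookup m (T i (c i)))" for m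
    using i j by (simp add: \<omega>_def lookup_expo)
  interpret G: graded_subalgebra "coord_ring 0" lconst "wt_part \<omega>"
    by (rule graded_coord_ring[OF \<omega>_add])
  interpret d: alg_lnd "coord_ring 0" lconst \<delta> by fact
  have homog: "gen x \<in> G.homog (\<omega> (expo (single x 1)))" if "x \<in> tvars r n 0" for x
    by (rule gen_homog[OF \<omega>_add that])
  have homog': "\<exists>k. x \<in> G.homog k" if "x \<in> gen ` tvars r n 0" for x
    using that homog by blast
  have fin: "finite (gen ` tvars r n 0)" using finite_tvars by simp
  let ?x = "T i (c i)" and ?y = "T i j"
  have xy: "?x \<in> tvars r n 0" "?y \<in> tvars r n 0" using i j c_in[OF i(1)] by (auto simp: tvars_0)
  have wx: "\<omega> (expo (single ?x 1)) = - int (l i j)" and wy: "\<omega> (expo (single ?y 1)) = 1"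
    using j by (simp_all add: \<omega> lookup_single when_def del: One_nat_def)
  obtain k \<delta>' where shift: "G.shifts_by \<delta> k" and \<delta>': "coord_lnd 0 \<delta>'"
    and nz: "\<exists>f\<in>coord_ring 0. \<delta>' f \<noteq> 0"
    and deg: "\<And>m f. f \<in> G.homog m \<Longrightarrow> \<delta>' f \<in> G.homog (m + k)"
  proof -
    show thesis by (rule G.bottom_component[OF \<delta> f0 coord_ring_eq fin homog']) (assumption | rule that)+
  qed
  interpret d': alg_lnd "coord_ring 0" lconst \<delta>' by fact
  have "k \<ge> 0"
  proof (rule ccontr)
    assume k: "\<not> k \<ge> 0"
    have dx: "\<delta>' (gen ?x) \<in> G.homog (- int (l i j) + k)"
      using deg[OF homog[OF xy(1)]] unfolding wx .
    have "2 \<le> lookup m ?x" if m: "wt_part \<omega> (\<omega> (expo m)) (\<delta>' (gen ?x)) \<noteq> 0" for m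
    proof -
      have "\<omega> (expo m) = - int (l i j) + k"
        using G.pr_of_homog[OF dx, of "\<omega> (expo m)"] m by (auto split: if_splits)
      \<comment> \<open>As the exponent of \<open>?y\<close> is nonnegative, a weight below
        \<open>- int (l i j)\<close> forces the exponent of \<open>?x\<close> above
        \<open>1\<close>.\<close>
      hence "int (l i j) * int (lookup m ?x) > int (l i j) * 1" using k \<omega>[of m] by linarith
      hence "int (lookup m ?x) > 1" by (rule mult_left_less_imp_less) simp
      thus ?thesis by simp
    qed
    hence "\<exists>h\<in>coord_ring 0. \<delta>' (gen ?x) = gen ?x ^ 2 * h"
      by (rule divisible_if_weights[OF \<omega>_add G.homog_in[OF dx]])
    then obtain h where h: "h \<in> coord_ring 0" "\<delta>' (gen ?x) = gen ?x ^ 2 * h" ..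
    have "\<delta>' (gen ?x) = gen ?x * (gen ?x * h)" using h(2) by (simp add: power2_eq_square mult.assoc)
    hence zero: "\<delta>' (gen ?x) = 0"
      by (rule d'.der_eq_0_if_dvd[OF gen_in[OF xy(1)] alg.mult_in[OF gen_in[OF xy(1)] h(1)]])
    \<comment> \<open>Every exponent at the index \<open>i\<close> is at least \<open>2\<close>
      except that of \<open>?x\<close>, which is now in the kernel.\<close>
    have ge: "l i j' \<ge> 2 \<or> \<delta>' (gen (T i j')) = 0" if "j' \<in> {1..n i}" for j'
      using zero i(4)[OF that] by (cases "j' = c i") simp_all
    have ge0: "l i0 j' \<ge> 2 \<or> \<delta>' (gen (T i0 j')) = 0" if "j' \<in> {1..n i0}" for j'
      using i0(2)[OF that] by simp
    have "\<delta>' x = 0" if "x \<in> gen ` tvars r n 0" for x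
      using that by (rule gen_0_cases) (simp only: lnd_T_eq_0[OF \<delta>' i(1) i0(1) i(2) ge ge0])
    from d'.der_eq_0_if_generators[OF coord_ring_eq this] show False using nz by blast
  qed
  have "1 \<le> lookup m ?y" if m: "wt_part \<omega> (\<omega> (expo m)) (\<delta> (gen ?y)) \<noteq> 0" for m
  proof -
    have "\<not> \<omega> (expo m) < 1 + k"
    proof
      assume "\<omega> (expo m) < 1 + k"
      hence "wt_part \<omega> (\<omega> (expo m)) (\<delta> (gen ?y)) = 0"
        using G.shifts_byD[OF shift homog[OF xy(2)]] unfolding wy by simp
      thus False using m by contradiction
    qed
    hence "int (lookup m ?y) \<ge> 1 + int (l i j) * int (lookup m ?x)" using \<open>k \<ge> 0\<close> \<omega>[of m] by linarith
    moreover have "int (l i j) * int (lookup m ?x) \<ge> 0" by simp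
    ultimately show ?thesis by linarith
  qed
  hence "\<exists>h\<in>coord_ring 0. \<delta> (gen ?y) = gen ?y ^ 1 * h"
    by (rule divisible_if_weights[OF \<omega>_add d.der_in[OF gen_in[OF xy(2)]]])
  then obtain h where h: "h \<in> coord_ring 0" "\<delta> (gen ?y) = gen ?y ^ 1 * h" ..
  show ?thesis
    by (rule d.der_eq_0_if_dvd[OF gen_in[OF xy(2)] h(1)]) (use h(2) in simp)
qed

text \<open>By \<open>lnd_kernel\<close> an LND kills all \<open>T i j\<close> with
  \<open>j \<noteq> c i\<close>, so applying it to the relations makes
  \<open>partial i * \<delta> (gen (T i (c i)))\<close> independent of \<open>i\<close>. Its value
  at \<open>T i0 1\<close> thus determines it, and two LNDs are proportional with these values as
  multipliers.\<close>

lemma semirigid_coord_ring_0: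
  assumes i0: "i0 \<in> {1..r}" "n i0 = 1" "l i0 1 > 1"
    and i: "\<And>i. i \<in> {1..r} \<Longrightarrow> i \<noteq> i0 \<Longrightarrow> l i (c i) = 1"
      "\<And>i j. i \<in> {1..r} \<Longrightarrow> i \<noteq> i0 \<Longrightarrow> j \<in> {1..n i} \<Longrightarrow> j \<noteq> c i \<Longrightarrow> l i j > 1"
  shows "semirigid (ring_of_type_algebra :: 'k ring) (subalgebra_module (coord_ring 0) lconst)"
  unfolding alg.semirigid_subalgebra_module_iff
proof (intro allI impI)
  have c0: "c i0 = 1" using c_in[OF i0(1)] i0(2) by simp
  have ge0: "l i0 j \<ge> 2" if "j \<in> {1..n i0}" for j
    using that i0(2,3) by auto
  have ker: "\<delta> (gen (T i j)) = 0"
    if "coord_lnd 0 \<delta>" "i \<in> {1..r}" "j \<in> {1..n i}" "j \<noteq> c i" for \<delta> i j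
  proof -
    have "i \<noteq> i0" using that(3,4) c0 i0(2) by auto
    moreover have "l i j' \<ge> 2" if "j' \<in> {1..n i}" "j' \<noteq> c i" for j'
      using assms(5)[OF \<open>i \<in> {1..r}\<close> \<open>i \<noteq> i0\<close> that] by simp
    ultimately show ?thesis
      by (intro lnd_kernel[OF that(1) i0(1) ge0 that(2) _ _ _ that(3,4)] assms(4)[OF that(2)])
  qed
  have rel: "partial i * \<delta> (gen (T i (c i))) = partial i0 * \<delta> (gen (T i0 1))"
    if \<delta>: "coord_lnd 0 \<delta>" and i: "i \<in> {1..r}" for \<delta> i
  proof -
    interpret d: alg_lnd "coord_ring 0" lconst \<delta> by fact
    have tm: "\<delta> (\<Prod>j\<in>{1..n i}. gen (T i j) ^ l i j) = partial i * \<delta> (gen (T i (c i)))" if "i \<in> {1..r}" for i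
      by (rule derivation_tmonom[OF d.alg_derivation_axioms T_in[OF that] that ker[OF \<delta> that]])
    have "(\<Prod>j\<in>{1..n i0}. gen (T i0 j) ^ l i0 j) \<in> coord_ring 0"
      using i0 by (intro alg.prod_in alg.power_in T_in)
    hence "\<delta> (\<Prod>j\<in>{1..n i}. gen (T i j) ^ l i j) = \<delta> (\<Prod>j\<in>{1..n i0}. gen (T i0 j) ^ l i0 j)"
      unfolding prod_gen_diff[OF i i0(1)] by (simp add: d.der_add alg.const_in d.der_const)
    thus ?thesis unfolding tm[OF i] tm[OF i0(1)] c0 .
  qed
  have nz: "\<delta> (gen (T i0 1)) \<noteq> 0"
    if \<delta>: "coord_lnd 0 \<delta>" and "\<exists>f\<in>coord_ring 0. \<delta> f \<noteq> 0" for \<delta>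
  proof
    interpret d: alg_lnd "coord_ring 0" lconst \<delta> by fact
    assume zero: "\<delta> (gen (T i0 1)) = 0"
    have "\<delta> x = 0" if x: "x \<in> gen ` tvars r n 0" for x
    proof -
      obtain i j where ij: "x = gen (T i j)" "i \<in> {1..r}" "j \<in> {1..n i}" by (rule gen_0_cases[OF x])
      show ?thesis
      proof (cases "j = c i")
        case True
        thus ?thesis using rel[OF \<delta> ij(2)] zero partial_nonzero[OF ij(2)] ij(1) by simp
      next
        case False
        thus ?thesis using ker[OF \<delta> ij(2,3)] ij(1) by simp
      qed
    qed
    from d.der_eq_0_if_generators[OF coord_ring_eq this] show False using that(2) by blast
  qed
  fix \<delta> \<delta>'
  assume \<delta>: "coord_lnd 0 \<delta>" and \<delta>': "coord_lnd 0 \<delta>'"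
    and nz\<delta>: "\<exists>f\<in>coord_ring 0. \<delta> f \<noteq> 0" and nz\<delta>': "\<exists>f\<in>coord_ring 0. \<delta>' f \<noteq> 0"
  note h = nz[OF \<delta> nz\<delta>] and h' = nz[OF \<delta>' nz\<delta>']
  have "\<delta>' (gen (T i0 1)) * \<delta> x = \<delta> (gen (T i0 1)) * \<delta>' x" if x: "x \<in> gen ` tvars r n 0" for x
  proof -
    obtain i j where ij: "x = gen (T i j)" "i \<in> {1..r}" "j \<in> {1..n i}" by (rule gen_0_cases[OF x])
    show ?thesis
    proof (cases "j = c i")
      case True
      have "partial i * (\<delta>' (gen (T i0 1)) * \<delta> x) = \<delta>' (gen (T i0 1)) * (partial i0 * \<delta> (gen (T i0 1)))"
        unfolding rel[OF \<delta> ij(2), symmetric] ij(1) True by (simp only: mult_ac)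
      also have "\<dots> = \<delta> (gen (T i0 1)) * (partial i0 * \<delta>' (gen (T i0 1)))" by (simp only: mult_ac)
      also have "\<dots> = partial i * (\<delta> (gen (T i0 1)) * \<delta>' x)"
        unfolding rel[OF \<delta>' ij(2), symmetric] ij(1) True by (simp only: mult_ac)
      finally show ?thesis using partial_nonzero[OF ij(2)] by simp
    next
      case False
      thus ?thesis using ker[OF \<delta> ij(2,3)] ker[OF \<delta>' ij(2,3)] ij(1) by simp
    qed
  qed
  from proportional_kernels[OF alg_lnd.axioms(1)[OF \<delta>] alg_lnd.axioms(1)[OF \<delta>'] coord_ring_eq this h h']
  show "\<forall>f\<in>coord_ring 0. \<delta> f = 0 \<longleftrightarrow> \<delta>' f = 0" by (rule ballI)
qed

section \<open>Adjoining the variables \<open>S\<^sub>k\<close>\<close>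

abbreviation S_weight :: "nat \<Rightarrow> (tvar \<Rightarrow>\<^sub>0 int) \<Rightarrow> int" where
  "S_weight k e \<equiv> lookup e (S k)"

lemma S_weight_add: "S_weight k (e + e') = S_weight k e + S_weight k e'"
  by (rule lookup_add)

lemma S_weight_expo: "S_weight k (expo m) = int (lookup m (S k))"
  by (simp add: lookup_expo)

text \<open>\<open>S k\<close> is a free parameter, hence invertible among the Laurent polynomials;
  its powers can be divided out of homogeneous elements.\<close>

definition S_inv :: "nat \<Rightarrow> 'k laurent" where
  "S_inv k = single (single (S k) (- 1)) 1"

lemma gen_S: "gen (S k) = single (single (S k) 1) 1"
proof -
  have "expo (single (S k) 1) = single (S k) 1"
    by (rule poly_mapping_eqI) (auto simp: lookup_expo lookup_single when_def split: tvar.splits)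
  moreover have "root_part (single (S k) 1) = 1" by (rule root_part_single_other) simp
  ultimately show ?thesis by (simp only: gen_eq pt_monom_def)
qed

lemma S_inv_gen: "S_inv k * gen (S k) = 1"
  by (simp add: S_inv_def gen_S mult_single flip: single_add)

lemma S_inv_gen_power: "S_inv k ^ p * gen (S k) ^ p = 1"
  by (simp only: power_mult_distrib[symmetric] S_inv_gen power_one)

text \<open>\<open>\<partial>/\<partial>S\<^sub>k\<close> is obtained as the Euler operator,
  multiplication by \<open>p\<close> on weight \<open>p\<close>, divided by
  \<open>S\<^sub>k\<close>. Elements of weight \<open>p \<noteq> 0\<close> are divisible by
  \<open>S\<^sub>k\<close>, so the coordinate ring is stable.\<close>

lemma S_lnd_exists:
  assumes k: "k \<in> {1..d}"
  shows "\<exists>\<delta>. coord_lnd d \<delta> \<and>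
    (\<forall>x\<in>tvars r n d. \<delta> (gen x) = 0 \<longleftrightarrow> x \<noteq> S k)"
proof -
  interpret G: graded_subalgebra "coord_ring d" lconst "wt_part (S_weight k)"
    by (rule graded_coord_ring[OF S_weight_add])
  define \<Delta> where "\<Delta> p f = of_int p * S_inv k * f" for p and f :: "'k laurent"
  have add: "\<Delta> p (f + g) = \<Delta> p f + \<Delta> p g" for p f g
    by (simp add: \<Delta>_def distrib_left)
  have der: "alg_derivation (coord_ring d) lconst (G.homog_ext \<Delta>)"
  proof (rule G.homog_ext_derivation)
    fix p f assume f: "f \<in> G.homog p"
    show "\<Delta> p f \<in> coord_ring d"
    proof (cases "p = 0")
      case False
      have "1 \<le> lookup m (S k)" if "wt_part (S_weight k) (S_weight k (expo m)) f \<noteq> 0" for m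
        using that G.pr_of_homog[OF f, of "S_weight k (expo m)"] False by (auto simp: S_weight_expo split: if_splits)
      hence "\<exists>h\<in>coord_ring d. f = gen (S k) ^ 1 * h"
        by (rule divisible_if_weights[OF S_weight_add G.homog_in[OF f]])
      then obtain h where h: "h \<in> coord_ring d" "f = gen (S k) ^ 1 * h" ..
      have "\<Delta> p f = of_int p * (S_inv k * gen (S k)) * h" unfolding \<Delta>_def h(2) by (simp add: mult.assoc)
      also have "\<dots> = lconst (of_int p) * h"
        unfolding S_inv_gen by (cases p rule: int_cases2) (simp_all add: alg.const_of_nat alg.const_minus)
      finally show ?thesis using h(1) by (simp add: alg.mult_in alg.const_in)
    qed (simp add: \<Delta>_def alg.zero_in)
  qed (simp_all add: \<Delta>_def algebra_simps)
  let ?\<delta> = "G.homog_ext \<Delta>"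
  interpret d: alg_derivation "coord_ring d" lconst ?\<delta> by (rule der)
  have eval: "?\<delta> (gen x) = (if x = S k then 1 else 0)" if x: "x \<in> tvars r n d" for x
  proof -
    have "?\<delta> (gen x) = \<Delta> (S_weight k (expo (single x 1))) (gen x)"
      by (rule G.homog_ext_homog[OF add gen_homog[OF S_weight_add x]])
    thus ?thesis using S_inv_gen[of k]
      by (auto simp: \<Delta>_def S_weight_expo lookup_single when_def simp del: One_nat_def)
  qed
  have "coord_lnd d ?\<delta>"
  proof (rule d.lnd_if_nilpotent_generators[OF coord_ring_eq])
    fix x assume "x \<in> gen ` tvars r n d"
    then obtain y where y: "y \<in> tvars r n d" "x = gen y" by blast
    have "?\<delta> 1 = 0" using d.der_const[of 1] by (simp add: alg.const_1)
    hence "(?\<delta> ^^ 2) x = 0" using eval[OF y(1)] y(2) d.der_0 by (simp add: numeral_2_eq_2)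
    thus "\<exists>m. (?\<delta> ^^ m) x = 0" ..
  qed
  thus ?thesis using eval by (intro exI[of _ ?\<delta>]) simp
qed

lemma coord_ring_0_subset: "coord_ring 0 \<subseteq> coord_ring 1"
proof
  fix f assume "f \<in> coord_ring 0"
  then obtain p where p: "p \<in> carrier (mpoly_ring (tvars r n 0))" "f = evaluate p"
    unfolding coord_ring_def by blast
  have "p \<in> carrier (mpoly_ring (tvars r n 1))" using p(1) unfolding tvars_1 by auto
  thus "f \<in> coord_ring 1" unfolding p(2) coord_ring_def by (rule imageI)
qed

lemma weight_coord_ring_0:
  assumes "f \<in> coord_ring 0"
  shows "wt_part (S_weight 1) 0 f = f"
proof -
  obtain p where p: "p \<in> carrier (mpoly_ring (tvars r n 0))" "f = evaluate p"
    using assms unfolding coord_ring_def by blast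
  have "S_weight 1 (expo m) = 0" if "m \<in> keys p" for m
  proof -
    have "S 1 \<notin> keys m" using p(1) that by (auto simp: tvars_0)
    thus ?thesis by (simp add: S_weight_expo in_keys_iff)
  qed
  thus ?thesis unfolding p(2) evaluate_eq wt_part_sum wt_part_monom by simp
qed

text \<open>The monomials of weight \<open>k\<close> are those containing exactly the
  \<open>k\<close>-th power of \<open>S\<^sub>1\<close>. For negative \<open>k\<close> there are
  none, and the value \<open>0\<close> of \<open>nat k\<close> does no harm.\<close>

lemma coord_ring_1_homog:
  assumes f: "f \<in> coord_ring 1" "wt_part (S_weight 1) k f = f"
  shows "(k < 0 \<longrightarrow> f = 0) \<and> S_inv 1 ^ nat k * f \<in> coord_ring 0"
proof -
  obtain p where p: "p \<in> carrier (mpoly_ring (tvars r n 1))" "f = evaluate p"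
    using f(1) unfolding coord_ring_def by blast
  have f_eq: "f = (\<Sum>m\<in>keys p. if int (lookup m (S 1)) = k then lconst (lookup p m) * pt_monom m else 0)"
    using f(2) unfolding p(2) evaluate_eq wt_part_sum wt_part_monom S_weight_expo by simp
  have "f = 0" if "k < 0" using that by (subst f_eq, intro sum.neutral) auto
  moreover have "S_inv 1 ^ nat k * f \<in> coord_ring 0"
    unfolding f_eq sum_distrib_left
  proof (rule alg.sum_in)
    fix m assume m: "m \<in> keys p"
    show "S_inv 1 ^ nat k * (if int (lookup m (S 1)) = k then lconst (lookup p m) * pt_monom m else 0)
      \<in> coord_ring 0"
    proof (cases "int (lookup m (S 1)) = k")
      case True
      let ?m = "m - single (S 1) (nat k)"
      have "m = single (S 1) (nat k) + ?m"
        using True by (intro poly_mapping_eqI) (auto simp: lookup_add lookup_minus lookup_single when_def)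
      hence "pt_monom m = pt_monom (single (S 1) (nat k) + ?m)" by (rule arg_cong)
      also have "\<dots> = gen (S 1) ^ nat k * pt_monom ?m" by (simp only: gen_power monom_add)
      finally have "S_inv 1 ^ nat k * (lconst (lookup p m) * pt_monom m) =
          (S_inv 1 ^ nat k * gen (S 1) ^ nat k) * (lconst (lookup p m) * pt_monom ?m)"
        by (simp only: mult_ac)
      also have "\<dots> = lconst (lookup p m) * pt_monom ?m" by (simp only: S_inv_gen_power mult_1)
      finally have eq: "S_inv 1 ^ nat k * (lconst (lookup p m) * pt_monom m) = lconst (lookup p m) * pt_monom ?m" .
      have "keys m \<subseteq> tvars r n 1" using m p(1) by auto
      moreover have "S 1 \<notin> keys ?m" using True by (auto simp: in_keys_iff lookup_minus lookup_single)
      moreover have "keys ?m \<subseteq> keys m" by (auto simp: in_keys_iff lookup_minus)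
      ultimately have "keys ?m \<subseteq> tvars r n 0" unfolding tvars_1 by blast
      from monom_in[OF this] show ?thesis unfolding if_P[OF True] eq .
    qed (simp add: alg.zero_in)
  qed
  ultimately show ?thesis by blast
qed

lemma wt_part_uminus: "wt_part (\<lambda>e. - \<omega> e) k f = wt_part \<omega> (- k) f"
  by (rule poly_mapping_eqI) (auto simp: lookup_wt_part)

text \<open>The component of highest degree in \<open>S\<^sub>1\<close> of a locally nilpotent derivation has degree \<open>-1\<close>:
  otherwise \<open>S\<^sub>1\<close> divides its own image and is killed, and dividing by a power of \<open>S\<^sub>1\<close> gives a
  nonzero locally nilpotent derivation without \<open>S\<^sub>1\<close>.\<close>

lemma lnd_kills_coord_ring_0:
  assumes \<delta>: "coord_lnd 1 \<delta>"
    and rigid: "\<forall>D. coord_lnd 0 D \<longrightarrow> (\<forall>f\<in>coord_ring 0. D f = 0)"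
    and f: "f \<in> coord_ring 0"
  shows "\<delta> f = 0"
proof (rule ccontr)
  assume nz: "\<delta> f \<noteq> 0"
  \<comment> \<open>The weight is negated so that \<open>bottom_component\<close> yields the part of
    highest degree in \<open>S\<^sub>1\<close>.\<close>
  define \<omega> where "\<omega> e = - S_weight 1 e" for e
  have \<omega>_add: "\<omega> (e + e') = \<omega> e + \<omega> e'" for e e' by (simp add: \<omega>_def lookup_add)
  have wp: "wt_part \<omega> k g = wt_part (S_weight 1) (- k) g" for k and g :: "'k laurent"
    unfolding \<omega>_def by (rule wt_part_uminus)
  interpret G: graded_subalgebra "coord_ring 1" lconst "wt_part \<omega>"
    by (rule graded_coord_ring[OF \<omega>_add])
  interpret d: alg_lnd "coord_ring 1" lconst \<delta> by fact
  have f1: "f \<in> coord_ring 1" using f coord_ring_0_subset by blast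
  have homog': "\<exists>k. x \<in> G.homog k" if "x \<in> gen ` tvars r n 1" for x
    using that gen_homog[OF \<omega>_add] by blast
  have fin: "finite (gen ` tvars r n 1)" using finite_tvars by simp
  obtain k \<delta>' where shift: "G.shifts_by \<delta> k" and \<delta>': "coord_lnd 1 \<delta>'"
    and nz': "\<exists>f\<in>coord_ring 1. \<delta>' f \<noteq> 0"
    and deg: "\<And>m f. f \<in> G.homog m \<Longrightarrow> \<delta>' f \<in> G.homog (m + k)"
  proof -
    show thesis by (rule G.bottom_component[OF \<delta> f1 nz coord_ring_eq fin homog']) (assumption | rule that)+
  qed
  interpret d': alg_lnd "coord_ring 1" lconst \<delta>' by fact
  have homog0: "g \<in> G.homog 0" if "g \<in> coord_ring 0" for g
    using that coord_ring_0_subset weight_coord_ring_0[OF that]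
    by (auto simp: G.homog_def wp simp del: One_nat_def)
  show False
  proof (cases "k \<ge> 1")
    \<comment> \<open>Here \<open>\<delta>\<close> lowers the degree in \<open>S\<^sub>1\<close> by
      at least one, and \<open>f\<close> has degree zero, so its image would have negative
      degree.\<close>
    case True
    have "wt_part \<omega> i (\<delta> f) = 0" for i
    proof (cases "i < k")
      case True
      thus ?thesis using G.shifts_byD[OF shift homog0[OF f]] by simp
    next
      case False
      have "wt_part \<omega> i (\<delta> f) \<in> coord_ring 1" by (rule G.pr_in[OF d.der_in[OF f1]])
      moreover have "wt_part (S_weight 1) (- i) (wt_part \<omega> i (\<delta> f)) = wt_part \<omega> i (\<delta> f)"
        using G.pr_pr[of i i "\<delta> f"] by (simp only: wp simp_thms if_True)
      ultimately show ?thesis using coord_ring_1_homog[of "wt_part \<omega> i (\<delta> f)" "- i"] True False by simp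
    qed
    thus False using G.sum_pr[of "\<delta> f"] nz by simp
  next
    case False
    define p where "p = nat (- k)"
    have p: "k = - int p" using False by (simp add: p_def)
    let ?s = "gen (S 1)"
    have S1: "S 1 \<in> tvars r n 1" unfolding tvars_1 by (rule insertI1)
    have "\<omega> (expo (single (S 1) 1)) = - 1" by (simp add: \<omega>_def S_weight_expo)
    hence ds: "\<delta>' ?s \<in> G.homog (- 1 + k)" using deg[OF gen_homog[OF \<omega>_add S1]] by simp
    have "1 \<le> lookup m (S 1)" if "wt_part \<omega> (\<omega> (expo m)) (\<delta>' ?s) \<noteq> 0" for m
    proof -
      have "\<omega> (expo m) = - 1 + k"
        using that G.pr_of_homog[OF ds, of "\<omega> (expo m)"] by (auto split: if_splits)
      thus ?thesis using False by (simp add: \<omega>_def S_weight_expo)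
    qed
    hence "\<exists>h\<in>coord_ring 1. \<delta>' ?s = ?s ^ 1 * h"
      by (rule divisible_if_weights[OF \<omega>_add G.homog_in[OF ds]])
    then obtain h where h: "h \<in> coord_ring 1" "\<delta>' ?s = ?s ^ 1 * h" ..
    have s0: "\<delta>' ?s = 0"
      by (rule d'.der_eq_0_if_dvd[OF gen_in[OF S1] h(1)]) (use h(2) in simp)
    define D where "D g = S_inv 1 ^ p * \<delta>' g" for g
    have D_in: "D g \<in> coord_ring 0" if "g \<in> coord_ring 0" for g
    proof -
      have "\<delta>' g \<in> G.homog k" using deg[OF homog0[OF that]] by simp
      hence "\<delta>' g \<in> coord_ring 1" "wt_part (S_weight 1) (int p) (\<delta>' g) = \<delta>' g"
        by (simp_all add: G.homog_def wp p del: One_nat_def)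
      from coord_ring_1_homog[OF this] show ?thesis by (simp add: D_def del: One_nat_def)
    qed
    have \<delta>'_D: "\<delta>' g = ?s ^ p * D g" for g
    proof -
      have "?s ^ p * D g = (S_inv 1 ^ p * ?s ^ p) * \<delta>' g" by (simp only: D_def mult_ac)
      thus ?thesis by (simp only: S_inv_gen_power mult_1)
    qed
    have in1: "g \<in> coord_ring 1" if "g \<in> coord_ring 0" for g using that coord_ring_0_subset by blast
    interpret D: alg_derivation "coord_ring 0" lconst D
    proof
      fix g g' b assume g: "g \<in> coord_ring 0"
      show "D g \<in> coord_ring 0" by (rule D_in[OF g])
      show "D (lconst b * g) = lconst b * D g"
        unfolding D_def d'.der_scale[OF in1[OF g]] by (simp only: mult_ac)
      assume g': "g' \<in> coord_ring 0"
      show "D (g + g') = D g + D g'"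
        unfolding D_def d'.der_add[OF in1[OF g] in1[OF g']] by (simp only: distrib_left)
      show "D (g * g') = D g * g' + g * D g'"
        unfolding D_def d'.der_mult[OF in1[OF g] in1[OF g']] by (simp only: distrib_left mult_ac)
    qed
    \<comment> \<open>Since \<open>\<delta>'\<close> kills \<open>?s\<close>, powers of
      \<open>?s\<close> pass through the iteration, and nilpotency of \<open>\<delta>'\<close>
      becomes that of \<open>D\<close>.\<close>
    have iter: "(\<delta>' ^^ m) g = ?s ^ (p * m) * (D ^^ m) g" if g: "g \<in> coord_ring 0" for m g
    proof (induction m)
      case (Suc m)
      have s: "?s ^ (p * m) \<in> coord_ring 1" "\<delta>' (?s ^ (p * m)) = 0"
        using gen_in[OF S1] s0 by (simp_all add: alg.power_in d'.der_power)
      have "(\<delta>' ^^ Suc m) g = \<delta>' (?s ^ (p * m) * (D ^^ m) g)" using Suc by simp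
      also have "\<dots> = ?s ^ (p * m) * \<delta>' ((D ^^ m) g)"
        using d'.der_mult[OF s(1) in1[OF D.iter_in[OF g]]] s(2) by simp
      also have "\<dots> = ?s ^ (p * m) * (?s ^ p * D ((D ^^ m) g))" by (simp only: \<delta>'_D[of "(D ^^ m) g"])
      finally show ?case by (simp add: power_add mult_ac)
    qed simp
    have "coord_lnd 0 D"
    proof
      fix g assume g: "g \<in> coord_ring 0"
      obtain m where "(\<delta>' ^^ m) g = 0" using d'.nilpotent[OF in1[OF g]] by blast
      thus "\<exists>m. (D ^^ m) g = 0" using iter[OF g, of m] gen_nonzero[of "S 1"] by auto
    qed
    hence "\<forall>g\<in>coord_ring 0. D g = 0" by (rule rigid[THEN spec, THEN mp])
    hence "\<delta>' g = 0" if "g \<in> coord_ring 0" for g using that \<delta>'_D[of g] by simp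
    hence "\<delta>' x = 0" if "x \<in> gen ` tvars r n 1" for x
      using that s0 gen_in[of _ 0] unfolding tvars_1 by blast
    from d'.der_eq_0_if_generators[OF coord_ring_eq this] show False using nz' by blast
  qed
qed

text \<open>All LNDs kill the coordinate ring without \<open>S\<^sub>1\<close>, so two of them are
  proportional with their values at \<open>S\<^sub>1\<close> as multipliers.\<close>

lemma semirigid_coord_ring_1:
  assumes rigid: "\<forall>D. coord_lnd 0 D \<longrightarrow> (\<forall>f\<in>coord_ring 0. D f = 0)"
  shows "semirigid (ring_of_type_algebra :: 'k ring) (subalgebra_module (coord_ring 1) lconst)"
  unfolding alg.semirigid_subalgebra_module_iff
proof (intro allI impI)
  have ker: "\<delta> x = 0" if "coord_lnd 1 \<delta>" "x \<in> gen ` tvars r n 0" for \<delta> x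
  proof -
    have "x \<in> coord_ring 0" using that(2) gen_in by blast
    thus ?thesis by (rule lnd_kills_coord_ring_0[OF that(1) rigid])
  qed
  have nz: "\<delta> (gen (S 1)) \<noteq> 0"
    if \<delta>: "coord_lnd 1 \<delta>" and "\<exists>f\<in>coord_ring 1. \<delta> f \<noteq> 0" for \<delta>
  proof
    interpret d: alg_lnd "coord_ring 1" lconst \<delta> by fact
    assume "\<delta> (gen (S 1)) = 0"
    hence "\<delta> x = 0" if "x \<in> gen ` tvars r n 1" for x
      using that ker[OF \<delta>, of x] unfolding tvars_1 by (elim imageE insertE) simp_all
    from d.der_eq_0_if_generators[OF coord_ring_eq this] show False using that(2) by blast
  qed
  fix \<delta> \<delta>'
  assume \<delta>: "coord_lnd 1 \<delta>" and \<delta>': "coord_lnd 1 \<delta>'"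
    and nz\<delta>: "\<exists>f\<in>coord_ring 1. \<delta> f \<noteq> 0" and nz\<delta>': "\<exists>f\<in>coord_ring 1. \<delta>' f \<noteq> 0"
  note h = nz[OF \<delta> nz\<delta>] and h' = nz[OF \<delta>' nz\<delta>']
  have "\<delta>' (gen (S 1)) * \<delta> x = \<delta> (gen (S 1)) * \<delta>' x" if "x \<in> gen ` tvars r n 1" for x
    using that ker[OF \<delta>, of x] ker[OF \<delta>', of x] unfolding tvars_1 by (elim imageE insertE) (simp_all add: mult.commute)
  from proportional_kernels[OF alg_lnd.axioms(1)[OF \<delta>] alg_lnd.axioms(1)[OF \<delta>'] coord_ring_eq this h h']
  show "\<forall>f\<in>coord_ring 1. \<delta> f = 0 \<longleftrightarrow> \<delta>' f = 0" by (rule ballI)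
qed

text \<open>The extension applies \<open>D\<close> to the coefficients of powers of
  \<open>S\<^sub>1\<close>; dividing a homogeneous element by its power of \<open>S\<^sub>1\<close>
  exposes its coefficient.\<close>

lemma lnd_extends:
  assumes D: "coord_lnd 0 D"
  shows "\<exists>\<delta>. coord_lnd 1 \<delta> \<and> \<delta> (gen (S 1)) = 0 \<and>
    (\<forall>f\<in>coord_ring 0. \<delta> f = D f)"
proof -
  interpret D: alg_lnd "coord_ring 0" lconst D by fact
  interpret G: graded_subalgebra "coord_ring 1" lconst "wt_part (S_weight 1)"
    by (rule graded_coord_ring[OF S_weight_add])
  let ?s = "gen (S 1)" and ?t = "S_inv 1"
  have S1: "S 1 \<in> tvars r n 1" unfolding tvars_1 by (rule insertI1)
  define \<Delta> where "\<Delta> k f = ?s ^ nat k * D (?t ^ nat k * f)" for k f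
  have root: "?t ^ nat k * f \<in> coord_ring 0" if "f \<in> G.homog k" for k f
    using that coord_ring_1_homog[of f k] by (simp add: G.homog_def del: One_nat_def)
  have neg: "f = 0" if "f \<in> G.homog k" "k < 0" for k f
    using that coord_ring_1_homog[of f k] by (simp add: G.homog_def del: One_nat_def)
  have add: "\<Delta> k (f + g) = \<Delta> k f + \<Delta> k g" if "f \<in> G.homog k" "g \<in> G.homog k" for k f g
    unfolding \<Delta>_def distrib_left D.der_add[OF root[OF that(1)] root[OF that(2)]] ..
  have st: "?s ^ k * ?t ^ k = 1" for k using S_inv_gen_power[of 1 k] by (simp only: mult.commute)
  have \<Delta>_0: "\<Delta> k 0 = 0" for k by (simp add: \<Delta>_def D.der_0)
  have der: "alg_derivation (coord_ring 1) lconst (G.homog_ext \<Delta>)"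
  proof (rule G.homog_ext_derivation)
    show "\<Delta> k f \<in> coord_ring 1" if "f \<in> G.homog k" for k f
      unfolding \<Delta>_def using D.der_in[OF root[OF that]] coord_ring_0_subset
      by (intro alg.mult_in alg.power_in gen_in[OF S1]) blast
    show "\<Delta> (i + j) (f * g) = \<Delta> i f * g + f * \<Delta> j g" if f: "f \<in> G.homog i" and g: "g \<in> G.homog j" for i j f g
    proof (cases "f = 0 \<or> g = 0")
      case True
      thus ?thesis by (auto simp: \<Delta>_0)
    next
      case False
      \<comment> \<open>Nonzero homogeneous elements have nonnegative degree, where
        \<open>nat\<close> is additive.\<close>
      hence "i \<ge> 0" "j \<ge> 0" using neg[OF f] neg[OF g] by (meson not_le)+
      hence nat: "nat (i + j) = nat i + nat j" by (simp add: nat_add_distrib)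
      let ?f = "?t ^ nat i * f" and ?g = "?t ^ nat j * g"
      have fg: "?s ^ nat i * ?f = f" "?s ^ nat j * ?g = g" by (simp_all only: mult.assoc[symmetric] st mult_1)
      have "?t ^ nat (i + j) * (f * g) = ?f * ?g" unfolding nat power_add by (simp only: mult_ac)
      hence "\<Delta> (i + j) (f * g) = ?s ^ nat i * ?s ^ nat j * (D ?f * ?g + ?f * D ?g)"
        unfolding \<Delta>_def by (simp only: nat power_add D.der_mult[OF root[OF f] root[OF g]])
      also have "\<dots> = (?s ^ nat i * D ?f) * (?s ^ nat j * ?g) + (?s ^ nat i * ?f) * (?s ^ nat j * D ?g)"
        by (simp only: distrib_left mult_ac)
      finally show ?thesis unfolding fg by (simp only: \<Delta>_def)
    qed
    show "\<Delta> k (lconst b * f) = lconst b * \<Delta> k f" if "f \<in> G.homog k" for k f b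
      using D.der_scale[OF root[OF that], of b] unfolding \<Delta>_def by (simp only: mult_ac)
  qed (rule add)
  let ?\<delta> = "G.homog_ext \<Delta>"
  interpret d: alg_derivation "coord_ring 1" lconst ?\<delta> by (rule der)
  have ext: "?\<delta> f = D f" if "f \<in> coord_ring 0" for f
  proof -
    have "f \<in> G.homog 0"
      using that coord_ring_0_subset weight_coord_ring_0[OF that]
      by (auto simp: G.homog_def simp del: One_nat_def)
    from G.homog_ext_homog[where \<Delta> = \<Delta>, OF add this] show ?thesis by (simp add: \<Delta>_def)
  qed
  have "S_weight 1 (expo (single (S 1) 1)) = 1" by (simp add: S_weight_expo)
  hence "?\<delta> ?s = \<Delta> 1 ?s" using G.homog_ext_homog[where \<Delta> = \<Delta>, OF add gen_homog[OF S_weight_add S1]] by simp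
  also have "\<dots> = 0"
    using D.der_const[of 1] S_inv_gen[of 1] by (simp add: \<Delta>_def alg.const_1)
  finally have s0: "?\<delta> ?s = 0" .
  have iter: "(?\<delta> ^^ m) f = (D ^^ m) f" if "f \<in> coord_ring 0" for m f
  proof (induction m)
    case (Suc m)
    have "(?\<delta> ^^ Suc m) f = ?\<delta> ((D ^^ m) f)" using Suc by simp
    also have "\<dots> = D ((D ^^ m) f)" by (rule ext[OF D.iter_in[OF that]])
    finally show ?case by simp
  qed simp
  have "coord_lnd 1 ?\<delta>"
  proof (rule d.lnd_if_nilpotent_generators[OF coord_ring_eq])
    fix x assume "x \<in> gen ` tvars r n 1"
    then consider "x = ?s" | "x \<in> coord_ring 0" using gen_in[of _ 0] unfolding tvars_1 by blast
    thus "\<exists>m. (?\<delta> ^^ m) x = 0"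
    proof cases
      case 1
      thus ?thesis using s0 by (intro exI[of _ 1]) simp
    next
      case 2
      thus ?thesis using D.nilpotent[OF 2] iter[OF 2] by simp
    qed
  qed
  thus ?thesis using s0 ext by (intro exI[of _ ?\<delta>]) simp
qed

end

section \<open>Trinomial algebras\<close>

context trinomial_data
begin

abbreviation var_class :: "nat \<Rightarrow> tvar \<Rightarrow> (tvar, 'k) mpol set" where
  "var_class d x \<equiv> Idl\<^bsub>mpoly_ring (tvars r n d)\<^esub> (trinomials r n l a) +>\<^bsub>mpoly_ring (tvars r n d)\<^esub> mvar x"

abbreviation alg_R :: "nat \<Rightarrow> ('k, (tvar, 'k) mpol set) module" where
  "alg_R d \<equiv> trinomial_algebra r n l a d"

abbreviation alg_K :: "'k ring" where
  "alg_K \<equiv> ring_of_type_algebra"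

lemma var_class_in:
  assumes "x \<in> tvars r n d"
  shows "var_class d x \<in> carrier (alg_R d)"
proof -
  have "mvar x \<in> carrier (mpoly_ring (tvars r n d))" by (rule mvar_mem_mpoly_ring[OF assms])
  thus ?thesis unfolding trinomial_algebra_def quot_algebra_simps FactRing_def A_RCOSETS_def'
    by (simp only: partial_object.select_convs) blast
qed

end

context trinomial_point
begin

lemma rigid_trinomial_algebra_iff:
  "rigid alg_K (alg_R d) \<longleftrightarrow>
    (\<forall>\<delta>. coord_lnd d \<delta> \<longrightarrow> (\<forall>f\<in>coord_ring d. \<delta> f = 0))"
proof -
  obtain h where "algebra_iso alg_K (alg_R d) (subalgebra_module (coord_ring d) lconst) h"
    by (rule trinomial_algebra_iso)
  from rigid_iso[OF this] show ?thesis by (simp only: alg.rigid_subalgebra_module_iff)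
qed

lemma semirigid_trinomial_algebra_iff:
  "semirigid alg_K (alg_R d) \<longleftrightarrow> semirigid alg_K (subalgebra_module (coord_ring d) lconst)"
proof -
  obtain h where "algebra_iso alg_K (alg_R d) (subalgebra_module (coord_ring d) lconst) h"
    by (rule trinomial_algebra_iso)
  from semirigid_iso[OF this] semirigid_iso[OF algebra_iso_inverse[OF this]] show ?thesis by (rule iffI)
qed

text \<open>Different choices of \<open>c\<close> give different coordinate rings. Back in the
  trinomial algebra, the kernels of the derivations they yield can be compared on the classes of the
  variables.\<close>

lemma lnd_trinomial_algebra:
  assumes \<delta>: "coord_lnd d \<delta>" "f \<in> coord_ring d" "\<delta> f \<noteq> 0"
  shows "\<exists>\<delta>'. nonzero_lnd alg_K (alg_R d) \<delta>' \<and>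
    (\<forall>x\<in>tvars r n d. \<delta>' (var_class d x) = \<zero>\<^bsub>alg_R d\<^esub> \<longleftrightarrow> \<delta> (gen x) = 0)"
proof -
  let ?B = "subalgebra_module (coord_ring d) lconst :: ('k, 'k laurent) module"
  obtain h where h: "algebra_iso alg_K (alg_R d) ?B h"
    and hx: "\<And>x. x \<in> tvars r n d \<Longrightarrow> h (var_class d x) = gen x"
  proof -
    show thesis by (rule trinomial_algebra_iso) (rule that)
  qed
  have nz: "nonzero_lnd alg_K ?B \<delta>" unfolding alg.nonzero_lnd_iff using \<delta> by (intro conjI bexI)
  hence der: "derivation alg_K ?B \<delta>" by (simp only: nonzero_lnd_def lnd_def)
  have "pull_back (alg_R d) h \<delta> (var_class d x) = \<zero>\<^bsub>alg_R d\<^esub> \<longleftrightarrow> \<delta> (gen x) = 0"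
    if x: "x \<in> tvars r n d" for x
    using pull_back_eq_0_iff[OF h der var_class_in[OF x]] unfolding hx[OF x]
    by (simp add: subalgebra_module_def)
  thus ?thesis using nonzero_lnd_pull_back[OF h nz]
    by (intro exI[of _ "pull_back (alg_R d) h \<delta>"] conjI ballI)
qed

end

section \<open>Choices of indices and semirigidity for \<open>d = 0\<close>\<close>

context trinomial_data
begin

lemma default_point:
  obtains z \<beta> where "trinomial_point r n l a (\<lambda>_. 1) z \<beta>"
proof (rule point_exists[of "\<lambda>_. 1"])
  show "1 \<in> {1..n i}" if "i \<in> {1..r}" for i using n_ge[OF that] by simp
qed (rule that)

text \<open>The data to which \<open>lnd_exists\<close> applies; at \<open>i0\<close> every index
  may be chosen, whatever its exponent.\<close>

definition admissible :: "nat \<Rightarrow> (nat \<Rightarrow> nat) \<Rightarrow> bool" where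
  "admissible i0 c \<longleftrightarrow> i0 \<in> {1..r} \<and> (\<forall>i\<in>{1..r}. c i \<in> {1..n i}) \<and> (\<forall>i\<in>{1..r} - {i0}. l i (c i) = 1)"

lemma admissible_lnd:
  assumes "admissible i0 c"
  shows "\<exists>\<delta>. nonzero_lnd alg_K (alg_R 0) \<delta> \<and>
    (\<forall>i\<in>{1..r}. \<forall>j\<in>{1..n i}. \<delta> (var_class 0 (T i j)) = \<zero>\<^bsub>alg_R 0\<^esub> \<longleftrightarrow> j \<noteq> c i)"
proof -
  have c: "i0 \<in> {1..r}" "\<And>i. i \<in> {1..r} \<Longrightarrow> c i \<in> {1..n i}" "\<And>i. i \<in> {1..r} \<Longrightarrow> i \<noteq> i0 \<Longrightarrow> l i (c i) = 1"
    using assms unfolding admissible_def by blast+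
  obtain z \<beta> where "trinomial_point r n l a c z \<beta>" by (rule point_exists[OF c(2)])
  then interpret P: trinomial_point r n l a c z \<beta> .
  obtain \<delta> where \<delta>: "P.coord_lnd 0 \<delta>"
    "\<And>i j. i \<in> {1..r} \<Longrightarrow> j \<in> {1..n i} \<Longrightarrow> \<delta> (P.gen (T i j)) = 0 \<longleftrightarrow> j \<noteq> c i"
    using P.lnd_exists[OF c(1,3), of 0] by blast
  have "\<delta> (P.gen (T i0 (c i0))) \<noteq> 0" using \<delta>(2)[OF c(1) c(2)[OF c(1)]] by simp
  from P.lnd_trinomial_algebra[OF \<delta>(1) P.T_in[OF c(1) c(2)[OF c(1)]] this]
  obtain \<delta>' where \<delta>': "nonzero_lnd alg_K (alg_R 0) \<delta>'"
    "\<And>x. x \<in> tvars r n 0 \<Longrightarrow> \<delta>' (var_class 0 x) = \<zero>\<^bsub>alg_R 0\<^esub> \<longleftrightarrow> \<delta> (P.gen x) = 0" by blast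
  have "\<delta>' (var_class 0 (T i j)) = \<zero>\<^bsub>alg_R 0\<^esub> \<longleftrightarrow> j \<noteq> c i" if "i \<in> {1..r}" "j \<in> {1..n i}" for i j
  proof -
    have "T i j \<in> tvars r n 0" using that unfolding P.tvars_0 by blast
    thus ?thesis using \<delta>'(2) \<delta>(2)[OF that] by (simp only:)
  qed
  thus ?thesis using \<delta>'(1) by (intro exI[of _ \<delta>'] conjI ballI)
qed

text \<open>Among the \<open>T i j\<close>, the derivation attached to \<open>c\<close> kills
  exactly those with \<open>j \<noteq> c i\<close>, so equal kernels force equal choices.\<close>

lemma admissible_unique:
  assumes sr: "semirigid alg_K (alg_R 0)" and "admissible i0 c" "admissible i0' c'" and i: "i \<in> {1..r}"
  shows "c i = c' i"
proof -
  obtain \<delta> where \<delta>: "nonzero_lnd alg_K (alg_R 0) \<delta>"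
    "\<And>i j. i \<in> {1..r} \<Longrightarrow> j \<in> {1..n i} \<Longrightarrow> \<delta> (var_class 0 (T i j)) = \<zero>\<^bsub>alg_R 0\<^esub> \<longleftrightarrow> j \<noteq> c i"
    using admissible_lnd[OF assms(2)] by blast
  obtain \<delta>' where \<delta>': "nonzero_lnd alg_K (alg_R 0) \<delta>'"
    "\<And>i j. i \<in> {1..r} \<Longrightarrow> j \<in> {1..n i} \<Longrightarrow> \<delta>' (var_class 0 (T i j)) = \<zero>\<^bsub>alg_R 0\<^esub> \<longleftrightarrow> j \<noteq> c' i"
    using admissible_lnd[OF assms(3)] by blast
  have ci: "c i \<in> {1..n i}" using assms(2) i unfolding admissible_def by blast
  have "T i (c i) \<in> tvars r n 0" using i ci unfolding tvars_def by blast
  from semirigid_kernel_iff[OF sr \<delta>(1) \<delta>'(1) var_class_in[OF this]]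
  show ?thesis unfolding \<delta>(2)[OF i ci] \<delta>'(2)[OF i ci] by simp
qed

text \<open>The choice at \<open>i0\<close> is free, so a second variable there would give a second
  admissible choice.\<close>

lemma admissible_n:
  assumes sr: "semirigid alg_K (alg_R 0)" and adm: "admissible i0 c"
  shows "n i0 = 1"
proof (rule ccontr)
  have i0: "i0 \<in> {1..r}" using adm by (simp add: admissible_def)
  assume "n i0 \<noteq> 1"
  hence "n i0 \<ge> 2" using n_ge[OF i0] by simp
  define j where "j = (if c i0 = 1 then 2 else 1 :: nat)"
  have j: "j \<in> {1..n i0}" "j \<noteq> c i0" using \<open>n i0 \<ge> 2\<close> by (auto simp: j_def)
  have "admissible i0 (c(i0 := j))" using adm j(1) by (auto simp: admissible_def)
  from admissible_unique[OF sr this adm i0] j(2) show False by simp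
qed

lemma not_rigid_admissible:
  assumes "\<not> rigid alg_K (alg_R 0)"
  shows "\<exists>i0 c. admissible i0 c"
proof -
  obtain z \<beta> where "trinomial_point r n l a (\<lambda>_. 1) z \<beta>" by (rule default_point)
  then interpret P: trinomial_point r n l a "\<lambda>_. 1" z \<beta> .
  obtain \<delta> f where \<delta>: "P.coord_lnd 0 \<delta>" and f: "f \<in> P.coord_ring 0" "\<delta> f \<noteq> 0"
    using assms unfolding P.rigid_trinomial_algebra_iff by blast
  interpret d: alg_lnd "P.coord_ring 0" lconst \<delta> by fact
  define bad where "bad i \<longleftrightarrow> i \<in> {1..r} \<and> (\<forall>j\<in>{1..n i}. l i j \<ge> 2)" for i
  have unique: "i = i'" if "bad i" "bad i'" for i i'
  proof (rule ccontr)
    assume ne: "i \<noteq> i'"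
    have ge: "i \<in> {1..r}" "i' \<in> {1..r}" "\<And>j. j \<in> {1..n i} \<Longrightarrow> l i j \<ge> 2 \<or> \<delta> (P.gen (T i j)) = 0"
      "\<And>j. j \<in> {1..n i'} \<Longrightarrow> l i' j \<ge> 2 \<or> \<delta> (P.gen (T i' j)) = 0"
      using that unfolding bad_def by blast+
    have "\<delta> x = 0" if x: "x \<in> P.gen ` tvars r n 0" for x
    proof -
      obtain k j where x: "x = P.gen (T k j)" and kj: "k \<in> {1..r}" "j \<in> {1..n k}" by (rule P.gen_0_cases[OF x])
      show ?thesis unfolding x by (rule P.lnd_T_eq_0[OF \<delta> ge(1,2) ne ge(3,4) kj])
    qed
    from d.der_eq_0_if_generators[OF P.coord_ring_eq this f(1)] f(2) show False by simp
  qed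
  \<comment> \<open>If no index is bad, any \<open>i0\<close> serves; the default \<open>1\<close>
    is in range because \<open>r \<ge> 2\<close>.\<close>
  define i0 where "i0 = (if \<exists>i. bad i then SOME i. bad i else 1)"
  have i0: "i0 \<in> {1..r}"
  proof (cases "\<exists>i. bad i")
    case True
    hence "bad i0" unfolding i0_def by (simp add: someI_ex)
    thus ?thesis by (simp add: bad_def)
  next
    case False
    thus ?thesis using r_ge by (simp add: i0_def)
  qed
  have "\<exists>j\<in>{1..n i}. i \<noteq> i0 \<longrightarrow> l i j = 1" if i: "i \<in> {1..r}" for i
  proof (cases "i = i0")
    case True
    thus ?thesis using n_ge[OF i] by (intro bexI[of _ 1]) simp_all
  next
    case False
    have "\<not> bad i"
    proof
      assume "bad i"
      moreover from this have "bad i0" unfolding i0_def by (auto intro: someI)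
      ultimately show False using unique False by blast
    qed
    then obtain j where j: "j \<in> {1..n i}" "\<not> l i j \<ge> 2" using i unfolding bad_def by blast
    hence "l i j = 1" using l_ge[OF i j(1)] by simp
    thus ?thesis using j(1) by blast
  qed
  then obtain c where c: "\<forall>i\<in>{1..r}. c i \<in> {1..n i} \<and> (i \<noteq> i0 \<longrightarrow> l i (c i) = 1)"
    using bchoice[of "{1..r}" "\<lambda>i j. j \<in> {1..n i} \<and> (i \<noteq> i0 \<longrightarrow> l i j = 1)"] by (auto simp: Bex_def)
  have "admissible i0 c" unfolding admissible_def using i0 c by simp
  thus ?thesis by blast
qed

abbreviation single_root :: bool where
  "single_root \<equiv> (\<exists>i0\<in>{1..r}. n i0 = 1 \<and> l i0 1 > 1 \<and>
     (\<forall>i\<in>{1..r} - {i0}. \<exists>c\<in>{1..n i}. l i c = 1 \<and> (\<forall>j\<in>{1..n i} - {c}. l i j > 1)))"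

lemma single_root_if_semirigid:
  assumes sr: "semirigid alg_K (alg_R 0)" and nr: "\<not> rigid alg_K (alg_R 0)"
    and not_line: "\<not> (\<forall>i\<in>{1..r}. n i = 1 \<and> l i 1 = 1)"
  shows single_root
proof -
  obtain i0 c where adm: "admissible i0 c" using not_rigid_admissible[OF nr] by blast
  hence i0: "i0 \<in> {1..r}" and c: "\<And>i. i \<in> {1..r} \<Longrightarrow> c i \<in> {1..n i}"
    "\<And>i. i \<in> {1..r} \<Longrightarrow> i \<noteq> i0 \<Longrightarrow> l i (c i) = 1"
    unfolding admissible_def by blast+
  have n0: "n i0 = 1" by (rule admissible_n[OF sr adm])
  hence c0: "c i0 = 1" using c(1)[OF i0] by simp
  have "l i0 1 > 1"
  proof (rule ccontr)
    assume "\<not> l i0 1 > 1"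
    hence l0: "l i0 1 = 1" using l_ge[OF i0, of 1] n0 by simp
    \<comment> \<open>Now all chosen exponents are \<open>1\<close>, so every index can play the
      role of \<open>i0\<close> and hence has a single variable: the excluded affine line.\<close>
    have all1: "l i (c i) = 1" if "i \<in> {1..r}" for i
      using c(2)[OF that] l0 c0 by (cases "i = i0") simp_all
    have "n i = 1 \<and> l i 1 = 1" if i: "i \<in> {1..r}" for i
    proof -
      have "admissible i c" using i c(1) all1 by (simp add: admissible_def)
      hence "n i = 1" by (rule admissible_n[OF sr])
      moreover from this have "c i = 1" using c(1)[OF i] by simp
      ultimately show ?thesis using all1[OF i] by simp
    qed
    thus False using not_line by blast
  qed
  moreover have "\<exists>c\<in>{1..n i}. l i c = 1 \<and> (\<forall>j\<in>{1..n i} - {c}. l i j > 1)" if i: "i \<in> {1..r} - {i0}" for i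
  proof (intro bexI[of _ "c i"] conjI ballI)
    show "l i (c i) = 1" "c i \<in> {1..n i}" using c i by blast+
    fix j assume j: "j \<in> {1..n i} - {c i}"
    show "l i j > 1"
    proof (rule ccontr)
      assume "\<not> l i j > 1"
      hence "l i j = 1" using l_ge[of i j] i j by simp
      hence "admissible i0 (c(i := j))" using adm i j by (auto simp: admissible_def)
      from admissible_unique[OF sr this adm, of i] i j show False by simp
    qed
  qed
  ultimately show ?thesis using i0 n0 by blast
qed

lemma semirigid_if_single_root:
  assumes single_root
  shows "semirigid alg_K (alg_R 0)"
proof -
  obtain i0 where i0: "i0 \<in> {1..r}" "n i0 = 1" "l i0 1 > 1"
    and ex: "\<forall>i\<in>{1..r} - {i0}. \<exists>c\<in>{1..n i}. l i c = 1 \<and> (\<forall>j\<in>{1..n i} - {c}. l i j > 1)"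
    using assms by blast
  have "\<exists>c. c \<in> {1..n i} \<and> (i \<noteq> i0 \<longrightarrow> l i c = 1 \<and> (\<forall>j\<in>{1..n i} - {c}. l i j > 1))" if "i \<in> {1..r}" for i
  proof (cases "i = i0")
    case True
    thus ?thesis using i0(2) by (intro exI[of _ 1]) simp
  next
    case False
    thus ?thesis using ex that by blast
  qed
  hence "\<forall>i\<in>{1..r}. \<exists>c. c \<in> {1..n i} \<and> (i \<noteq> i0 \<longrightarrow> l i c = 1 \<and> (\<forall>j\<in>{1..n i} - {c}. l i j > 1))" by blast
  from bchoice[OF this] obtain c where
    "\<forall>i\<in>{1..r}. c i \<in> {1..n i} \<and> (i \<noteq> i0 \<longrightarrow> l i (c i) = 1 \<and> (\<forall>j\<in>{1..n i} - {c i}. l i j > 1))" ..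
  hence c: "\<And>i. i \<in> {1..r} \<Longrightarrow> c i \<in> {1..n i}" "\<And>i. i \<in> {1..r} \<Longrightarrow> i \<noteq> i0 \<Longrightarrow> l i (c i) = 1"
    "\<And>i j. i \<in> {1..r} \<Longrightarrow> i \<noteq> i0 \<Longrightarrow> j \<in> {1..n i} \<Longrightarrow> j \<noteq> c i \<Longrightarrow> l i j > 1" by blast+
  obtain z \<beta> where "trinomial_point r n l a c z \<beta>" by (rule point_exists[OF c(1)])
  then interpret P: trinomial_point r n l a c z \<beta> .
  show ?thesis
    unfolding P.semirigid_trinomial_algebra_iff by (rule P.semirigid_coord_ring_0[OF i0 c(2,3)])
qed

section \<open>Rigidity and semirigidity in the presence of variables
  \<open>S\<^sub>k\<close>\<close>

lemma S_lnd:
  assumes k: "k \<in> {1..d}"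
  shows "\<exists>\<delta>. nonzero_lnd alg_K (alg_R d) \<delta> \<and>
    (\<forall>x\<in>tvars r n d. \<delta> (var_class d x) = \<zero>\<^bsub>alg_R d\<^esub> \<longleftrightarrow> x \<noteq> S k)"
proof -
  obtain z \<beta> where "trinomial_point r n l a (\<lambda>_. 1) z \<beta>" by (rule default_point)
  then interpret P: trinomial_point r n l a "\<lambda>_. 1" z \<beta> .
  obtain \<delta> where \<delta>: "P.coord_lnd d \<delta>"
    "\<And>x. x \<in> tvars r n d \<Longrightarrow> \<delta> (P.gen x) = 0 \<longleftrightarrow> x \<noteq> S k"
    using P.S_lnd_exists[OF k] by blast
  have Sk: "S k \<in> tvars r n d" using k unfolding tvars_def by blast
  hence "\<delta> (P.gen (S k)) \<noteq> 0" using \<delta>(2) by blast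
  from P.lnd_trinomial_algebra[OF \<delta>(1) P.gen_in[OF Sk] this]
  obtain \<delta>' where \<delta>': "nonzero_lnd alg_K (alg_R d) \<delta>'"
    "\<And>x. x \<in> tvars r n d \<Longrightarrow> \<delta>' (var_class d x) = \<zero>\<^bsub>alg_R d\<^esub> \<longleftrightarrow> \<delta> (P.gen x) = 0" by blast
  show ?thesis
  proof (intro exI[of _ \<delta>'] conjI ballI)
    fix x assume x: "x \<in> tvars r n d"
    show "\<delta>' (var_class d x) = \<zero>\<^bsub>alg_R d\<^esub> \<longleftrightarrow> x \<noteq> S k" by (simp only: \<delta>'(2)[OF x] \<delta>(2)[OF x])
  qed (fact \<delta>'(1))
qed

lemma not_rigid_if_S: "d > 0 \<Longrightarrow> \<not> rigid alg_K (alg_R d)"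
  using S_lnd[of 1 d] unfolding rigid_def by auto

lemma not_semirigid_if_two_S:
  assumes "d \<ge> 2"
  shows "\<not> semirigid alg_K (alg_R d)"
proof
  assume sr: "semirigid alg_K (alg_R d)"
  obtain \<delta> where \<delta>: "nonzero_lnd alg_K (alg_R d) \<delta>"
    "\<And>x. x \<in> tvars r n d \<Longrightarrow> \<delta> (var_class d x) = \<zero>\<^bsub>alg_R d\<^esub> \<longleftrightarrow> x \<noteq> S 1"
    using S_lnd[of 1 d] assms by auto
  obtain \<delta>' where \<delta>': "nonzero_lnd alg_K (alg_R d) \<delta>'"
    "\<And>x. x \<in> tvars r n d \<Longrightarrow> \<delta>' (var_class d x) = \<zero>\<^bsub>alg_R d\<^esub> \<longleftrightarrow> x \<noteq> S 2"
    using S_lnd[of 2 d] assms by auto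
  have S1: "S 1 \<in> tvars r n d" using assms unfolding tvars_def by auto
  from semirigid_kernel_iff[OF sr \<delta>(1) \<delta>'(1) var_class_in[OF S1]]
  show False unfolding \<delta>(2)[OF S1] \<delta>'(2)[OF S1] by simp
qed

lemma semirigid_1_iff: "semirigid alg_K (alg_R 1) \<longleftrightarrow> rigid alg_K (alg_R 0)"
proof -
  obtain z \<beta> where "trinomial_point r n l a (\<lambda>_. 1) z \<beta>" by (rule default_point)
  then interpret P: trinomial_point r n l a "\<lambda>_. 1" z \<beta> .
  show ?thesis
  proof
    assume rig: "rigid alg_K (alg_R 0)"
    show "semirigid alg_K (alg_R 1)"
      unfolding P.semirigid_trinomial_algebra_iff
      by (rule P.semirigid_coord_ring_1[OF rig[unfolded P.rigid_trinomial_algebra_iff]])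
  next
    assume "semirigid alg_K (alg_R 1)"
    note sr = this[unfolded P.semirigid_trinomial_algebra_iff P.alg.semirigid_subalgebra_module_iff, rule_format]
    have S1: "S 1 \<in> tvars r n 1" unfolding P.tvars_1 by (rule insertI1)
    obtain \<delta>' where \<delta>': "P.coord_lnd 1 \<delta>'"
      "\<And>x. x \<in> tvars r n 1 \<Longrightarrow> \<delta>' (P.gen x) = 0 \<longleftrightarrow> x \<noteq> S 1"
    proof -
      have "(1 :: nat) \<in> {1..1}" by simp
      from P.S_lnd_exists[OF this] show thesis using that by blast
    qed
    have nz: "\<delta>' (P.gen (S 1)) \<noteq> 0" using \<delta>'(2)[OF S1] by simp
    show "rigid alg_K (alg_R 0)"
      unfolding P.rigid_trinomial_algebra_iff
    proof (intro allI impI ballI)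
      fix D f assume D: "P.coord_lnd 0 D" and f: "f \<in> P.coord_ring 0"
      obtain \<delta> where \<delta>: "P.coord_lnd 1 \<delta>" "\<delta> (P.gen (S 1)) = 0"
        "\<And>f. f \<in> P.coord_ring 0 \<Longrightarrow> \<delta> f = D f"
        using P.lnd_extends[OF D] by blast
      show "D f = 0"
      proof (rule ccontr)
        assume "D f \<noteq> 0"
        hence "\<delta> f \<noteq> 0" using \<delta>(3)[OF f] by simp
        from sr[OF \<delta>(1) bexI[of "\<lambda>f. \<delta> f \<noteq> 0", OF this subsetD[OF P.coord_ring_0_subset f]]
            \<delta>'(1) bexI[of "\<lambda>f. \<delta>' f \<noteq> 0", OF nz P.gen_in[OF S1]] P.gen_in[OF S1]]
        have "\<delta>' (P.gen (S 1)) = 0" using \<delta>(2) by (rule iffD1)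
        with nz show False by contradiction
      qed
    qed
  qed
qed

end

theorem corollary3p2:
  fixes r d :: nat
    and n :: "nat \<Rightarrow> nat"
    and l :: "nat \<Rightarrow> nat \<Rightarrow> nat"
    and a :: "nat \<Rightarrow> 'k::{alg_closed_field, field_char_0}"
  defines "K \<equiv> (ring_of_type_algebra :: 'k ring)"
  assumes "r \<ge> 2"
    and "\<And>i. i \<in> {1..r} \<Longrightarrow> n i \<ge> 1"
    and "\<And>i j. i \<in> {1..r} \<Longrightarrow> j \<in> {1..n i} \<Longrightarrow> l i j \<ge> 1"
    and "inj_on a {1..r}"
    and not_affine_line: "\<not> (d = 0 \<and> (\<forall>i\<in>{1..r}. n i = 1 \<and> l i 1 = 1))"
  shows "semirigid K (trinomial_algebra r n l a d) \<longleftrightarrow>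
      rigid K (trinomial_algebra r n l a d)
    \<or> (d = 1 \<and> rigid K (trinomial_algebra r n l a 0))
    \<or> (d = 0 \<and> (\<exists>i0\<in>{1..r}. n i0 = 1 \<and> l i0 1 > 1 \<and>
          (\<forall>i\<in>{1..r} - {i0}. \<exists>c\<in>{1..n i}. l i c = 1 \<and>
             (\<forall>j\<in>{1..n i} - {c}. l i j > 1))))"
proof -
  interpret trinomial_data r n l a by unfold_locales (fact assms)+
  consider "d = 0" | "d = 1" | "d \<ge> 2" by linarith
  thus ?thesis
  proof cases
    case 1
    have line: "\<not> (\<forall>i\<in>{1..r}. n i = 1 \<and> l i 1 = 1)" using not_affine_line 1 by simp
    have "semirigid alg_K (alg_R 0) \<longleftrightarrow> rigid alg_K (alg_R 0) \<or> single_root"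
    proof (rule iffI)
      assume sr: "semirigid alg_K (alg_R 0)"
      show "rigid alg_K (alg_R 0) \<or> single_root"
      proof (cases "rigid alg_K (alg_R 0)")
        case True
        thus ?thesis by (rule disjI1)
      next
        case False
        from single_root_if_semirigid[OF sr this line] show ?thesis by (rule disjI2)
      qed
    next
      assume "rigid alg_K (alg_R 0) \<or> single_root"
      thus "semirigid alg_K (alg_R 0)"
      proof
        assume "rigid alg_K (alg_R 0)"
        thus ?thesis unfolding rigid_def semirigid_def by blast
      qed (rule semirigid_if_single_root)
    qed
    thus ?thesis unfolding K_def 1 by simp
  next
    case 2
    \<comment> \<open>The derivation \<open>\<partial>/\<partial>S\<^sub>1\<close> rules out the
      first alternative, leaving the one about rigidity without \<open>S\<^sub>1\<close>.\<close>
    have "\<not> rigid alg_K (alg_R 1)" by (rule not_rigid_if_S) simp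
    thus ?thesis unfolding K_def 2 semirigid_1_iff by simp
  next
    case 3
    thus ?thesis unfolding K_def using not_rigid_if_S[of d] not_semirigid_if_two_S[OF 3] by simp
  qed
qed

end
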